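(* Let $P_{\Omega,z}=\frac{\partial^N}{\partial z^N}+a_2(\Omega,z)\frac{\partial^{N-2}}{\partial z^{N-2}}+\cdots+a_N(\Omega,z)$ be a differential operator as described in the context. (1) There exists a unique formal solution $\Psi(\Omega,(z,[\gamma]),w,\lambda)$ of the differential equation $P_{\Omega,z}u=\lambda^Nu$ in the form $$\Psi(\Omega,(z,[\gamma]),w,\lambda)=\Big(\sum_{s=0}^\infty\xi_s(\Omega,(z,[\gamma]),w)\lambda^{-s}\Big)e^{\lambda(z-w)}$$ such that $\xi_0(\Omega,(z,[\gamma]),w)\equiv1$ and $\xi_s(\Omega,(w,[id]),w)=0$ for $s\ge1$. Here $\Omega\mapsto\xi_s(\Omega,(z,[\gamma]),w)$ are holomorphic for generic $((z,[\gamma]),w)$. Moreover, for fixed $\Omega\in\mathbb{H}_n^g$, $((z,[\gamma]),w)\mapsto\xi_s(\Omega,(z,[\gamma]),w)$ are locally holomorphic. (2) For any $\alpha\in\Gamma$, $$\Psi\Big(\alpha(\Omega),\Big(\frac{z}{j_\alpha(\Omega)},\Big[\frac{\gamma}{j_\alpha(\Omega)}\Big]\Big),\frac{w}{j_\alpha(\Omega)},j_\alpha(\Omega)\lambda\Big)=\Psi(\Omega,(z,[\gamma]),w,\lambda),$$ and the functions $\xi_s$ satisfy the transformation law $$\xi_s\Big(\alpha(\Omega),\Big(\frac{z}{j_\alpha(\Omega)},\Big[\frac{\gamma}{j_\alpha(\Omega)}\Big]\Big),\frac{w}{j_\alpha(\Omega)}\Big)=j_\alpha(\Omega)^s\,\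xi_s(\Omega,(z,[\gamma]),w).$$
   Context: $F$ is a totally real number field with $[F:\mathbb{Q}]=g$ and distinct embeddings $\varphi_1,\dots,\varphi_g:F\hookrightarrow\mathbb{R}$. $Sp(n,A)=\{\alpha\in GL(2n,A)\mid {}^t\alpha J\alpha=J\}$, $J=\begin{pmatrix}0&-I_n\\ I_n&0\end{pmatrix}$. $\mathbb{H}_n=\{\Omega\in M_n(\mathbb{C})\mid {}^t\Omega=\Omega,\ \mathrm{Im}(\Omega)>0\}$. $Sp(n,F)$ is embedded in $Sp(n,\mathbb{R})^g$ by $\alpha\mapsto(\alpha^{\varphi_1},\dots,\alpha^{\varphi_g})$ and acts on $\mathbb{H}_n^g$ by $\alpha(\Omega)=(\alpha^{\varphi_1}(\Omega_1),\dots,\alpha^{\varphi_g}(\Omega_g))$, where $\begin{pmatrix}A&B\\C&D\end{pmatrix}(\Omega)=(A\Omega+B)(C\Omega+D)^{-1}$. Put $j_\alpha(\Omega)=\prod_{\nu=1}^g\det(C^{\varphi_\nu}\Omega_\nu+D^{\varphi_\nu})$ (which is nonzero). A congruence subgroup $\Gamma$ of $Sp(n,F)$ is a subgroup containing, with finite index, some $\Gamma(\mathfrak{c})=\{\alpha\in Sp(n,\mathfrak{O}_F)\mid\alpha-I_{2n}\in\mathfrak{c}M(2n,\mathfrak{O}_F)\}$, $\mathfrak{c}$ an ideal of the ring of integers $\mathfrak{O}_F$. Fix such a $\Gamma$. The coefficients $a_l(\Omega,z)$ ($l=2,\dots,N$) are functions of $\Omega\in\mathbb{H}_n^g$, $z\in\mathbb{C}$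 such that $\Omega\mapsto a_l(\Omega,z)$ is holomorphic for generic $z$; for fixed $\Omega$, $z\mapsto a_l(\Omega,z)$ is analytic with at most poles; and $a_l(\alpha(\Omega),z/j_\alpha(\Omega))=j_\alpha(\Omega)^la_l(\Omega,z)$ for all $\alpha\in\Gamma$. $\mathcal{N}_\Omega\subset\mathbb{C}$ is the union of the pole sets of $z\mapsto a_l(\Omega,z)$, $l=2,\dots,N$. $\mathfrak{X}_\Omega$ is the universal covering of $\mathbb{C}-\mathcal{N}_\Omega$; with base point $w\in\mathbb{C}-\mathcal{N}_\Omega$, its points are written $(z,[\gamma])$, where $\gamma$ is an arc in $\mathbb{C}-\mathcal{N}_\Omega$ from $w$ to $z$ and $[\gamma]$ its homotopy class; $(w,[id])$ is the point given by the constant arc, and $z$ is a local coordinate. For an arc $\gamma$ in $\mathbb{C}-\mathcal{N}_\Omega$, $\gamma/j_\alpha(\Omega)$ is the arc $t\mapsto\gamma(t)/j_\alpha(\Omega)$, which lies in $\mathbb{C}-\mathcal{N}_{\alpha(\Omega)}$. "Formal solution" means that the equation holds after termwise differentiation by comparing the coefficients of all powers of $\lambda$ (after cancelling $e^{\lambda(z-w)}$). *)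

theory Defs
  imports
    "HOL-Complex_Analysis.Complex_Analysis"
    "HOL-Algebra.Ideal"
    "HOL-Algebra.Coset"
begin

subsection \<open>Totally real number fields\<close>

definition field_embedding :: "('f::field \<Rightarrow> 'k::field) \<Rightarrow> bool" where
  "field_embedding \<sigma> \<longleftrightarrow> \<sigma> 1 = 1 \<and> (\<forall>x y. \<sigma> (x + y) = \<sigma> x + \<sigma> y \<and> \<sigma> (x * y) = \<sigma> x * \<sigma> y)"

definition rat_scale :: "rat \<Rightarrow> 'f::field_char_0 \<Rightarrow> 'f" where
  "rat_scale q x = of_rat q * x"

definition number_field :: "'f::field_char_0 itself \<Rightarrow> bool" where
  "number_field _ \<longleftrightarrow> (\<exists>B::'f set. finite_dimensional_vector_space rat_scale B)"

definition field_degree :: "'f::field_char_0 itself \<Rightarrow> nat" where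
  "field_degree _ = vector_space.dim rat_scale (UNIV :: 'f set)"

definition totally_real :: "'f::field_char_0 itself \<Rightarrow> bool" where
  "totally_real _ \<longleftrightarrow> (\<forall>\<sigma>::'f \<Rightarrow> complex. field_embedding \<sigma> \<longrightarrow> range \<sigma> \<subseteq> \<real>)"

definition integer_ring :: "'f::field_char_0 ring" where
  "integer_ring = \<lparr>carrier = {x. algebraic_int x}, monoid.mult = (*), one = 1, zero = 0, add = (+)\<rparr>"


subsection \<open>Symplectic groups and congruence subgroups\<close>

text \<open>The index type \<open>'n + 'n\<close> of a matrix of size \<open>2n\<close> exhibits its four blocks.\<close>

type_synonym ('a, 'n) mat2 = "'a ^ ('n + 'n) ^ ('n + 'n)"

definition blockA :: "('a, 'n::finite) mat2 \<Rightarrow> 'a ^ 'n ^ 'n" where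
  "blockA M = (\<chi> i j. M $ Inl i $ Inl j)"
definition blockB :: "('a, 'n::finite) mat2 \<Rightarrow> 'a ^ 'n ^ 'n" where
  "blockB M = (\<chi> i j. M $ Inl i $ Inr j)"
definition blockC :: "('a, 'n::finite) mat2 \<Rightarrow> 'a ^ 'n ^ 'n" where
  "blockC M = (\<chi> i j. M $ Inr i $ Inl j)"
definition blockD :: "('a, 'n::finite) mat2 \<Rightarrow> 'a ^ 'n ^ 'n" where
  "blockD M = (\<chi> i j. M $ Inr i $ Inr j)"

definition sympl_form :: "('a::ring_1, 'n::finite) mat2" where
  "sympl_form = (\<chi> i j. case (i, j) of
      (Inl k, Inr l) \<Rightarrow> (if k = l then - 1 else 0)
    | (Inr k, Inl l) \<Rightarrow> (if k = l then 1 else 0)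
    | _ \<Rightarrow> 0)"

text \<open>\<open>Sp(n, A)\<close> for a subring \<open>A\<close> of the ambient field.\<close>

definition Sp :: "'f::field set \<Rightarrow> ('f, 'n::finite) mat2 set" where
  "Sp A = {M. (\<forall>i j. M $ i $ j \<in> A) \<and>
      (\<exists>M'. (\<forall>i j. M' $ i $ j \<in> A) \<and> M ** M' = mat 1 \<and> M' ** M = mat 1) \<and>
      transpose M ** sympl_form ** M = sympl_form}"

definition Sp_group :: "('f::field, 'n::finite) mat2 monoid" where
  "Sp_group = \<lparr>carrier = Sp UNIV, monoid.mult = (**), one = mat 1\<rparr>"

definition principal_congruence :: "'f::field_char_0 set \<Rightarrow> ('f, 'n::finite) mat2 set" where
  "principal_congruence \<cc> =
    {M \<in> Sp (carrier integer_ring). \<forall>i j. (M - mat 1) $ i $ j \<in> \<cc>}"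

definition congruence_subgroup :: "('f::field_char_0, 'n::finite) mat2 set \<Rightarrow> bool" where
  "congruence_subgroup \<Gamma> \<longleftrightarrow> subgroup \<Gamma> Sp_group \<and>
    (\<exists>\<cc>. ideal \<cc> integer_ring \<and> principal_congruence \<cc> \<subseteq> \<Gamma> \<and>
      finite (rcosets\<^bsub>Sp_group\<lparr>carrier := \<Gamma>\<rparr>\<^esub> (principal_congruence \<cc>)))"


subsection \<open>The action on the product of Siegel upper half spaces\<close>

definition siegel :: "(complex ^ 'n ^ 'n::finite) set" where
  "siegel = {Z. transpose Z = Z \<and>
      (\<forall>v::real ^ 'n. v \<noteq> 0 \<longrightarrow> v \<bullet> ((\<chi> i j. Im (Z $ i $ j)) *v v) > 0)}"

type_synonym ('n, 'g) periods = "complex ^ 'n ^ 'n ^ 'g"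

definition siegel_prod :: "('n::finite, 'g::finite) periods set" where
  "siegel_prod = {\<Omega>. \<forall>\<nu>. \<Omega> $ \<nu> \<in> siegel}"

definition conj_mat :: "('f \<Rightarrow> real) \<Rightarrow> ('f, 'n::finite) mat2 \<Rightarrow> (complex, 'n) mat2" where
  "conj_mat \<sigma> M = (\<chi> i j. complex_of_real (\<sigma> (M $ i $ j)))"

definition moebius_mat :: "(complex, 'n::finite) mat2 \<Rightarrow> complex ^ 'n ^ 'n \<Rightarrow> complex ^ 'n ^ 'n" where
  "moebius_mat M Z = (blockA M ** Z + blockB M) ** matrix_inv (blockC M ** Z + blockD M)"

definition Sp_act ::
  "('g::finite \<Rightarrow> 'f \<Rightarrow> real) \<Rightarrow> ('f, 'n::finite) mat2 \<Rightarrow> ('n, 'g) periods \<Rightarrow> ('n, 'g) periods" where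
  "Sp_act \<phi> \<alpha> \<Omega> = (\<chi> \<nu>. moebius_mat (conj_mat (\<phi> \<nu>) \<alpha>) (\<Omega> $ \<nu>))"

definition aut_factor ::
  "('g::finite \<Rightarrow> 'f \<Rightarrow> real) \<Rightarrow> ('f, 'n::finite) mat2 \<Rightarrow> ('n, 'g) periods \<Rightarrow> complex" where
  "aut_factor \<phi> \<alpha> \<Omega> =
    (\<Prod>\<nu>\<in>UNIV. det (blockC (conj_mat (\<phi> \<nu>) \<alpha>) ** \<Omega> $ \<nu> + blockD (conj_mat (\<phi> \<nu>) \<alpha>)))"


subsection \<open>Holomorphic functions of several variables\<close>

text \<open>
  \<open>siegel_prod\<close> is open in the complex subspace of tuples of symmetric matrices, not in the whole
  matrix space, so the derivative is taken within it. A complex linear form on that subspace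
  extends to the whole space, whence the shape of the derivative. The sets \<open>U\<close> of interest are
  relatively open in \<open>siegel_prod\<close>.
\<close>

definition holomorphic_periods ::
  "(('n::finite, 'g::finite) periods \<Rightarrow> complex) \<Rightarrow> ('n, 'g) periods set \<Rightarrow> bool" where
  "holomorphic_periods f U \<longleftrightarrow> (\<forall>\<Omega>\<in>U. \<exists>c :: ('n, 'g) periods.
     (f has_derivative (\<lambda>H. \<Sum>\<nu>\<in>UNIV. \<Sum>i\<in>UNIV. \<Sum>j\<in>UNIV. c $ \<nu> $ i $ j * H $ \<nu> $ i $ j))
       (at \<Omega> within siegel_prod))"

definition holomorphic_two :: "(complex \<times> complex \<Rightarrow> complex) \<Rightarrow> (complex \<times> complex) set \<Rightarrow> bool" where
  "holomorphic_two f U \<longleftrightarrow> (\<forall>x\<in>U. \<exists>A B.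
     (f has_derivative (\<lambda>h. A * fst h + B * snd h)) (at x))"


subsection \<open>Pole sets of the coefficients\<close>

definition meromorphic_plane :: "(complex \<Rightarrow> complex) \<Rightarrow> bool" where
  "meromorphic_plane f \<longleftrightarrow> f meromorphic_on UNIV \<and> (\<forall>z. \<not> is_pole f z \<longrightarrow> f analytic_on {z})"

definition pole_set :: "nat \<Rightarrow> (nat \<Rightarrow> 'o \<Rightarrow> complex \<Rightarrow> complex) \<Rightarrow> 'o \<Rightarrow> complex set" where
  "pole_set N a \<Omega> = (\<Union>l\<in>{2..N}. {z. is_pole (a l \<Omega>) z})"

text \<open>
  The pole sets move with \<open>\<Omega>\<close>, so ``generic \<open>z\<close>'' is understood relative to \<open>\<Omega>\<close>: the pair
  \<open>(\<Omega>, z)\<close> has a neighbourhood that does not meet the poles. The pole at \<open>z = \<Omega>\<close> of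
  \<open>\<Omega> / (z - \<Omega>)\<close>, which disappears for \<open>\<Omega> = 0\<close> (\<open>\<Omega>\<close> a scalar here), shows that this may exclude
  more values of \<open>z\<close> than \<open>pole_set\<close>. Coefficients are holomorphic for generic \<open>z\<close> if for each
  \<open>\<Omega>\<close> only a discrete closed set of \<open>z\<close> is not generic, and they are holomorphic in \<open>\<Omega>\<close> wherever
  \<open>z\<close> is generic.
\<close>

definition generic_locus ::
  "nat \<Rightarrow> (nat \<Rightarrow> ('n::finite, 'g::finite) periods \<Rightarrow> complex \<Rightarrow> complex) \<Rightarrow>
    (('n, 'g) periods \<times> complex) set" where
  "generic_locus N a = {(\<Omega>, z). \<Omega> \<in> siegel_prod \<and>
     (\<exists>T. open T \<and> (\<Omega>, z) \<in> T \<and>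
       (\<forall>(\<Omega>', z')\<in>T. \<Omega>' \<in> siegel_prod \<longrightarrow> z' \<notin> pole_set N a \<Omega>'))}"

definition holomorphic_for_generic_z ::
  "nat \<Rightarrow> (nat \<Rightarrow> ('n::finite, 'g::finite) periods \<Rightarrow> complex \<Rightarrow> complex) \<Rightarrow> bool" where
  "holomorphic_for_generic_z N a \<longleftrightarrow>
     (\<forall>\<Omega>\<in>siegel_prod. \<forall>x. \<not> x islimpt {z. (\<Omega>, z) \<notin> generic_locus N a}) \<and>
     (\<forall>l\<in>{2..N}. \<forall>z. holomorphic_periods (\<lambda>\<Omega>. a l \<Omega> z) {\<Omega>. (\<Omega>, z) \<in> generic_locus N a})"


subsection \<open>The universal covering\<close>

definition path_class :: "complex set \<Rightarrow> (real \<Rightarrow> complex) \<Rightarrow> (real \<Rightarrow> complex) set" where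
  "path_class S \<gamma> = {\<delta>. homotopic_paths S \<gamma> \<delta>}"

definition arc_in :: "complex set \<Rightarrow> complex \<Rightarrow> complex \<Rightarrow> (real \<Rightarrow> complex) \<Rightarrow> bool" where
  "arc_in S w z \<gamma> \<longleftrightarrow> path \<gamma> \<and> path_image \<gamma> \<subseteq> S \<and> pathstart \<gamma> = w \<and> pathfinish \<gamma> = z"

type_synonym cover_point = "complex \<times> (real \<Rightarrow> complex) set"

definition univ_cover :: "complex set \<Rightarrow> complex \<Rightarrow> cover_point set" where
  "univ_cover S w = {(z, path_class S \<gamma>) | z \<gamma>. arc_in S w z \<gamma>}"

text \<open>
  \<open>sheet S p\<close> is the inverse of the local coordinate at \<open>p\<close>: a nearby \<open>z\<close> is reached by following
  an arc that represents \<open>p\<close> and then a straight segment. In \<open>sheet_base\<close> the base point moves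
  from \<open>w\<close> to a nearby \<open>w'\<close> as well. Both are meaningful only near \<open>fst p\<close> and \<open>w\<close>, where the
  segments lie in \<open>S\<close>.
\<close>

definition sheet :: "complex set \<Rightarrow> cover_point \<Rightarrow> complex \<Rightarrow> cover_point" where
  "sheet S p z = (z, {\<delta>. \<exists>\<gamma>\<in>snd p. homotopic_paths S (\<gamma> +++ linepath (fst p) z) \<delta>})"

definition sheet_base ::
  "complex set \<Rightarrow> complex \<Rightarrow> cover_point \<Rightarrow> complex \<Rightarrow> complex \<Rightarrow> cover_point" where
  "sheet_base S w p w' z =
    (z, {\<delta>. \<exists>\<gamma>\<in>snd p. homotopic_paths S (linepath w' w +++ (\<gamma> +++ linepath (fst p) z)) \<delta>})"

definition cover_holomorphic ::
  "complex set \<Rightarrow> complex \<Rightarrow> (cover_point \<Rightarrow> complex) \<Rightarrow> bool" where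
  "cover_holomorphic S w h \<longleftrightarrow>
     (\<forall>p\<in>univ_cover S w. (\<lambda>z. h (sheet S p z)) analytic_on {fst p})"

definition cover_deriv ::
  "complex set \<Rightarrow> (cover_point \<Rightarrow> complex) \<Rightarrow> cover_point \<Rightarrow> complex" where
  "cover_deriv S h p = deriv (\<lambda>z. h (sheet S p z)) (fst p)"

definition locally_holomorphic_in_both ::
  "complex set \<Rightarrow> (cover_point \<Rightarrow> complex \<Rightarrow> complex) \<Rightarrow> bool" where
  "locally_holomorphic_in_both S h \<longleftrightarrow>
     (\<forall>w\<in>S. \<forall>p\<in>univ_cover S w. \<exists>\<epsilon>>0. ball (fst p) \<epsilon> \<subseteq> S \<and> ball w \<epsilon> \<subseteq> S \<and>
        holomorphic_two (\<lambda>(z, w'). h (sheet_base S w p w' z) w') (ball (fst p) \<epsilon> \<times> ball w \<epsilon>))"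


subsection \<open>Formal solutions\<close>

text \<open>The pair \<open>(c, b)\<close> stands for the formal expression \<open>(\<Sum>k. c k * \<lambda>^k) * exp (\<lambda> * b)\<close>.\<close>

type_synonym formal_exp = "(int \<Rightarrow> complex) \<times> complex"

text \<open>Termwise differentiation, \<open>d/dz (c e^{\<lambda> b}) = (c' + \<lambda> b' c) e^{\<lambda> b}\<close>.\<close>

definition formal_deriv ::
  "complex set \<Rightarrow> (cover_point \<Rightarrow> formal_exp) \<Rightarrow> cover_point \<Rightarrow> formal_exp" where
  "formal_deriv S u p =
    (\<lambda>k. cover_deriv S (\<lambda>q. fst (u q) k) p
          + cover_deriv S (\<lambda>q. snd (u q)) p * fst (u p) (k - 1),
     snd (u p))"

text \<open>The substitution of \<open>\<mu> * \<lambda>\<close> for \<open>\<lambda>\<close>.\<close>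

definition formal_subst :: "complex \<Rightarrow> formal_exp \<Rightarrow> formal_exp" where
  "formal_subst \<mu> u = (\<lambda>k. fst u k * \<mu> powi k, \<mu> * snd u)"

text \<open>The expression \<open>(\<Sum>s. \<xi> s p * \<lambda>^(-s)) * exp (\<lambda> * (z - w))\<close> at \<open>p = (z, [\<gamma>])\<close>.\<close>

definition Psi :: "complex \<Rightarrow> (nat \<Rightarrow> cover_point \<Rightarrow> complex) \<Rightarrow> cover_point \<Rightarrow> formal_exp" where
  "Psi w \<xi> p = (\<lambda>k. if k \<le> 0 then \<xi> (nat (- k)) p else 0, fst p - w)"

text \<open>
  The equation \<open>u^(N) + A 2 u^(N-2) + ... + A N u = \<lambda>^N u\<close> on the covering, coefficient by
  coefficient; all terms carry the same exponential.
\<close>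

definition solves_formally ::
  "nat \<Rightarrow> (nat \<Rightarrow> complex \<Rightarrow> complex) \<Rightarrow> complex set \<Rightarrow> complex \<Rightarrow>
    (cover_point \<Rightarrow> formal_exp) \<Rightarrow> bool" where
  "solves_formally N A S w u \<longleftrightarrow>
     (\<forall>p\<in>univ_cover S w. \<forall>k.
        fst ((formal_deriv S ^^ N) u p) k
          + (\<Sum>l=2..N. A l (fst p) * fst ((formal_deriv S ^^ (N - l)) u p) k)
        = fst (u p) (k - int N))"

definition normalized_formal_solution ::
  "nat \<Rightarrow> (nat \<Rightarrow> complex \<Rightarrow> complex) \<Rightarrow> complex set \<Rightarrow> complex \<Rightarrow>
    (nat \<Rightarrow> cover_point \<Rightarrow> complex) \<Rightarrow> bool" where
  "normalized_formal_solution N A S w \<xi> \<longleftrightarrow>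
     (\<forall>s. cover_holomorphic S w (\<xi> s)) \<and>
     solves_formally N A S w (Psi w \<xi>) \<and>
     (\<forall>p\<in>univ_cover S w. \<xi> 0 p = 1) \<and>
     (\<forall>s\<ge>1. \<xi> s (w, path_class S (\<lambda>t. w)) = 0)"

end

theory Submission
  imports Defs
begin

text \<open>
  A formal solution \<open>u = (\<Sum>s. \<xi>\<^sub>s \<lambda>^(-s)) e^(\<lambda>(z - w))\<close> has a single-valued logarithmic derivative
  \<open>u' / u = \<lambda> + \<chi>\<^sub>1 \<lambda>^(-1) + \<dots>\<close>: the coefficients \<open>\<chi>\<^sub>s\<close> are determined algebraically by a Riccati
  recursion and are differential polynomials in the coefficients \<open>a\<^sub>l\<close>. Hence \<open>\<xi>\<^sub>s\<close> is the coefficient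
  of \<open>\<lambda>^(-s)\<close> in the exponential of \<open>\<Sum>s. \<lambda>^(-s) \<integral>\<^sub>\<gamma> \<chi>\<^sub>s\<close>, and homotopy invariance, analyticity in
  \<open>(z, w)\<close> and the transformation law reduce to the corresponding facts for contour integrals. For
  uniqueness, the first coefficient in which two solutions differ would have derivative zero.

  The coefficients are only assumed to be holomorphic in \<open>\<Omega>\<close> and in \<open>z\<close> separately, so that
  holomorphy of \<open>\<integral>\<^sub>\<gamma> \<chi>\<^sub>s\<close> in \<open>\<Omega>\<close> rests on Hartogs's theorem: separate holomorphy implies local
  boundedness, after which one may differentiate under the integral sign.
\<close>

subsection \<open>The mean value inequality for powers of holomorphic functions\<close>

text \<open>The absence of a derivative of order N - 1 makes the first Riccati coefficient vanish,
  so that u'/u - \<lambda> has no constant term; this is what permits the leading coefficient 1 of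
  the solution. If d/dz has weight 1 and a_l weight l, every Riccati coefficient is isobaric, and
  the automorphy law passes through the recursion and the integrals by counting powers of j.

  Two obstacles concern \<Omega>. The covering itself varies with \<Omega>, so a path of integration
  must be found that serves all nearby periods. And \<open>siegel_prod\<close> is open only among
  symmetric matrices; functions on it are therefore composed with the symmetrization
  \<open>symm\<close>, which gives functions on open sets of the full matrix space.

  Hartogs's theorem comes from Baire's theorem and a lemma on Taylor coefficients c_n. The usual
  subharmonic functions log |c_n| / n are replaced by the powers |c_n|^(1/n): these stay finite at
  zeros and are bounded from both sides, so that dominated convergence applies directly.\<close>

lemma circle_mean_value:
  assumes G: "G holomorphic_on cball 0 r" and r: "0 < r"
  shows "((\<lambda>t. G (of_real r * exp (2 * of_real pi * \<i> * of_real t))) has_integral G 0) {0..1}"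
proof -
  have "((\<lambda>u. G u / (u - 0)) has_contour_integral 2 * of_real pi * \<i> * G 0) (circlepath 0 r)"
    using r by (intro Cauchy_integral_circlepath_simple[OF G]) auto
  then have "((\<lambda>t. G (circlepath 0 r t) / circlepath 0 r t *
      vector_derivative (circlepath 0 r) (at t within {0..1})) has_integral 2 * of_real pi * \<i> * G 0) {0..1}"
    by (simp add: has_contour_integral_def)
  then have "((\<lambda>t. 2 * of_real pi * \<i> * G (of_real r * exp (2 * of_real pi * \<i> * of_real t)))
      has_integral 2 * of_real pi * \<i> * G 0) {0..1}"
    by (rule has_integral_eq[rotated])
      (use r in \<open>simp add: vector_derivative_circlepath01, simp add: circlepath field_simps\<close>)
  from has_integral_mult_right[OF this, of "1 / (2 * of_real pi * \<i>)"] show ?thesis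
    by (simp add: mult.assoc[symmetric])
qed

lemma norm_exp_turn [simp]: "norm (exp (2 * complex_of_real pi * \<i> * of_real t)) = 1"
  by (metis mult.commute mult.left_commute norm_exp_i_times of_real_mult of_real_numeral)

text \<open>With a holomorphic logarithm h of f on the open disc, |f| powr p is the absolute value
  of the holomorphic function exp(p h), which has the mean value property. Zeros are allowed on the
  unit circle, so the argument runs on circles of radius r < 1 and ends with r tending to 1.\<close>

lemma powr_circle_mean_zero_free:
  assumes f: "f holomorphic_on ball 0 R" and R: "1 < R" and p: "0 < p"
    and nz: "\<And>z. norm z < 1 \<Longrightarrow> f z \<noteq> 0"
  shows "norm (f 0) powr p \<le> integral {0..1} (\<lambda>t. norm (f (exp (2 * of_real pi * \<i> * of_real t))) powr p)"
proof -
  define E where "E = (\<lambda>t. exp (2 * complex_of_real pi * \<i> * of_real t))"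
  define I where "I = (\<lambda>r. integral {0..1} (\<lambda>t. norm (f (of_real r * E t)) powr p))"
  obtain h where h: "h holomorphic_on ball 0 1" "\<And>z. z \<in> ball 0 1 \<Longrightarrow> f z = exp (h z)"
  proof (rule contractible_imp_holomorphic_log[of f "ball 0 1"])
    show "f holomorphic_on ball 0 1" by (rule holomorphic_on_subset[OF f]) (use R in auto)
  qed (use nz in \<open>auto intro: convex_imp_contractible\<close>)
  have contf: "continuous_on (cball 0 1) f"
    by (rule holomorphic_on_imp_continuous_on[OF holomorphic_on_subset[OF f]]) (use R in auto)
  have cont: "continuous_on ({0..1} \<times> {0..1}) (\<lambda>(r, t). norm (f (of_real r * E t)) powr p)"
    unfolding case_prod_unfold E_def
    by (intro continuous_on_powr' continuous_intros continuous_on_compose2[OF contf])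
       (use p in \<open>auto simp: norm_mult\<close>)
  have contI: "continuous_on {0..1} I"
    unfolding I_def using integral_continuous_on_param[of "{0..1}" 0 1 "\<lambda>r t. norm (f (of_real r * E t)) powr p"] cont
    by (simp add: case_prod_unfold)
  have le: "norm (f 0) powr p \<le> I r" if r: "r \<in> {0<..<1}" for r
  proof -
    define G where "G = (\<lambda>z. exp (of_real p * h z))"
    have G: "G holomorphic_on ball 0 1"
      unfolding G_def using h(1) by (intro holomorphic_intros)
    have G': "G holomorphic_on cball 0 r"
      by (rule holomorphic_on_subset[OF G]) (use r in auto)
    have nG: "norm (G z) = norm (f z) powr p" if "z \<in> ball 0 1" for z
      using h(2)[OF that] by (simp add: G_def powr_def)
    have *: "((\<lambda>t. G (of_real r * E t)) has_integral G 0) {0..1}"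
      unfolding E_def by (rule circle_mean_value[OF G']) (use r in auto)
    have "continuous_on {0..1} (\<lambda>t. norm (f (of_real r * E t)) powr p)"
      unfolding E_def
      by (intro continuous_on_powr' continuous_intros continuous_on_compose2[OF contf])
         (use p r in \<open>auto simp: norm_mult\<close>)
    then have "(\<lambda>t. norm (f (of_real r * E t)) powr p) integrable_on {0..1}"
      by (rule integrable_continuous_real)
    then have "norm (integral {0..1} (\<lambda>t. G (of_real r * E t))) \<le> I r"
      unfolding I_def
      by (intro integral_norm_bound_integral has_integral_integrable[OF *])
         (use r in \<open>auto simp: nG norm_mult E_def\<close>)
    then show ?thesis
      using * nG[of 0] by (simp add: integral_unique)
  qed
  have "norm (f 0) powr p \<le> I 1"
    by (rule continuous_ge_on_closure[of "{0<..<1}" I]) (use contI le in auto)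
  then show ?thesis by (simp add: I_def E_def)
qed

text \<open>Multiplication by Blaschke factors removes the zeros in the unit disc: this increases the value
  at the centre and does not change the absolute value on the circle.\<close>

lemma powr_circle_mean:
  assumes "f holomorphic_on ball 0 R" and R: "1 < R" and p: "0 < p"
  shows "norm (f 0) powr p \<le> integral {0..1} (\<lambda>t. norm (f (exp (2 * of_real pi * \<i> * of_real t))) powr p)"
proof (cases "f constant_on ball 0 R")
  case True
  then obtain c where c: "\<And>z. z \<in> ball 0 R \<Longrightarrow> f z = c" by (auto simp: constant_on_def)
  have "integral {0..1} (\<lambda>t. norm (f (exp (2 * of_real pi * \<i> * of_real t))) powr p)
      = integral {0..1} (\<lambda>t::real. norm c powr p)"
    by (rule integral_cong) (use c R in auto)
  then show ?thesis using c[of 0] R by simp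
next
  case False
  let ?Z = "\<lambda>f. {z \<in> cball 0 1. f z = (0::complex)}"
  have finZ: "finite (?Z f)"
    if "f holomorphic_on ball 0 R" "\<not> f constant_on ball 0 R" for f :: "complex \<Rightarrow> complex"
    by (rule holomorphic_compact_finite_zeros[OF that(1)]) (use R that in auto)
  \<comment> \<open>The induction carries finiteness of the zero set rather than nonconstancy,
    because division by all zeros may leave a constant function.\<close>
  have nconst: "\<not> f constant_on ball 0 R" if fin: "finite (?Z f)" and ne: "z \<in> ?Z f" for f :: "complex \<Rightarrow> complex" and z
  proof
    assume "f constant_on ball 0 R"
    then obtain c where c: "\<And>z. z \<in> ball 0 R \<Longrightarrow> f z = c" by (auto simp: constant_on_def)
    from ne c[of z] R have "c = 0" by auto
    with c R have "cball 0 1 \<subseteq> ?Z f" by auto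
    then have "finite (cball 0 1 :: complex set)" using fin finite_subset by blast
    moreover have "infinite (cball 0 1 :: complex set)"
      using uncountable_cball[of 1 "0::complex"] countable_finite by auto
    ultimately show False by blast
  qed
  have "finite (?Z f)" using finZ assms(1) False by blast
  with assms(1) show ?thesis
  \<comment> \<open>Distinct zeros are counted, since one step removes a zero together with its
    whole multiplicity \<open>n\<close>.\<close>
  proof (induction "card {z \<in> ball 0 1. f z = 0}" arbitrary: f rule: less_induct)
    case less
    show ?case
    proof (cases "\<exists>z \<in> ball 0 1. f z = 0")
      case False
      then show ?thesis
        using powr_circle_mean_zero_free[OF less.prems(1) R p] by auto
    next
      case True
      then obtain a where a: "norm a < 1" "f a = 0" by auto
      have aZ: "a \<in> ?Z f" using a by auto
      obtain g r n where g: "0 < n" "0 < r" "ball a r \<subseteq> ball 0 R" "g holomorphic_on ball a r"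
         "\<And>w. w \<in> ball a r \<Longrightarrow> f w = (w - a) ^ n * g w"
         "\<And>w. w \<in> ball a r \<Longrightarrow> g w \<noteq> 0"
        by (rule holomorphic_factor_zero_nonconstant[OF less.prems(1), of a])
           (use a R nconst[OF less.prems(2) aZ] in auto)
      define h where "h = (\<lambda>z. if z \<in> ball a r then g z else f z / (z - a) ^ n)"
      have hf: "f z = (z - a) ^ n * h z" for z
        using g(2,5) by (auto simp: h_def)
      have "h holomorphic_on (ball a r \<union> (ball 0 R - {a}))"
      proof (rule holomorphic_on_Un)
        show "h holomorphic_on ball a r"
          using g(4) by (rule holomorphic_transform) (auto simp: h_def)
        have "(\<lambda>z. f z / (z - a) ^ n) holomorphic_on ball 0 R - {a}"
          by (intro holomorphic_intros holomorphic_on_subset[OF less.prems(1)]) auto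
        then show "h holomorphic_on ball 0 R - {a}"
          by (rule holomorphic_transform) (simp add: hf)
      qed auto
      moreover have "ball a r \<union> (ball 0 R - {a}) = ball 0 R" using g(2,3) a R by auto
      ultimately have h: "h holomorphic_on ball 0 R" by simp
      \<comment> \<open>Each factor z - a of \<open>f\<close> is replaced by 1 - cnj a * z. The
        latter has no zero in the closed disc, the same absolute value on the circle, and the value
        1 at the centre, where |z - a| is less than 1.\<close>
      define F where "F = (\<lambda>z. (1 - cnj a * z) ^ n * h z)"
      have F: "F holomorphic_on ball 0 R"
        unfolding F_def by (intro holomorphic_intros h)
      have ha: "h a \<noteq> 0" using g(2,6) by (simp add: h_def)
      have nz: "1 - cnj a * z \<noteq> 0" if "norm z \<le> 1" for z
      proof
        assume "1 - cnj a * z = 0"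
        then have "norm (cnj a * z) = 1" by (metis eq_iff_diff_eq_0 norm_one)
        moreover have "norm (cnj a * z) < 1"
          using a that by (simp add: norm_mult) (metis norm_ge_zero le_less_trans mult_left_le)
        ultimately show False by simp
      qed
      have "F a \<noteq> 0"
        using nz[of a] ha a by (simp add: F_def)
      moreover have le: "F z = 0 \<Longrightarrow> f z = 0" if "norm z \<le> 1" for z
        using nz[OF that] by (simp add: F_def hf)
      ultimately have sub: "?Z F \<subseteq> ?Z f" "{z \<in> ball 0 1. F z = 0} \<subset> {z \<in> ball 0 1. f z = 0}"
        using a by auto
      have fin: "finite (?Z F)" "finite {z \<in> ball 0 1. f z = 0}"
        using sub less.prems(2) by (auto intro: finite_subset rev_finite_subset)
      have "card {z \<in> ball 0 1. F z = 0} < card {z \<in> ball 0 1. f z = 0}"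
        using sub(2) fin by (simp add: psubset_card_mono)
      from less.hyps[OF this F fin(1)]
      have IH: "norm (F 0) powr p \<le> integral {0..1} (\<lambda>t. norm (F (exp (2 * of_real pi * \<i> * of_real t))) powr p)" .
      have eq: "norm (F z) = norm (f z)" if z: "norm z = 1" for z
      proof -
        have "z * cnj z = 1" using z by (simp add: complex_norm_square[symmetric])
        then have "1 - cnj a * z = z * cnj (z - a)" by (simp add: algebra_simps)
        then have "norm (1 - cnj a * z) = norm (z - a)" using z by (metis norm_mult complex_mod_cnj mult_1)
        then show ?thesis by (simp add: F_def hf norm_mult norm_power)
      qed
      have "norm (f 0) \<le> norm (F 0)"
        using a by (simp add: hf F_def norm_mult norm_power mult_left_le_one_le power_le_one)
      then have "norm (f 0) powr p \<le> norm (F 0) powr p" using p by (intro powr_mono2) auto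
      also note IH
      finally show ?thesis by (simp add: eq)
    qed
  qed
qed


subsection \<open>Holomorphic functions on a complex vector space and Hartogs's theorem\<close>

text \<open>The complex structure on a real Euclidean space is a parameter, because the theory is
  applied both to tuples of period matrices and to pairs (z, w).\<close>

locale complex_scaling =
  fixes sc :: "complex \<Rightarrow> 'e::euclidean_space \<Rightarrow> 'e"
  assumes bilinear: "bounded_bilinear sc"
    and norm_sc: "norm (sc c x) = norm c * norm x"
    and sc_one: "sc 1 x = x"
    and sc_sc: "sc a (sc b x) = sc (a * b) x"
begin

lemma sc_add_right: "sc a (x + y) = sc a x + sc a y"
  and sc_zero_left [simp]: "sc 0 x = 0"
  and sc_zero_right [simp]: "sc a 0 = 0"
  using bilinear by (simp_all add: bounded_bilinear.add_right
      bounded_bilinear.zero_left bounded_bilinear.zero_right)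

lemma sc_of_real: "sc (of_real r) x = r *\<^sub>R x"
  using bounded_bilinear.scaleR_left[OF bilinear, of r 1 x] by (simp add: sc_one of_real_def)

section \<open>Complex differentiability and differentiation under the integral sign\<close>

definition cdiff :: "('e \<Rightarrow> complex) \<Rightarrow> 'e \<Rightarrow> bool" where
  "cdiff f X \<longleftrightarrow> (\<exists>D. (f has_derivative D) (at X) \<and> (\<forall>c h. D (sc c h) = c * D h))"

lemma cdiff_imp_isCont: "cdiff f X \<Longrightarrow> isCont f X"
  unfolding cdiff_def using has_derivative_continuous by blast

lemma cdiff_imp_continuous_on: "(\<And>X. X \<in> V \<Longrightarrow> cdiff f X) \<Longrightarrow> continuous_on V f"
  by (simp add: cdiff_imp_isCont continuous_at_imp_continuous_on)

lemma cdiff_const [intro]: "cdiff (\<lambda>X. c) X"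
  unfolding cdiff_def by (rule exI[of _ "\<lambda>h. 0"]) auto

lemma cdiff_add [intro]:
  assumes "cdiff f X" "cdiff g X"
  shows "cdiff (\<lambda>X. f X + g X) X"
proof -
  obtain D E where *: "(f has_derivative D) (at X)" "\<And>c h. D (sc c h) = c * D h"
    "(g has_derivative E) (at X)" "\<And>c h. E (sc c h) = c * E h"
    using assms unfolding cdiff_def by blast
  show ?thesis
    unfolding cdiff_def
    by (rule exI[of _ "\<lambda>h. D h + E h"]) (simp add: * has_derivative_add distrib_left)
qed

lemma cdiff_mult [intro]:
  assumes "cdiff f X" "cdiff g X"
  shows "cdiff (\<lambda>X. f X * g X) X"
proof -
  obtain D E where *: "(f has_derivative D) (at X)" "\<And>c h. D (sc c h) = c * D h"
    "(g has_derivative E) (at X)" "\<And>c h. E (sc c h) = c * E h"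
    using assms unfolding cdiff_def by blast
  show ?thesis
    unfolding cdiff_def
    by (rule exI[of _ "\<lambda>h. f X * E h + D h * g X"])
       (use has_derivative_mult[OF *(1,3)] in \<open>simp add: * algebra_simps\<close>)
qed

lemma cdiff_sum [intro]: "(\<And>i. i \<in> I \<Longrightarrow> cdiff (f i) X) \<Longrightarrow> cdiff (\<lambda>X. \<Sum>i\<in>I. f i X) X"
  by (induction I rule: infinite_finite_induct) auto

lemma cdiff_transform:
  assumes "cdiff f X" "open V" "X \<in> V" "\<And>Y. Y \<in> V \<Longrightarrow> f Y = g Y"
  shows "cdiff g X"
  using assms unfolding cdiff_def by (metis has_derivative_transform_within_open)

lemma cdiff_line:
  assumes "\<And>X. X \<in> V \<Longrightarrow> cdiff f X" "\<And>s. s \<in> S \<Longrightarrow> X + sc s H \<in> V"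
  shows "(\<lambda>s. f (X + sc s H)) holomorphic_on S"
proof -
  have "\<exists>f'. ((\<lambda>s. f (X + sc s H)) has_field_derivative f') (at s)" if sS: "s \<in> S" for s
  proof -
    obtain D where D: "(f has_derivative D) (at (X + sc s H))" "\<And>c h. D (sc c h) = c * D h"
      using assms(1)[OF assms(2)[OF sS]] unfolding cdiff_def by blast
    have "((\<lambda>s. X + sc s H) has_derivative (\<lambda>s. sc s H)) (at s)"
      by (auto intro!: derivative_eq_intros bounded_bilinear.bounded_linear_left[OF bilinear]
          bounded_linear_imp_has_derivative)
    from has_derivative_compose[OF this D(1)]
    have "((\<lambda>s. f (X + sc s H)) has_derivative (\<lambda>s. s * D H)) (at s)" by (simp add: D(2))
    moreover have "(\<lambda>s. s * D H) = (*) (D H)" by (auto simp: mult.commute)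
    ultimately show ?thesis unfolding has_field_derivative_def by metis
  qed
  then show ?thesis
    unfolding holomorphic_on_def field_differentiable_def
    using has_field_derivative_at_within by blast
qed

text \<open>Along the complex line through \<open>X\<close> in direction \<open>H\<close>, f becomes
  a holomorphic function u on the disc of radius r / norm H > 2. Cauchy's inequality on discs of
  half that radius bounds u'' on the closed unit disc, and Taylor's formula between 0 and 1 yields 2
  * M / (r / (2 * norm H))^2, whence the constant 8. The bound sees f only through \<open>M\<close>,
  so it is uniform in parameters.\<close>

lemma cdiff_taylor_bound:
  assumes r: "0 < r" and f: "\<And>Y. Y \<in> ball X r \<Longrightarrow> cdiff f Y"
    and M: "\<And>Y. Y \<in> ball X r \<Longrightarrow> norm (f Y) \<le> M"
    and D: "(f has_derivative D) (at X)" "\<And>c h. D (sc c h) = c * D h"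
    and H: "norm H < r / 2"
  shows "norm (f (X + H) - f X - D H) \<le> 8 * M / r\<^sup>2 * (norm H)\<^sup>2"
proof (cases "H = 0")
  case True
  then have "D H = 0" using D(2)[of 0 0] by simp
  with True show ?thesis by simp
next
  case False
  define \<rho> where "\<rho> = r / norm H"
  have \<rho>: "\<rho> > 2" using False H by (simp add: \<rho>_def field_simps)
  define u where "u = (\<lambda>s. f (X + sc s H))"
  have inb: "X + sc s H \<in> ball X r" if "norm s < \<rho>" for s
    using that False by (simp add: dist_norm norm_sc \<rho>_def field_simps)
  have u: "u holomorphic_on ball 0 \<rho>"
    unfolding u_def by (rule cdiff_line[of "ball X r"]) (use f inb in auto)
  have Mu: "norm (u s) \<le> M" if "norm s < \<rho>" for s
    unfolding u_def using M inb[OF that] by blast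
  have sub: "cball s (\<rho> / 2) \<subseteq> ball 0 \<rho>" if "norm s \<le> 1" for s :: complex
  proof
    fix y assume "y \<in> cball s (\<rho> / 2)"
    then have "norm (y - s) \<le> \<rho> / 2" by (simp add: dist_norm norm_minus_commute)
    moreover have "norm y \<le> norm (y - s) + norm s" by (metis diff_add_cancel norm_triangle_ineq)
    ultimately show "y \<in> ball 0 \<rho>" using that \<rho> by simp
  qed
  have b2: "norm ((deriv ^^ 2) u s) \<le> fact 2 * M / (\<rho> / 2) ^ 2" if s: "s \<in> cball 0 1" for s
  proof (rule Cauchy_inequality)
    have sb: "cball s (\<rho> / 2) \<subseteq> ball 0 \<rho>" using sub s by simp
    then show "u holomorphic_on ball s (\<rho> / 2)" "continuous_on (cball s (\<rho> / 2)) u"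
      using u by (meson ball_subset_cball holomorphic_on_subset holomorphic_on_imp_continuous_on)+
    fix x assume "norm (s - x) = \<rho> / 2"
    then have "x \<in> cball s (\<rho> / 2)" by (simp add: dist_norm)
    then show "norm (u x) \<le> M" using sb Mu by auto
  qed (use \<rho> in auto)
  have "norm ((deriv ^^ 0) u 1 - (\<Sum>i\<le>1. (deriv ^^ i) u 0 * (1 - 0) ^ i / fact i))
      \<le> (fact 2 * M / (\<rho> / 2) ^ 2) * norm (1 - 0 :: complex) ^ Suc 1 / fact 1"
  proof (rule complex_Taylor[where S = "cball 0 1"])
    fix i s assume s: "s \<in> cball (0::complex) 1" and "i \<le> (1::nat)"
    have "(deriv ^^ i) u holomorphic_on ball 0 \<rho>"
      by (intro holomorphic_higher_deriv u) auto
    then have "((deriv ^^ i) u has_field_derivative deriv ((deriv ^^ i) u) s) (at s)"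
      by (rule holomorphic_derivI) (use s \<rho> in auto)
    then show "((deriv ^^ i) u has_field_derivative (deriv ^^ Suc i) u s) (at s within cball 0 1)"
      by (simp add: has_field_derivative_at_within)
  qed (use b2 in \<open>auto simp: numeral_2_eq_2\<close>)
  moreover have "deriv u 0 = D H"
  proof (rule DERIV_imp_deriv)
    have "((\<lambda>s. X + sc s H) has_derivative (\<lambda>s. sc s H)) (at 0)"
      by (auto intro!: derivative_eq_intros bounded_bilinear.bounded_linear_left[OF bilinear]
          bounded_linear_imp_has_derivative)
    from has_derivative_compose[OF this, of f D] D
    have "(u has_derivative (\<lambda>s. s * D H)) (at 0)" by (simp add: u_def)
    moreover have "(\<lambda>s. s * D H) = (*) (D H)" by (auto simp: mult.commute)
    ultimately show "(u has_field_derivative D H) (at 0)" unfolding has_field_derivative_def by metis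
  qed
  ultimately have "norm (u 1 - (u 0 + D H)) \<le> 2 * M / (\<rho> / 2) ^ 2"
    by (simp add: numeral_2_eq_2)
  then show ?thesis
    using False by (simp add: u_def sc_one \<rho>_def power_divide diff_diff_eq)
qed

text \<open>Nothing is assumed on how the derivative depends on t. The quadratic remainder bound,
  uniform in t, exhibits it as a uniform limit of difference quotients that are continuous in t; it
  is therefore integrable, and the same bound controls the remainder of the integral.\<close>

lemma cdiff_integral:
  fixes \<phi> :: "'e \<Rightarrow> real \<Rightarrow> complex"
  assumes r: "0 < r"
    and f: "\<And>Y t. Y \<in> ball X r \<Longrightarrow> t \<in> {0..1} \<Longrightarrow> cdiff (\<lambda>Y. \<phi> Y t) Y"
    and M: "\<And>Y t. Y \<in> ball X r \<Longrightarrow> t \<in> {0..1} \<Longrightarrow> norm (\<phi> Y t) \<le> M"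
    and cont: "\<And>Y. Y \<in> ball X r \<Longrightarrow> continuous_on {0..1} (\<phi> Y)"
  shows "cdiff (\<lambda>Y. integral {0..1} (\<phi> Y)) X"
proof -
  have Xb: "X \<in> ball X r" using r by simp
  have "\<forall>t\<in>{0..1}. \<exists>D. ((\<lambda>Y. \<phi> Y t) has_derivative D) (at X) \<and> (\<forall>c h. D (sc c h) = c * D h)"
    using f[OF Xb] unfolding cdiff_def by blast
  then obtain D where D: "\<And>t. t \<in> {0..1} \<Longrightarrow> ((\<lambda>Y. \<phi> Y t) has_derivative D t) (at X)"
    "\<And>t c h. t \<in> {0..1} \<Longrightarrow> D t (sc c h) = c * D t h"
    by metis
  define C where "C = 8 * M / r\<^sup>2"
  have lin: "bounded_linear (D t)" if "t \<in> {0..1}" for t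
    using D(1)[OF that] by (rule has_derivative_bounded_linear)
  have est: "norm (\<phi> (X + H) t - \<phi> X t - D t H) \<le> C * (norm H)\<^sup>2"
    if "norm H < r / 2" "t \<in> {0..1}" for H t
    unfolding C_def
    by (rule cdiff_taylor_bound[OF r]) (use that f M D in auto)
  have contD: "continuous_on {0..1} (\<lambda>t. D t H)" for H
  proof (rule uniform_limit_theorem)
    define q where "q = (\<lambda>n t. of_nat (Suc n) * (\<phi> (X + (1 / real (Suc n)) *\<^sub>R H) t - \<phi> X t))"
    have small: "\<forall>\<^sub>F n in sequentially. norm ((1 / real (Suc n)) *\<^sub>R H) < r / 2"
    proof -
      have "(\<lambda>n. norm ((1 / real (Suc n)) *\<^sub>R H)) \<longlonglongrightarrow> norm (0 *\<^sub>R H)"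
        by (intro tendsto_intros) (use LIMSEQ_inverse_real_of_nat in \<open>simp add: field_simps\<close>)
      then show ?thesis using r by (intro order_tendstoD(2)) auto
    qed
    show "uniform_limit {0..1} q (\<lambda>t. D t H) sequentially"
      unfolding uniform_limit_iff
    proof (intro allI impI)
      fix e :: real assume e: "0 < e"
      have "(\<lambda>n. C * (norm H)\<^sup>2 * inverse (real (Suc n))) \<longlonglongrightarrow> C * (norm H)\<^sup>2 * 0"
        by (intro tendsto_intros LIMSEQ_inverse_real_of_nat)
      then have "\<forall>\<^sub>F n in sequentially. C * (norm H)\<^sup>2 * inverse (real (Suc n)) < e"
        using e by (intro order_tendstoD(2)) auto
      with small show "\<forall>\<^sub>F n in sequentially. \<forall>t\<in>{0..1}. dist (q n t) (D t H) < e"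
      proof eventually_elim
        case (elim n)
        show ?case
        proof
          fix t :: real assume t: "t \<in> {0..1}"
          let ?h = "(1 / real (Suc n)) *\<^sub>R H"
          have "D t ?h = D t H / of_nat (Suc n)"
            using linear_scale[OF bounded_linear.linear[OF lin[OF t]], of "1 / real (Suc n)" H]
            by (simp add: scaleR_conv_of_real)
          then have "D t H = of_nat (Suc n) * D t ?h" by (simp del: of_nat_Suc)
          then have "q n t - D t H = of_nat (Suc n) * (\<phi> (X + ?h) t - \<phi> X t - D t ?h)"
            by (simp add: q_def algebra_simps)
          then have "norm (q n t - D t H) = real (Suc n) * norm (\<phi> (X + ?h) t - \<phi> X t - D t ?h)"
            by (simp only: norm_mult norm_of_nat)
          also have "\<dots> \<le> real (Suc n) * (C * (norm ?h)\<^sup>2)"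
            using elim(1) t by (intro mult_left_mono est) auto
          also have "\<dots> = C * (norm H)\<^sup>2 * inverse (real (Suc n))"
            by (simp add: power_mult_distrib power2_eq_square divide_simps)
          finally show "dist (q n t) (D t H) < e" using elim(2) by (simp add: dist_norm)
        qed
      qed
    qed
    show "\<forall>\<^sub>F n in sequentially. continuous_on {0..1} (q n)"
      using small
    proof eventually_elim
      case (elim n)
      then have "norm ((1 / real (Suc n)) *\<^sub>R H) < r" using r by linarith
      then have "X + (1 / real (Suc n)) *\<^sub>R H \<in> ball X r" by (simp add: dist_norm)
      then show ?case unfolding q_def by (intro continuous_intros cont Xb)
    qed
  qed auto
  have int: "(\<lambda>t. D t H) integrable_on {0..1}" for H
    by (rule integrable_continuous_real[OF contD])
  have intp: "\<phi> Y integrable_on {0..1}" if "Y \<in> ball X r" for Y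
    by (rule integrable_continuous_real[OF cont[OF that]])
  define L where "L = (\<lambda>H. integral {0..1} (\<lambda>t. D t H))"
  have L_sc: "L (sc c H) = c * L H" for c H
  proof -
    have "L (sc c H) = integral {0..1} (\<lambda>t. c * D t H)"
      unfolding L_def by (rule integral_cong) (simp add: D)
    then show ?thesis by (simp add: L_def)
  qed
  have "linear L"
  proof (rule linearI)
    fix x y
    have "L (x + y) = integral {0..1} (\<lambda>t. D t x + D t y)"
      unfolding L_def
      by (rule integral_cong) (simp add: bounded_linear.linear[OF lin] linear_add)
    then show "L (x + y) = L x + L y" by (simp add: L_def integral_add int)
  next
    fix c x
    show "L (c *\<^sub>R x) = c *\<^sub>R L x"
      using L_sc[of "of_real c" x] by (simp add: sc_of_real scaleR_conv_of_real)
  qed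
  then have bl: "bounded_linear L" by (simp add: linear_conv_bounded_linear)
  have bound: "norm (integral {0..1} (\<phi> (X + H)) - integral {0..1} (\<phi> X) - L H) \<le> C * (norm H)\<^sup>2"
    if H: "norm H < r / 2" for H
  proof -
    have Y: "X + H \<in> ball X r" using H r by (simp add: dist_norm)
    have "integral {0..1} (\<phi> (X + H)) - integral {0..1} (\<phi> X) - L H
        = integral {0..1} (\<lambda>t. \<phi> (X + H) t - \<phi> X t - D t H)"
      using intp[OF Y] intp[OF Xb] int[of H]
      by (simp add: L_def integral_diff integrable_diff)
    also have "norm \<dots> \<le> integral {0..1} (\<lambda>t::real. C * (norm H)\<^sup>2)"
      using intp[OF Y] intp[OF Xb] int[of H] est[OF H]
      by (intro integral_norm_bound_integral) (auto intro!: integrable_diff)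
    finally show ?thesis by simp
  qed
  have "((\<lambda>H. norm (integral {0..1} (\<phi> (X + H)) - integral {0..1} (\<phi> X) - L H) / norm H) \<longlongrightarrow> 0) (at 0)"
  proof (rule Lim_null_comparison)
    show "\<forall>\<^sub>F H in at 0. norm (norm (integral {0..1} (\<phi> (X + H)) - integral {0..1} (\<phi> X) - L H) / norm H)
        \<le> C * norm H"
    proof -
      have "\<forall>\<^sub>F H in at 0. H \<in> ball (0::'e) (r / 2) - {0}"
        by (rule eventually_at_in_open) (use r in auto)
      then show ?thesis
      proof eventually_elim
        case (elim H)
        then show ?case
          using bound[of H] by (simp add: divide_simps power2_eq_square mult.assoc)
      qed
    qed
    show "((\<lambda>H. C * norm H) \<longlongrightarrow> 0) (at (0::'e))"
      by (intro tendsto_mult_right_zero tendsto_norm_zero tendsto_ident_at)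
  qed
  then have "((\<lambda>Y. integral {0..1} (\<phi> Y)) has_derivative L) (at X)"
    unfolding has_derivative_at using bl by simp
  with L_sc show ?thesis unfolding cdiff_def by blast
qed

text \<open>Hartogs's lemma. The functions \<open>\<bar>c n\<bar> powr (1 / n)\<close> satisfy the mean value inequality on every
  complex disc; averaging it over all discs of a fixed radius turns the pointwise bound into a uniform
  one, by dominated convergence.\<close>

lemma hartogs_lemma:
  fixes c :: "nat \<Rightarrow> 'e \<Rightarrow> complex"
  assumes \<rho>: "0 < \<rho>" and A: "0 < A" and B: "0 < B"
    and c: "\<And>n X. X \<in> ball X0 (4 * \<rho>) \<Longrightarrow> cdiff (c n) X"
    and cB: "\<And>n X. 1 \<le> n \<Longrightarrow> X \<in> ball X0 (4 * \<rho>) \<Longrightarrow> norm (c n X) \<le> B ^ n"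
    and cA: "\<And>X. X \<in> ball X0 (4 * \<rho>) \<Longrightarrow> \<forall>\<^sub>F n in sequentially. norm (c n X) \<le> A ^ n"
  shows "\<forall>\<^sub>F n in sequentially. \<forall>X\<in>ball X0 \<rho>. norm (c n X) \<le> (2 * A) ^ n"
proof -
  define E where "E = (\<lambda>t. exp (2 * complex_of_real pi * \<i> * of_real t))"
  have nE [simp]: "norm (E t) = 1" for t by (simp add: E_def)
  have E0 [simp]: "E t \<noteq> 0" for t by (simp add: E_def)
  have contE: "continuous_on S E" for S unfolding E_def by (intro continuous_intros)
  define v where "v = (\<lambda>n X. norm (c n X) powr (1 / real n))"
  \<comment> \<open>Only the excess over \<open>A\<close> is averaged: it is bounded by
    \<open>B\<close> and eventually zero at each point, as dominated convergence requires.\<close>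
  define e where "e = (\<lambda>n X. max 0 (v n X - A))"
  \<comment> \<open>The radius 2 * \<rho> lets this single domain contain the translates b + H with
    norm b < \<rho> and norm H < \<rho>, hence serve all centres \<open>a\<close> at once.\<close>
  define Q where "Q = {0..1::real} \<times> ball (0::'e) (2 * \<rho>)"
  define F where "F = (\<lambda>n x. indicator Q x * e n (X0 + sc (E (fst x)) (snd x)))"
  have Qb: "Q \<in> sets borel"
    unfolding Q_def by (intro borel_Times) auto
  have inb: "X0 + sc (E t) H \<in> ball X0 (4 * \<rho>)" if "norm H < 4 * \<rho>" for t H
    using that by (simp add: dist_norm norm_sc)
  have contv: "continuous_on (ball X0 (4 * \<rho>)) (v n)" if "1 \<le> n" for n
    unfolding v_def using that
    by (intro continuous_on_powr' continuous_intros cdiff_imp_continuous_on c) auto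
  have conte: "continuous_on (ball X0 (4 * \<rho>)) (e n)" if "1 \<le> n" for n
    unfolding e_def by (intro continuous_intros contv that)
  have e0: "0 \<le> e n X" for n X by (simp add: e_def)
  have ve: "v n X \<le> A + e n X" for n X by (simp add: e_def)
  have eB: "e n X \<le> B" if "1 \<le> n" "X \<in> ball X0 (4 * \<rho>)" for n X
  proof -
    have "v n X \<le> (B ^ n) powr (1 / real n)"
      unfolding v_def using cB[OF that] that by (intro powr_mono2) auto
    also have "\<dots> = B" using B that by (simp add: powr_realpow[symmetric] powr_powr)
    finally show ?thesis using A B by (simp add: e_def)
  qed
  have eA: "\<forall>\<^sub>F n in sequentially. e n X = 0" if "X \<in> ball X0 (4 * \<rho>)" for X
    using cA[OF that] eventually_ge_at_top[of 1]
  proof eventually_elim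
    case (elim n)
    have "v n X \<le> (A ^ n) powr (1 / real n)"
      unfolding v_def using elim by (intro powr_mono2) auto
    also have "\<dots> = A" using A elim by (simp add: powr_realpow[symmetric] powr_powr)
    finally show ?case by (simp add: e_def)
  qed
  have Fmeas: "F n \<in> borel_measurable borel" if "1 \<le> n" for n
  proof -
    have "continuous_on Q (\<lambda>x. e n (X0 + sc (E (fst x)) (snd x)))"
    proof (rule continuous_on_compose2[OF conte[OF that]])
      show "continuous_on Q (\<lambda>x. X0 + sc (E (fst x)) (snd x))"
        by (intro continuous_intros bounded_bilinear.continuous_on[OF bilinear]
            continuous_on_compose2[OF contE[of UNIV]]) auto
    qed (use inb \<rho> in \<open>auto simp: Q_def\<close>)
    from borel_measurable_continuous_on_indicator[OF Qb this] show ?thesis by (simp add: F_def)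
  qed
  have Fmeas': "(\<lambda>x. ennreal (F n x)) \<in> borel_measurable (lborel \<Otimes>\<^sub>M lborel)" if "1 \<le> n" for n
    using Fmeas[OF that] by (simp add: lborel_prod)
  define \<Phi> where "\<Phi> = (\<lambda>n. \<integral>\<^sup>+x. ennreal (F n x) \<partial>(lborel \<Otimes>\<^sub>M lborel))"
  have "(\<lambda>n. \<integral>\<^sup>+x. ennreal (F (Suc n) x) \<partial>lborel) \<longlonglongrightarrow> (\<integral>\<^sup>+x. 0 \<partial>(lborel :: (real \<times> 'e) measure))"
  proof (rule nn_integral_dominated_convergence[where w = "\<lambda>x. ennreal B * indicator Q x"])
    show "(\<lambda>x. ennreal (F (Suc n) x)) \<in> borel_measurable lborel" for n
      using Fmeas[of "Suc n"] by simp
    show "(\<lambda>x. ennreal B * indicator Q x) \<in> borel_measurable lborel" using Qb by simp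
    show "AE x in lborel. ennreal (F (Suc n) x) \<le> ennreal B * indicator Q x" for n
    proof (rule AE_I2)
      fix x :: "real \<times> 'e"
      show "ennreal (F (Suc n) x) \<le> ennreal B * indicator Q x"
        using eB[of "Suc n" "X0 + sc (E (fst x)) (snd x)"] inb[of "snd x" "fst x"] \<rho>
        by (auto simp: F_def Q_def indicator_def intro!: ennreal_leI)
    qed
    have "bounded Q" unfolding Q_def by (intro bounded_Times) auto
    then have "emeasure lborel Q < \<infinity>" by (rule emeasure_bounded_finite)
    then show "(\<integral>\<^sup>+x. ennreal B * indicator Q x \<partial>lborel) < \<infinity>"
      using Qb by (simp add: nn_integral_cmult_indicator ennreal_mult_less_top)
    show "AE x in lborel. (\<lambda>n. ennreal (F (Suc n) x)) \<longlonglongrightarrow> 0"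
    proof (rule AE_I2)
      fix x :: "real \<times> 'e"
      have "\<forall>\<^sub>F n in sequentially. F (Suc n) x = 0"
      proof (cases "x \<in> Q")
        case True
        then have "norm (snd x) < 4 * \<rho>" using \<rho> by (auto simp: Q_def)
        from eA[OF inb[OF this]] show ?thesis
          unfolding F_def eventually_sequentially by (metis le_SucI mult_zero_right)
      qed (simp add: F_def)
      then have "\<forall>\<^sub>F n in sequentially. ennreal (F (Suc n) x) = 0"
        by eventually_elim simp
      then show "(\<lambda>n. ennreal (F (Suc n) x)) \<longlonglongrightarrow> 0" by (rule tendsto_eventually)
    qed
  qed simp_all
  then have lim: "(\<lambda>n. \<Phi> (Suc n)) \<longlonglongrightarrow> 0" by (simp add: \<Phi>_def lborel_prod)
  define \<mu> where "\<mu> = emeasure lborel (ball (0::'e) \<rho>)"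
  have \<mu>: "0 < \<mu>" "\<mu> < \<infinity>"
  proof -
    show "\<mu> < \<infinity>" unfolding \<mu>_def by (rule emeasure_bounded_finite) simp
    have "\<mu> \<noteq> 0"
    proof
      assume "\<mu> = 0"
      then have "negligible (ball (0::'e) \<rho>)"
        by (simp add: \<mu>_def negligible_iff_null_sets null_setsI null_sets_completionI)
      then show False using \<rho> open_not_negligible[of "ball (0::'e) \<rho>"] by auto
    qed
    then show "0 < \<mu>" by (simp add: zero_less_iff_neq_zero)
  qed
  have key: "ennreal (v n a - A) * \<mu> \<le> \<Phi> n" if n: "1 \<le> n" and a: "a \<in> ball X0 \<rho>" for n a
  proof -
    define G where "G = (\<lambda>x. indicator ({0..1} \<times> ball 0 \<rho>) x * e n (a + sc (E (fst x)) (snd x)))"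
    have ina: "a + sc (E t) H \<in> ball X0 (4 * \<rho>)" "a + sc s H \<in> ball X0 (4 * \<rho>)"
      if "norm H < \<rho>" "norm s < 2" for t s H
    proof -
      have *: "a + sc s H \<in> ball X0 (4 * \<rho>)" if "norm s < 2" for s
      proof -
        have "norm (sc s H) \<le> 2 * \<rho>"
          using \<open>norm H < \<rho>\<close> that by (simp add: norm_sc mult_mono)
        moreover have "norm (a - X0) < \<rho>" using a by (simp add: dist_norm norm_minus_commute)
        moreover have "norm (a + sc s H - X0) \<le> norm (a - X0) + norm (sc s H)"
          using norm_triangle_ineq[of "a - X0" "sc s H"] by (simp add: algebra_simps)
        ultimately show ?thesis using \<rho> by (simp add: dist_norm norm_minus_commute)
      qed
      show "a + sc (E t) H \<in> ball X0 (4 * \<rho>)" "a + sc s H \<in> ball X0 (4 * \<rho>)"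
        using *[of "E t"] *[OF that(2)] by simp_all
    qed
    have Gmeas: "G \<in> borel_measurable borel"
    proof -
      have "continuous_on ({0..1} \<times> ball 0 \<rho>) (\<lambda>x. e n (a + sc (E (fst x)) (snd x)))"
      proof (rule continuous_on_compose2[OF conte[OF n]])
        show "continuous_on ({0..1} \<times> ball 0 \<rho>) (\<lambda>x. a + sc (E (fst x)) (snd x))"
          by (intro continuous_intros bounded_bilinear.continuous_on[OF bilinear]
              continuous_on_compose2[OF contE[of UNIV]]) auto
      qed (use ina(1)[of _ 0] in auto)
      moreover have "{0..1} \<times> ball 0 \<rho> \<in> sets (borel :: (real \<times> 'e) measure)"
        by (intro borel_Times) auto
      ultimately show ?thesis
        using borel_measurable_continuous_on_indicator[of "{0..1} \<times> ball 0 \<rho>"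
            "\<lambda>x. e n (a + sc (E (fst x)) (snd x))"] by (simp add: G_def)
    qed
    have Gmeas': "(\<lambda>(t, H). ennreal (G (t, H))) \<in> borel_measurable (lborel \<Otimes>\<^sub>M lborel)"
      using Gmeas by (simp add: lborel_prod case_prod_unfold)
    \<comment> \<open>For a fixed direction \<open>H\<close> the mean value inequality is applied to
      s |-> c n (a + sc s H); the range norm s < 2 leaves room beyond the unit circle.\<close>
    have mean: "ennreal (v n a - A) * indicator (ball 0 \<rho>) H \<le> (\<integral>\<^sup>+t. ennreal (G (t, H)) \<partial>lborel)" for H
    proof (cases "H \<in> ball 0 \<rho>")
      case True
      then have H: "norm H < \<rho>" by simp
      have contt: "continuous_on {0..1} (\<lambda>t. f (a + sc (E t) H))"
        if "continuous_on (ball X0 (4 * \<rho>)) f" for f :: "'e \<Rightarrow> real"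
        by (rule continuous_on_compose2[OF that])
           (use ina(1)[OF H, of 0] in \<open>auto intro!: continuous_intros contE bounded_bilinear.continuous_on[OF bilinear]\<close>)
      have "norm (c n (a + sc 0 H)) powr (1 / real n)
          \<le> integral {0..1} (\<lambda>t. norm (c n (a + sc (exp (2 * of_real pi * \<i> * of_real t)) H)) powr (1 / real n))"
      proof (rule powr_circle_mean[where R = 2])
        show "(\<lambda>s. c n (a + sc s H)) holomorphic_on ball 0 2"
          by (rule cdiff_line[of "ball X0 (4 * \<rho>)"]) (use ina(2)[OF H] c in auto)
      qed (use n in auto)
      then have "v n a \<le> integral {0..1} (\<lambda>t. v n (a + sc (E t) H))"
        by (simp add: v_def E_def)
      also have "\<dots> \<le> integral {0..1} (\<lambda>t. A + e n (a + sc (E t) H))"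
        by (intro integral_le integrable_continuous_real continuous_intros contt contv conte n ve)
      also have "\<dots> = A + integral {0..1} (\<lambda>t. e n (a + sc (E t) H))"
        by (subst integral_add) (auto intro!: integrable_continuous_real contt conte n)
      finally have le: "v n a - A \<le> integral {0..1} (\<lambda>t. e n (a + sc (E t) H))" by simp
      have "((\<lambda>t. e n (a + sc (E t) H)) has_integral integral {0..1} (\<lambda>t. e n (a + sc (E t) H))) {0..1}"
        by (intro integrable_integral integrable_continuous_real contt conte n)
      then have "((\<lambda>t. if t \<in> {0..1} then e n (a + sc (E t) H) else 0)
          has_integral integral {0..1} (\<lambda>t. e n (a + sc (E t) H))) UNIV"
        by (simp only: has_integral_restrict_UNIV)
      moreover have "(\<lambda>t. if t \<in> {0..1} then e n (a + sc (E t) H) else 0) = (\<lambda>t. G (t, H))"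
        using True by (auto simp: G_def indicator_def)
      ultimately have hi: "((\<lambda>t. G (t, H)) has_integral integral {0..1} (\<lambda>t. e n (a + sc (E t) H))) UNIV"
        by simp
      have "(\<integral>\<^sup>+t. ennreal (G (t, H)) \<partial>lborel) = ennreal (integral {0..1} (\<lambda>t. e n (a + sc (E t) H)))"
      proof (rule nn_integral_has_integral_lborel[OF _ _ hi])
        show "(\<lambda>t. G (t, H)) \<in> borel_measurable borel"
          using Gmeas by measurable
      qed (simp add: G_def e0)
      with le show ?thesis using True by (simp add: ennreal_leI)
    qed simp
    \<comment> \<open>The point a + sc (E t) H is rewritten as X0 + sc (E t) (b + H), where norm b <
      \<rho>. Translation invariance of Lebesgue measure in \<open>H\<close> then gives the bound
      \<open>\<Phi> n\<close>, which does not depend on \<open>a\<close>.\<close>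
    have shift: "(\<integral>\<^sup>+H. ennreal (G (t, H)) \<partial>lborel) \<le> (\<integral>\<^sup>+H. ennreal (F n (t, H)) \<partial>lborel)" for t
    proof -
      define b where "b = sc (inverse (E t)) (a - X0)"
      have nb: "norm b < \<rho>"
        using a by (simp add: b_def norm_sc norm_inverse dist_norm norm_minus_commute)
      have eq: "X0 + sc (E t) (b + H) = a + sc (E t) H" for H
        by (simp add: sc_add_right b_def sc_sc sc_one)
      have meas: "(\<lambda>H. ennreal (F n (t, H))) \<in> borel_measurable borel"
        using Fmeas[OF n] by measurable
      have "(\<integral>\<^sup>+H. ennreal (G (t, H)) \<partial>lborel) \<le> (\<integral>\<^sup>+H. ennreal (F n (t, b + H)) \<partial>lborel)"
      proof (intro nn_integral_mono ennreal_leI)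
        fix H :: 'e
        have "norm (b + H) < 2 * \<rho>" if "norm H < \<rho>"
          using that nb norm_triangle_ineq[of b H] by linarith
        then show "G (t, H) \<le> F n (t, b + H)"
          using eq[of H] e0 by (auto simp: G_def F_def Q_def indicator_def)
      qed
      also have "\<dots> = (\<integral>\<^sup>+H. ennreal (F n (t, H)) \<partial>distr lborel borel ((+) b))"
        by (subst nn_integral_distr) (use meas in auto)
      also have "\<dots> = (\<integral>\<^sup>+H. ennreal (F n (t, H)) \<partial>lborel)" by (simp add: lborel_distr_plus)
      finally show ?thesis .
    qed
    have "ennreal (v n a - A) * \<mu> = (\<integral>\<^sup>+H. ennreal (v n a - A) * indicator (ball (0::'e) \<rho>) H \<partial>lborel)"
      by (simp add: \<mu>_def nn_integral_cmult_indicator)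
    also have "\<dots> \<le> (\<integral>\<^sup>+H. \<integral>\<^sup>+t. ennreal (G (t, H)) \<partial>lborel \<partial>lborel)"
      by (intro nn_integral_mono mean)
    also have "\<dots> = (\<integral>\<^sup>+t. \<integral>\<^sup>+H. ennreal (G (t, H)) \<partial>lborel \<partial>lborel)"
      by (rule lborel_pair.Fubini'[OF Gmeas'])
    also have "\<dots> \<le> (\<integral>\<^sup>+t. \<integral>\<^sup>+H. ennreal (F n (t, H)) \<partial>lborel \<partial>lborel)"
      by (intro nn_integral_mono shift)
    also have "\<dots> = \<Phi> n"
      unfolding \<Phi>_def by (rule lborel.nn_integral_fst[OF Fmeas'[OF n]])
    finally show ?thesis .
  qed
  have "\<forall>\<^sub>F n in sequentially. \<Phi> (Suc n) < ennreal A * \<mu>"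
    using lim \<mu> A by (intro order_tendstoD(2)) (auto simp: ennreal_zero_less_mult_iff)
  then have "\<forall>\<^sub>F n in sequentially. 1 \<le> Suc n \<and> \<Phi> (Suc n) < ennreal A * \<mu>" by simp
  then have "\<forall>\<^sub>F n in sequentially. 1 \<le> n \<and> \<Phi> n < ennreal A * \<mu>"
    by (rule eventually_sequentially_Suc[THEN iffD1])
  then show ?thesis
  proof eventually_elim
    case (elim n)
    show ?case
    proof
      fix X assume X: "X \<in> ball X0 \<rho>"
      \<comment> \<open>The tolerance \<open>ennreal A * \<mu>\<close> was chosen for this: an
        excess below \<open>A\<close> gives the factor 2 of the conclusion.\<close>
      have "v n X - A < A"
      proof (rule ccontr)
        assume "\<not> v n X - A < A"
        then have "ennreal A * \<mu> \<le> ennreal (v n X - A) * \<mu>"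
          by (intro mult_right_mono ennreal_leI) auto
        also have "\<dots> \<le> \<Phi> n" using elim X by (intro key) auto
        finally show False using elim leD by blast
      qed
      then have "v n X \<le> 2 * A" by simp
      then have "v n X ^ n \<le> (2 * A) ^ n" by (intro power_mono) (simp_all add: v_def)
      moreover have "v n X ^ n = norm (c n X)"
      proof (cases "c n X = 0")
        case False
        then show ?thesis using elim by (simp add: v_def powr_realpow[symmetric] powr_powr)
      qed (use elim in \<open>simp add: v_def\<close>)
      ultimately show "norm (c n X) \<le> (2 * A) ^ n" by simp
    qed
  qed
qed

section \<open>Separately holomorphic functions\<close>

definition sep_hol :: "'e set \<Rightarrow> complex set \<Rightarrow> ('e \<Rightarrow> complex \<Rightarrow> complex) \<Rightarrow> bool" where
  "sep_hol V W f \<longleftrightarrow> (\<forall>z\<in>W. \<forall>X\<in>V. cdiff (\<lambda>X. f X z) X) \<and> (\<forall>X\<in>V. f X holomorphic_on W)"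

lemma cdiff_contour_integral:
  assumes r: "0 < r"
    and g: "\<And>t. t \<in> {0..1} \<Longrightarrow> (g has_vector_derivative g' t) (at t)"
    and g': "continuous_on {0..1} g'"
    and f: "\<And>Y z. Y \<in> ball X r \<Longrightarrow> z \<in> path_image g \<Longrightarrow> cdiff (\<lambda>Y. f Y z) Y"
    and M: "\<And>Y z. Y \<in> ball X r \<Longrightarrow> z \<in> path_image g \<Longrightarrow> norm (f Y z) \<le> M"
    and cont: "\<And>Y. Y \<in> ball X r \<Longrightarrow> continuous_on (path_image g) (f Y)"
  shows "cdiff (\<lambda>Y. contour_integral g (f Y)) X"
proof -
  have eq: "contour_integral g h = integral {0..1} (\<lambda>t. h (g t) * g' t)" for h
    unfolding contour_integral_integral
    by (rule integral_cong) (use vector_derivative_at[OF g] in simp)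
  have contg: "continuous_on {0..1} g"
    using g has_vector_derivative_at_within[of g]
    by (meson continuous_on_eq_continuous_within has_vector_derivative_continuous)
  have "bounded (g' ` {0..1})"
    using g' by (intro compact_imp_bounded compact_continuous_image) auto
  then obtain L where L: "\<And>t. t \<in> {0..1} \<Longrightarrow> norm (g' t) \<le> L" by (metis bounded_iff imageI)
  have gi: "g t \<in> path_image g" if "t \<in> {0..1}" for t using that by (auto simp: path_image_def)
  have "cdiff (\<lambda>Y. integral {0..1} (\<lambda>t. f Y (g t) * g' t)) X"
  proof (rule cdiff_integral[OF r, where M = "M * L"])
    fix Y t assume *: "Y \<in> ball X r" "t \<in> {0..1::real}"
    show "cdiff (\<lambda>Y. f Y (g t) * g' t) Y"
      by (intro cdiff_mult cdiff_const f * gi)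
    show "norm (f Y (g t) * g' t) \<le> M * L"
      unfolding norm_mult using M[OF *(1) gi[OF *(2)]] L[OF *(2)]
      by (intro mult_mono) (auto intro: order_trans[OF norm_ge_zero])
  next
    fix Y assume "Y \<in> ball X r"
    then show "continuous_on {0..1} (\<lambda>t. f Y (g t) * g' t)"
      by (intro continuous_intros continuous_on_compose2[OF cont contg] g') (use gi in auto)
  qed
  then show ?thesis by (simp only: eq)
qed

lemma cdiff_circle_integral:
  assumes d: "0 < d" and r: "0 < r"
    and f: "\<And>Y z. Y \<in> ball X r \<Longrightarrow> z \<in> sphere z0 d \<Longrightarrow> cdiff (\<lambda>Y. f Y z) Y"
    and M: "\<And>Y z. Y \<in> ball X r \<Longrightarrow> z \<in> sphere z0 d \<Longrightarrow> norm (f Y z) \<le> M"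
    and cont: "\<And>Y. Y \<in> ball X r \<Longrightarrow> continuous_on (sphere z0 d) (f Y)"
  shows "cdiff (\<lambda>Y. contour_integral (circlepath z0 d) (f Y)) X"
proof (rule cdiff_contour_integral[OF r])
  show "(circlepath z0 d has_vector_derivative 2 * of_real pi * \<i> * d * exp (2 * of_real pi * \<i> * of_real t))
      (at t)" for t
    using has_vector_derivative_circlepath by fastforce
  show "continuous_on {0..1} (\<lambda>t. 2 * of_real pi * \<i> * d * exp (2 * of_real pi * \<i> * of_real t))"
    by (intro continuous_intros)
qed (use assms in auto)

text \<open>Baire's theorem yields a disc \<open>cball z1 \<delta>\<close> near \<open>z0\<close> on
  which f is bounded uniformly in X, but \<open>z0\<close> need not lie in it. The Taylor
  coefficients of f X at \<open>z1\<close> are thus bounded by M / \<delta>^n uniformly in X and, as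
  each f X is holomorphic on a disc of radius \<open>R\<close>, eventually by (2 / R)^n for each
  single X. Hartogs's lemma makes the second kind of bound uniform, after which the Taylor series
  controls a neighbourhood of \<open>z0\<close>.\<close>

theorem sep_hol_locally_bounded:
  assumes V: "open V" and W: "open W" and f: "sep_hol V W f" and X0: "X0 \<in> V" and z0: "z0 \<in> W"
  shows "\<exists>r>0. \<exists>M. ball X0 r \<subseteq> V \<and> (\<forall>X\<in>ball X0 r. \<forall>z\<in>ball z0 r. norm (f X z) \<le> M)"
proof -
  obtain r0 where r0: "0 < r0" "cball X0 r0 \<subseteq> V" using V X0 open_contains_cball by blast
  obtain R' where R': "0 < R'" "cball z0 R' \<subseteq> W" using W z0 open_contains_cball by blast
  define R where "R = R' / 2"
  have R: "0 < R" "cball z0 (2 * R) \<subseteq> W" using R' by (auto simp: R_def)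
  have fX: "cdiff (\<lambda>X. f X z) X" if "X \<in> cball X0 r0" "z \<in> cball z0 (2 * R)" for X z
    using f r0(2) R(2) that unfolding sep_hol_def by blast
  have fz: "f X holomorphic_on cball z0 (2 * R)" if "X \<in> cball X0 r0" for X
    using f that r0 R unfolding sep_hol_def by (meson holomorphic_on_subset subsetD)
  define S where "S = cball z0 (R / 16)"
  \<comment> \<open>Each \<open>E m\<close> is closed in \<open>S\<close> because f is continuous in
    z; together they cover \<open>S\<close> because f is continuous in X on the compact
    ball.\<close>
  define E where "E = (\<lambda>m. {z \<in> S. \<forall>X\<in>cball X0 r0. norm (f X z) \<le> real m})"
  have SR: "S \<subseteq> cball z0 (2 * R)" using R by (auto simp: S_def)
  have "\<exists>m. \<not> S \<subseteq> closure (S - E m)"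
  proof (rule ccontr)
    assume "\<not> (\<exists>m. \<not> S \<subseteq> closure (S - E m))"
    then have dense: "S \<subseteq> closure (S - E m)" for m by blast
    have "S \<subseteq> closure (\<Inter> (range (\<lambda>m. S - E m)))"
    proof (rule Baire)
      fix T assume "T \<in> range (\<lambda>m. S - E m)"
      then obtain m where T: "T = S - E m" by blast
      have "closedin (top_of_set S) {z \<in> S. norm (f X z) \<le> real m}" if "X \<in> cball X0 r0" for X
      proof -
        have "continuous_on S (\<lambda>z. norm (f X z))"
          using holomorphic_on_imp_continuous_on[OF fz[OF that]] SR
          by (intro continuous_intros) (rule continuous_on_subset)
        from continuous_closedin_preimage[OF this, of "{..real m}"]
        show ?thesis by (simp add: vimage_def Int_def)
      qed
      then have "closedin (top_of_set S) (\<Inter>X\<in>cball X0 r0. {z \<in> S. norm (f X z) \<le> real m})"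
        using r0 by (intro closedin_INT) auto
      moreover have "(\<Inter>X\<in>cball X0 r0. {z \<in> S. norm (f X z) \<le> real m}) = E m"
      proof -
        have "X0 \<in> cball X0 r0" using r0(1) by simp
        then show ?thesis unfolding E_def by blast
      qed
      ultimately have "closedin (top_of_set S) (E m)" by simp
      then show "openin (top_of_set S) T \<and> S \<subseteq> closure T"
        using dense T by auto
    qed (auto simp: S_def)
    moreover have "\<Inter> (range (\<lambda>m. S - E m)) = {}"
    proof -
      have "\<exists>m. z \<in> E m" if "z \<in> S" for z
      proof -
        have "continuous_on (cball X0 r0) (\<lambda>X. f X z)"
          using fX that SR by (intro cdiff_imp_continuous_on) auto
        then have "bounded ((\<lambda>X. f X z) ` cball X0 r0)"
          by (intro compact_imp_bounded compact_continuous_image) auto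
        then obtain K where K: "\<And>X. X \<in> cball X0 r0 \<Longrightarrow> norm (f X z) \<le> K" by (metis bounded_iff imageI)
        obtain m where "K \<le> real m" using real_arch_simple by blast
        with K that show ?thesis unfolding E_def by (force intro: order_trans)
      qed
      then show ?thesis by blast
    qed
    ultimately have "S \<subseteq> {}" by (simp only: closure_empty)
    then show False using R by (simp add: S_def)
  qed
  then obtain m x where x: "x \<in> S" "x \<notin> closure (S - E m)" by blast
  have "open (- closure (S - E m) \<inter> ball z0 (R / 16))" by auto
  moreover have "- closure (S - E m) \<inter> ball z0 (R / 16) \<noteq> {}"
  proof -
    have "x \<in> closure (ball z0 (R / 16))" using x R by (simp add: S_def)
    then show ?thesis
      using x(2) closure_iff_nhds_not_empty[of x "ball z0 (R / 16)"] by (metis ComplI Int_commute closed_closure open_Compl order_refl)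
  qed
  ultimately obtain z1 \<delta> where z1: "0 < \<delta>" "cball z1 \<delta> \<subseteq> - closure (S - E m) \<inter> ball z0 (R / 16)"
    by (meson all_not_in_conv open_contains_cball)
  define M where "M = real m + 1"
  have M: "1 \<le> M" by (simp add: M_def)
  have fM: "norm (f X z) \<le> M" if "X \<in> cball X0 r0" "z \<in> cball z1 \<delta>" for X z
  proof -
    have "z \<in> ball z0 (R / 16)" "z \<notin> closure (S - E m)" using that(2) z1(2) by blast+
    then have "z \<in> S" "z \<notin> S - E m"
      using closure_subset[of "S - E m"] ball_subset_cball unfolding S_def by blast+
    then have "z \<in> E m" by blast
    with that(1) have "norm (f X z) \<le> real m" unfolding E_def by blast
    then show ?thesis by (simp add: M_def)
  qed
  have z1z0: "dist z0 z1 < R / 16" using z1 by (metis IntD2 centre_in_cball less_imp_le mem_ball subsetD)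
  have sub1: "cball z1 R \<subseteq> cball z0 (2 * R)"
  proof
    fix y assume "y \<in> cball z1 R"
    then have "dist z1 y \<le> R" by simp
    then have "dist z0 y \<le> 2 * R"
      using z1z0 dist_triangle[of z0 y z1] zero_le_dist[of z0 z1] by linarith
    then show "y \<in> cball z0 (2 * R)" by simp
  qed
  have sub2: "cball z1 \<delta> \<subseteq> cball z0 (2 * R)" using z1 R by (auto intro: less_imp_le dest!: subsetD)
  define c where "c = (\<lambda>n X. (deriv ^^ n) (f X) z1 / fact n)"
  have cc: "cdiff (c n) X" if X: "X \<in> ball X0 r0" for n X
  proof -
    obtain r1 where r1: "0 < r1" "ball X r1 \<subseteq> ball X0 r0"
      using X by (meson open_ball open_contains_ball)
    then have r1': "ball X r1 \<subseteq> cball X0 r0" by auto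
    have "cdiff (\<lambda>Y. contour_integral (circlepath z1 \<delta>) (\<lambda>u. f Y u * (1 / (u - z1) ^ Suc n))) X"
    proof (rule cdiff_circle_integral[OF z1(1) r1(1), where M = "M * (1 / \<delta> ^ Suc n)"])
      fix Y z assume *: "Y \<in> ball X r1" "z \<in> sphere z1 \<delta>"
      then have **: "Y \<in> cball X0 r0" "z \<in> cball z1 \<delta>" "norm (z - z1) = \<delta>"
        using r1' by (auto simp: dist_norm norm_minus_commute)
      show "cdiff (\<lambda>Y. f Y z * (1 / (z - z1) ^ Suc n)) Y"
        using fX[of Y z] ** sub2 by (intro cdiff_mult[OF _ cdiff_const]) auto
      show "norm (f Y z * (1 / (z - z1) ^ Suc n)) \<le> M * (1 / \<delta> ^ Suc n)"
        unfolding norm_mult using fM[OF **(1,2)] **(3) z1(1) M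
        by (intro mult_mono) (simp_all add: norm_divide norm_power norm_mult)
    next
      fix Y assume "Y \<in> ball X r1"
      then have "f Y holomorphic_on cball z0 (2 * R)" using r1' fz by blast
      then have "continuous_on (sphere z1 \<delta>) (f Y)"
        using sub2 holomorphic_on_imp_continuous_on
        by (meson continuous_on_subset order_trans sphere_cball)
      then show "continuous_on (sphere z1 \<delta>) (\<lambda>u. f Y u * (1 / (u - z1) ^ Suc n))"
        using z1(1) by (intro continuous_intros) auto
    qed
    then have "cdiff (\<lambda>Y. 1 / (2 * of_real pi * \<i>) *
        contour_integral (circlepath z1 \<delta>) (\<lambda>u. f Y u * (1 / (u - z1) ^ Suc n))) X"
      by (rule cdiff_mult[OF cdiff_const])
    then show ?thesis
    proof (rule cdiff_transform[OF _ open_ball X])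
      fix Y assume "Y \<in> ball X0 r0"
      then have "f Y holomorphic_on cball z1 \<delta>" using fz sub2 by (meson ball_subset_cball holomorphic_on_subset subsetD)
      then have "contour_integral (circlepath z1 \<delta>) (\<lambda>u. f Y u / (u - z1) ^ Suc n)
          = (2 * pi * \<i>) * (deriv ^^ n) (f Y) z1 / fact n"
        using z1(1) by (intro Cauchy_contour_integral_circlepath)
          (auto intro: holomorphic_on_imp_continuous_on holomorphic_on_subset)
      then show "1 / (2 * of_real pi * \<i>) *
        contour_integral (circlepath z1 \<delta>) (\<lambda>u. f Y u * (1 / (u - z1) ^ Suc n)) = c n Y"
        by (simp add: c_def)
    qed
  qed
  have cbound: "norm (c n X) \<le> K / d ^ n"
    if X: "X \<in> cball X0 r0" and d: "0 < d" "cball z1 d \<subseteq> cball z0 (2 * R)"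
      and K: "\<And>z. z \<in> cball z1 d \<Longrightarrow> norm (f X z) \<le> K" for X n K d
  proof -
    have h: "f X holomorphic_on cball z1 d" using fz[OF X] d(2) holomorphic_on_subset by blast
    have "norm ((deriv ^^ n) (f X) z1) \<le> fact n * K / d ^ n"
    proof (rule Cauchy_inequality[OF _ _ d(1)])
      show "f X holomorphic_on ball z1 d" using h by (rule holomorphic_on_subset) auto
      show "continuous_on (cball z1 d) (f X)" using h by (rule holomorphic_on_imp_continuous_on)
      fix u assume "norm (z1 - u) = d"
      then show "norm (f X u) \<le> K" by (intro K) (simp add: dist_norm)
    qed
    then show ?thesis by (simp add: c_def norm_divide field_simps)
  qed
  \<comment> \<open>Since M \<ge> 1, the bound M / \<delta>^n is at most B^n for n \<ge> 1, the form
    required by Hartogs's lemma.\<close>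
  define B where "B = M / \<delta>"
  define \<rho> where "\<rho> = r0 / 4"
  have \<rho>: "0 < \<rho>" "4 * \<rho> = r0" using r0 by (auto simp: \<rho>_def)
  have cB0: "norm (c n X) \<le> M / \<delta> ^ n" if "X \<in> ball X0 r0" for n X
    by (rule cbound) (use that z1(1) sub2 fM in auto)
  have "\<forall>\<^sub>F n in sequentially. \<forall>X\<in>ball X0 \<rho>. norm (c n X) \<le> (2 * (2 / R)) ^ n"
  proof (rule hartogs_lemma[OF \<rho>(1), where B = B])
    show "0 < 2 / R" "0 < B" using R M z1(1) by (auto simp: B_def)
    show "cdiff (c n) X" if "X \<in> ball X0 (4 * \<rho>)" for n X using cc that \<rho> by simp
    show "norm (c n X) \<le> B ^ n" if "1 \<le> n" "X \<in> ball X0 (4 * \<rho>)" for n X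
    proof -
      have "norm (c n X) \<le> M / \<delta> ^ n" using cB0 that \<rho> by simp
      also have "M \<le> M ^ n" using M that by (intro self_le_power) auto
      finally show ?thesis using z1(1) by (simp add: B_def power_divide divide_right_mono)
    qed
    fix X assume "X \<in> ball X0 (4 * \<rho>)"
    then have X: "X \<in> cball X0 r0" using \<rho> by simp
    have "bounded (f X ` cball z1 R)"
      using holomorphic_on_imp_continuous_on[OF fz[OF X]] sub1
      by (intro compact_imp_bounded compact_continuous_image) (auto intro: continuous_on_subset)
    then obtain K where K: "\<And>z. z \<in> cball z1 R \<Longrightarrow> norm (f X z) \<le> K" by (metis bounded_iff imageI)
    \<comment> \<open>The bound \<open>K\<close> depends on X; it is absorbed by 2^n, which turns 1
      / R into 2 / R.\<close>
    obtain n1 where "K < 2 ^ n1" using real_arch_pow[of 2 K] by auto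
    then have "K \<le> 2 ^ n" if "n1 \<le> n" for n
      using power_increasing[OF that, of "2::real"] \<open>K < 2 ^ n1\<close> by linarith
    then have "\<forall>\<^sub>F n in sequentially. K \<le> 2 ^ n" unfolding eventually_sequentially by blast
    then show "\<forall>\<^sub>F n in sequentially. norm (c n X) \<le> (2 / R) ^ n"
    proof eventually_elim
      case (elim n)
      have "norm (c n X) \<le> K / R ^ n" by (rule cbound) (use X R sub1 K in auto)
      also have "\<dots> \<le> 2 ^ n / R ^ n" using elim R by (intro divide_right_mono) auto
      finally show ?case by (simp add: power_divide)
    qed
  qed
  moreover have "2 * (2 / R) = 4 / R" by simp
  ultimately obtain n0 where n0: "\<And>n X. n0 \<le> n \<Longrightarrow> X \<in> ball X0 \<rho> \<Longrightarrow> norm (c n X) \<le> (4 / R) ^ n"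
    unfolding eventually_sequentially by metis
  \<comment> \<open>For z within R / 16 of \<open>z0\<close> the distance to \<open>z1\<close> is
    below R / 8, so from \<open>n0\<close> on the terms are at most (4 / R * (R / 8))^n = (1 / 2)^n.
    Below \<open>n0\<close> the bound M / \<delta>^n serves.\<close>
  define K where "K = (\<lambda>n. if n < n0 then M / \<delta> ^ n * (R / 8) ^ n else (1 / 2) ^ n)"
  have sumK: "summable K"
  proof (rule summable_comparison_test_ev)
    show "\<forall>\<^sub>F n in sequentially. norm (K n) \<le> (1 / 2) ^ n"
      using eventually_ge_at_top[of n0] by eventually_elim (simp add: K_def)
  qed (rule summable_geometric, simp)
  define r where "r = min \<rho> (R / 16)"
  have r: "0 < r" using \<rho> R by (simp add: r_def)
  have "ball X0 r \<subseteq> V" using r0 \<rho> by (auto simp: r_def)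
  moreover have "norm (f X z) \<le> suminf K" if X: "X \<in> ball X0 r" and z: "z \<in> ball z0 r" for X z
  proof -
    have X': "X \<in> ball X0 \<rho>" "X \<in> cball X0 r0" "X \<in> ball X0 r0" using X \<rho> by (auto simp: r_def)
    have zz1: "norm (z - z1) < R / 8"
      using z z1z0 dist_triangle[of z z1 z0] by (simp add: r_def dist_norm norm_minus_commute)
    have "(\<lambda>n. (deriv ^^ n) (f X) z1 / fact n * (z - z1) ^ n) sums f X z"
    proof (rule holomorphic_power_series)
      show "f X holomorphic_on ball z1 R"
        using fz[OF X'(2)] sub1 by (meson ball_subset_cball holomorphic_on_subset order_trans)
      show "z \<in> ball z1 R" using zz1 R by (simp add: dist_norm norm_minus_commute)
    qed
    then have s: "(\<lambda>n. c n X * (z - z1) ^ n) sums f X z" by (simp add: c_def)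
    have "norm (c n X * (z - z1) ^ n) \<le> K n" for n
    proof (cases "n < n0")
      case True
      have "norm (c n X * (z - z1) ^ n) \<le> M / \<delta> ^ n * (R / 8) ^ n"
        unfolding norm_mult norm_power using cB0[OF X'(3), of n] zz1 M z1(1)
        by (intro mult_mono power_mono) auto
      then show ?thesis using True by (simp add: K_def)
    next
      case False
      have "norm (c n X * (z - z1) ^ n) \<le> (4 / R) ^ n * (R / 8) ^ n"
        unfolding norm_mult norm_power using n0[of n X] False X' zz1 R
        by (intro mult_mono power_mono) auto
      also have "\<dots> = (1 / 2) ^ n" using R by (simp add: power_mult_distrib[symmetric])
      finally show ?thesis using False by (simp add: K_def)
    qed
    then have "norm (\<Sum>n. c n X * (z - z1) ^ n) \<le> suminf K"
      by (intro norm_suminf_le sumK)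
    then show ?thesis using s by (simp add: sums_iff)
  qed
  ultimately show ?thesis using r by blast
qed

lemma sep_hol_bounded_on_compact:
  assumes V: "open V" and W: "open W" and f: "sep_hol V W f" and X: "X \<in> V"
    and K: "compact K" "K \<subseteq> W"
  shows "\<exists>r>0. \<exists>M. ball X r \<subseteq> V \<and> (\<forall>Y\<in>ball X r. \<forall>z\<in>K. norm (f Y z) \<le> M)"
proof -
  have "\<forall>z\<in>K. \<exists>r>0. \<exists>M. ball X r \<subseteq> V \<and> (\<forall>Y\<in>ball X r. \<forall>u\<in>ball z r. norm (f Y u) \<le> M)"
    using sep_hol_locally_bounded[OF V W f X] K(2) by blast
  then obtain r M where rM: "\<And>z. z \<in> K \<Longrightarrow> 0 < r z"
    "\<And>z Y u. z \<in> K \<Longrightarrow> Y \<in> ball X (r z) \<Longrightarrow> u \<in> ball z (r z) \<Longrightarrow> norm (f Y u) \<le> M z"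
    by metis
  obtain C where C: "C \<subseteq> K" "finite C" "K \<subseteq> (\<Union>z\<in>C. ball z (r z))"
    by (rule compactE_image[OF K(1), of K "\<lambda>z. ball z (r z)"]) (use rM in auto)
  obtain r0 where r0: "0 < r0" "ball X r0 \<subseteq> V" using V X open_contains_ball by blast
  define s where "s = Min (insert r0 (r ` C))"
  have s: "0 < s" "s \<le> r0" "\<And>z. z \<in> C \<Longrightarrow> s \<le> r z"
    using C rM r0 by (auto simp: s_def)
  have "norm (f Y u) \<le> Max (M ` C)" if "Y \<in> ball X s" "u \<in> K" for Y u
  proof -
    obtain z where z: "z \<in> C" "u \<in> ball z (r z)" using C(3) \<open>u \<in> K\<close> by blast
    then have "norm (f Y u) \<le> M z" using that C s(3)[OF z(1)] by (intro rM) auto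
    also have "\<dots> \<le> Max (M ` C)" using C z by simp
    finally show ?thesis .
  qed
  moreover have "ball X s \<subseteq> V" using r0 s by auto
  ultimately show ?thesis using s(1) by blast
qed

text \<open>A polynomial path has a continuous derivative, and local boundedness along its compact
  image supplies the uniform bound for differentiation under the integral.\<close>

lemma sep_hol_contour_integral:
  assumes V: "open V" and W: "open W" and f: "sep_hol V W f" and X: "X \<in> V"
    and g: "polynomial_function g" "path_image g \<subseteq> W"
  shows "cdiff (\<lambda>Y. contour_integral g (f Y)) X"
proof -
  obtain g' where g': "polynomial_function g'" "\<And>t. (g has_vector_derivative g' t) (at t)"
    using has_vector_derivative_polynomial_function[OF g(1)] by blast
  have "path g" using g(1) by (rule path_polynomial_function)
  then obtain r M where r: "0 < r" "ball X r \<subseteq> V"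
      "\<And>Y z. Y \<in> ball X r \<Longrightarrow> z \<in> path_image g \<Longrightarrow> norm (f Y z) \<le> M"
    using sep_hol_bounded_on_compact[OF V W f X _ g(2)] compact_path_image by meson
  show ?thesis
  proof (rule cdiff_contour_integral[OF r(1)])
    show "(g has_vector_derivative g' t) (at t)" for t by (rule g'(2))
    show "continuous_on {0..1} g'" using g'(1) by (rule continuous_on_polymonial_function)
    fix Y assume Y: "Y \<in> ball X r"
    show "cdiff (\<lambda>Y. f Y z) Y" if "z \<in> path_image g" for z
      using f Y r(2) g(2) that unfolding sep_hol_def by blast
    show "norm (f Y z) \<le> M" if "z \<in> path_image g" for z using r(3)[OF Y that] .
    show "continuous_on (path_image g) (f Y)"
      using f Y r(2) g(2) unfolding sep_hol_def
      by (meson continuous_on_subset holomorphic_on_imp_continuous_on subsetD)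
  qed
qed

text \<open>Cauchy's formula writes the z-derivative as an integral of f over a circle, which is
  complex differentiable in X by local boundedness. The Riccati recursion differentiates in z at
  each step.\<close>

lemma sep_hol_deriv:
  assumes V: "open V" and W: "open W" and f: "sep_hol V W f"
  shows "sep_hol V W (\<lambda>X. deriv (f X))"
  unfolding sep_hol_def
proof (intro conjI ballI)
  show "deriv (f X) holomorphic_on W" if "X \<in> V" for X
    using f that W unfolding sep_hol_def by (intro holomorphic_deriv) auto
  fix z X assume z: "z \<in> W" and X: "X \<in> V"
  obtain d where d: "0 < d" "cball z d \<subseteq> W" using W z open_contains_cball by blast
  have sW: "sphere z d \<subseteq> W" using d by auto
  obtain r M where r: "0 < r" "ball X r \<subseteq> V"
      "\<And>Y u. Y \<in> ball X r \<Longrightarrow> u \<in> sphere z d \<Longrightarrow> norm (f Y u) \<le> M"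
    using sep_hol_bounded_on_compact[OF V W f X _ sW] by (meson compact_sphere)
  have "cdiff (\<lambda>Y. contour_integral (circlepath z d) (\<lambda>u. f Y u * (1 / (u - z)\<^sup>2))) X"
  proof (rule cdiff_circle_integral[OF d(1) r(1), where M = "M * (1 / d\<^sup>2)"])
    fix Y u assume *: "Y \<in> ball X r" "u \<in> sphere z d"
    then have nu: "norm (u - z) = d" by (simp add: dist_norm norm_minus_commute)
    have "cdiff (\<lambda>Y. f Y u) Y" using f * r(2) sW unfolding sep_hol_def by blast
    then show "cdiff (\<lambda>Y. f Y u * (1 / (u - z)\<^sup>2)) Y" by (rule cdiff_mult[OF _ cdiff_const])
    show "norm (f Y u * (1 / (u - z)\<^sup>2)) \<le> M * (1 / d\<^sup>2)"
      using r(3)[OF *] d(1) by (simp add: norm_mult norm_divide norm_power nu divide_right_mono)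
  next
    fix Y assume "Y \<in> ball X r"
    then have "continuous_on (sphere z d) (f Y)"
      using f r(2) sW unfolding sep_hol_def
      by (meson continuous_on_subset holomorphic_on_imp_continuous_on subsetD)
    then show "continuous_on (sphere z d) (\<lambda>u. f Y u * (1 / (u - z)\<^sup>2))"
      using d(1) by (intro continuous_intros) auto
  qed
  then have "cdiff (\<lambda>Y. 1 / (2 * of_real pi * \<i>) *
      contour_integral (circlepath z d) (\<lambda>u. f Y u * (1 / (u - z)\<^sup>2))) X"
    by (rule cdiff_mult[OF cdiff_const])
  then show "cdiff (\<lambda>X. deriv (f X) z) X"
  proof (rule cdiff_transform[OF _ V X])
    fix Y assume "Y \<in> V"
    then have "f Y holomorphic_on cball z d" using f d(2) unfolding sep_hol_def
      by (meson holomorphic_on_subset)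
    then have "contour_integral (circlepath z d) (\<lambda>u. f Y u / (u - z)\<^sup>2) = (2 * pi * \<i>) * deriv (f Y) z"
      using d(1) by (intro Cauchy_contour_integral_circlepath_2)
        (auto intro: holomorphic_on_imp_continuous_on holomorphic_on_subset)
    then show "1 / (2 * of_real pi * \<i>) *
      contour_integral (circlepath z d) (\<lambda>u. f Y u * (1 / (u - z)\<^sup>2)) = deriv (f Y) z" by simp
  qed
qed

lemma sep_hol_const: "sep_hol V W (\<lambda>X z. c)"
  by (auto simp: sep_hol_def)

lemma sep_hol_add: "sep_hol V W f \<Longrightarrow> sep_hol V W g \<Longrightarrow> sep_hol V W (\<lambda>X z. f X z + g X z)"
  by (auto simp: sep_hol_def intro!: holomorphic_intros)

lemma sep_hol_mult: "sep_hol V W f \<Longrightarrow> sep_hol V W g \<Longrightarrow> sep_hol V W (\<lambda>X z. f X z * g X z)"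
  by (auto simp: sep_hol_def intro!: holomorphic_intros)

lemma sep_hol_sum:
  "(\<And>i. i \<in> I \<Longrightarrow> sep_hol V W (f i)) \<Longrightarrow> sep_hol V W (\<lambda>X z. \<Sum>i\<in>I. f i X z)"
  by (auto simp: sep_hol_def intro!: holomorphic_intros)

end


subsection \<open>Siegel space and the automorphy factor\<close>

definition csc :: "complex \<Rightarrow> ('n::finite, 'g::finite) periods \<Rightarrow> ('n, 'g) periods" where
  "csc c X = (\<chi> \<nu> i j. c * X $ \<nu> $ i $ j)"

lemma complex_scaling_csc:
  "complex_scaling (csc :: complex \<Rightarrow> ('n::finite, 'g::finite) periods \<Rightarrow> ('n, 'g) periods)"
proof (rule complex_scaling.intro)
  show "bounded_bilinear (csc :: complex \<Rightarrow> ('n, 'g) periods \<Rightarrow> _)"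
    unfolding bilinear_conv_bounded_bilinear[symmetric] bilinear_def
    by (auto intro!: linearI simp: csc_def vec_eq_iff algebra_simps)
  show "norm (csc c x) = norm c * norm x" for c and x :: "('n, 'g) periods"
    by (simp add: csc_def norm_vec_def norm_mult L2_set_right_distrib)
qed (simp_all add: csc_def vec_eq_iff mult.assoc)

interpretation periods: complex_scaling csc
  by (rule complex_scaling_csc)

text \<open>The projection onto tuples of symmetric matrices. A function on
  \<open>siegel_prod\<close> composed with it is defined on a neighbourhood in the whole matrix
  space, where derivatives are taken without restriction to a subset.\<close>

definition symm :: "('n::finite, 'g::finite) periods \<Rightarrow> ('n, 'g) periods" where
  "symm X = (\<chi> \<nu> i j. (X $ \<nu> $ i $ j + X $ \<nu> $ j $ i) / 2)"

lemma bounded_linear_symm: "bounded_linear symm"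
  unfolding linear_conv_bounded_linear[symmetric]
  by (rule linearI) (simp_all add: symm_def vec_eq_iff scaleR_conv_of_real[where 'a = complex] algebra_simps add_divide_distrib)

lemma symm_csc: "symm (csc c X) = csc c (symm X)"
  by (simp add: symm_def csc_def vec_eq_iff algebra_simps)

lemma siegel_sym: "Z \<in> siegel \<Longrightarrow> Z $ i $ j = Z $ j $ i"
  unfolding siegel_def transpose_def by (auto simp: vec_eq_iff)

lemma symm_siegel_prod: "\<Omega> \<in> siegel_prod \<Longrightarrow> symm \<Omega> = \<Omega>"
  using siegel_sym by (fastforce simp: symm_def siegel_prod_def vec_eq_iff)

text \<open>Homogeneity of the quadratic form reduces positivity to unit vectors, which form a
  compact set, as the tube lemma requires.\<close>

lemma siegel_iff:
  "Z \<in> siegel \<longleftrightarrow> (\<forall>i j. Z $ i $ j = Z $ j $ i) \<and>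
    (\<forall>v::real ^ 'n::finite. norm v = 1 \<longrightarrow> (\<Sum>i\<in>UNIV. \<Sum>j\<in>UNIV. v $ i * Im (Z $ i $ j) * v $ j) > 0)"
    (is "?L \<longleftrightarrow> ?S \<and> ?P")
proof -
  define q where "q = (\<lambda>v::real ^ 'n. \<Sum>i\<in>UNIV. \<Sum>j\<in>UNIV. v $ i * Im (Z $ i $ j) * v $ j)"
  have q: "v \<bullet> ((\<chi> i j. Im (Z $ i $ j)) *v v) = q v" for v
    by (simp add: q_def inner_vec_def matrix_vector_mult_def sum_distrib_left mult.assoc)
  have scale: "q (c *\<^sub>R v) = c\<^sup>2 * q v" for c v
    by (simp add: q_def sum_distrib_left power2_eq_square algebra_simps)
  have "(\<forall>v. v \<noteq> 0 \<longrightarrow> q v > 0) \<longleftrightarrow> (\<forall>v. norm v = 1 \<longrightarrow> q v > 0)"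
  proof (intro iffI allI impI)
    fix v :: "real ^ 'n" assume *: "\<forall>v. norm v = 1 \<longrightarrow> q v > 0" and v: "v \<noteq> 0"
    have "q (inverse (norm v) *\<^sub>R v) > 0" using * v by simp
    then show "q v > 0" using v by (simp add: scale zero_less_mult_iff)
  next
    fix v :: "real ^ 'n" assume *: "\<forall>v. v \<noteq> 0 \<longrightarrow> q v > 0" and v: "norm v = 1"
    from v have "v \<noteq> 0" by auto
    with * show "q v > 0" by blast
  qed
  moreover have "transpose Z = Z \<longleftrightarrow> ?S" by (auto simp: transpose_def vec_eq_iff)
  ultimately show ?thesis by (simp add: siegel_def q q_def)
qed

text \<open>The quadratic form of the imaginary part is jointly continuous in the matrix and the
  vector, so positivity on the compact unit sphere persists near \<open>\<Omega>\<close>; symmetry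
  is supplied by \<open>symm\<close>.\<close>

lemma symm_in_siegel_prod:
  assumes "\<Omega> \<in> siegel_prod"
  shows "\<exists>\<delta>>0. \<forall>X\<in>ball \<Omega> \<delta>. symm X \<in> (siegel_prod :: ('n::finite, 'g::finite) periods set)"
proof -
  have "\<exists>\<delta>>0. \<forall>X\<in>ball \<Omega> \<delta>. symm X $ \<nu> \<in> siegel" for \<nu>
  proof -
    define Q where "Q = (\<lambda>(X :: ('n, 'g) periods, v :: real ^ 'n).
      \<Sum>i\<in>UNIV. \<Sum>j\<in>UNIV. v $ i * Im (symm X $ \<nu> $ i $ j) * v $ j)"
    have "open (Q -` {0<..})"
      unfolding Q_def symm_def case_prod_unfold
      by (intro open_vimage) (auto intro!: continuous_intros)
    moreover have "{\<Omega>} \<times> sphere 0 1 \<subseteq> Q -` {0<..}"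
      using assms symm_siegel_prod[OF assms]
      by (auto simp: Q_def siegel_prod_def siegel_iff)
    ultimately obtain U where U: "\<Omega> \<in> U" "open U" "U \<times> sphere 0 1 \<subseteq> Q -` {0<..}"
      using Elementary_Topology.tube_lemma[of "sphere 0 1" "Q -` {0<..}" \<Omega>] by auto
    then obtain \<delta> where \<delta>: "\<delta> > 0" "ball \<Omega> \<delta> \<subseteq> U" by (meson open_contains_ball)
    have "symm X $ \<nu> \<in> siegel" if "X \<in> ball \<Omega> \<delta>" for X
    proof -
      have "X \<in> U" using \<delta> that by blast
      then have "Q (X, v) > 0" if "norm v = 1" for v
      proof -
        have "(X, v) \<in> U \<times> sphere 0 1" using \<open>X \<in> U\<close> that by simp
        then show ?thesis using U(3) by blast
      qed
      then show ?thesis by (simp add: siegel_iff Q_def symm_def add.commute)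
    qed
    with \<delta>(1) show ?thesis by blast
  qed
  then obtain \<delta> where \<delta>: "\<And>\<nu>. \<delta> \<nu> > 0" "\<And>\<nu> X. X \<in> ball \<Omega> (\<delta> \<nu>) \<Longrightarrow> symm X $ \<nu> \<in> siegel"
    by metis
  have "Min (range \<delta>) > 0" using \<delta>(1) by simp
  moreover have "symm X \<in> siegel_prod" if "X \<in> ball \<Omega> (Min (range \<delta>))" for X
    unfolding siegel_prod_def using that by (auto intro!: \<delta>(2) elim: order.strict_trans2)
  ultimately show ?thesis by blast
qed

lemma cdiff_pullback:
  assumes f: "holomorphic_periods f U" and X: "symm X \<in> U"
    and V: "open V" "X \<in> V" "symm ` V \<subseteq> siegel_prod"
  shows "periods.cdiff (\<lambda>X. f (symm X)) X"
proof -
  obtain c where c: "(f has_derivative (\<lambda>H. \<Sum>\<nu>\<in>UNIV. \<Sum>i\<in>UNIV. \<Sum>j\<in>UNIV. c $ \<nu> $ i $ j * H $ \<nu> $ i $ j))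
       (at (symm X) within siegel_prod)" (is "(f has_derivative ?D) _")
    using f X unfolding holomorphic_periods_def by blast
  have "(symm has_derivative symm) (at X within V)"
    by (intro bounded_linear_imp_has_derivative bounded_linear_symm)
  from has_derivative_in_compose[OF this has_derivative_subset[OF c V(3)]]
  have "((\<lambda>X. f (symm X)) has_derivative (\<lambda>H. ?D (symm H))) (at X)"
    unfolding at_within_open[OF V(2,1)] .
  moreover have "?D (symm (csc a H)) = a * ?D (symm H)" for a H
    unfolding symm_csc sum_distrib_left by (intro sum.cong refl) (simp add: csc_def)
  ultimately show ?thesis
    unfolding periods.cdiff_def by (intro exI[of _ "\<lambda>H. ?D (symm H)"] conjI allI)
qed

text \<open>Within \<open>siegel_prod\<close> the composition with \<open>symm\<close> has no
  effect, and the coefficients \<open>c\<close> are the values of the complex linear derivative at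
  the elementary matrices.\<close>

lemma cdiff_pushforward:
  fixes f :: "('n::finite, 'g::finite) periods \<Rightarrow> complex"
  assumes f: "periods.cdiff (\<lambda>X. f (symm X)) \<Omega>" and \<Omega>: "\<Omega> \<in> siegel_prod"
  shows "\<exists>c :: ('n, 'g) periods.
     (f has_derivative (\<lambda>H. \<Sum>\<nu>\<in>UNIV. \<Sum>i\<in>UNIV. \<Sum>j\<in>UNIV. c $ \<nu> $ i $ j * H $ \<nu> $ i $ j))
       (at \<Omega> within siegel_prod)"
proof -
  obtain D where D: "((\<lambda>X. f (symm X)) has_derivative D) (at \<Omega>)" "\<And>a H. D (csc a H) = a * D H"
    using f unfolding periods.cdiff_def by blast
  have "((\<lambda>X. f (symm X)) has_derivative D) (at \<Omega> within siegel_prod)"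
    using D(1) by (rule has_derivative_at_withinI)
  then have *: "(f has_derivative D) (at \<Omega> within siegel_prod)"
    by (rule has_derivative_transform[OF \<Omega>, rotated]) (simp add: symm_siegel_prod)
  define e :: "'g \<Rightarrow> 'n \<Rightarrow> 'n \<Rightarrow> ('n, 'g) periods" where
    "e = (\<lambda>\<nu> i j. axis \<nu> (axis i (axis j 1)))"
  define c :: "('n, 'g) periods" where "c = (\<chi> \<nu> i j. D (e \<nu> i j))"
  have lin: "linear D" using D(1) by (rule has_derivative_linear)
  have e_nth: "e \<nu> i j $ \<nu>' $ i' $ j' = (if \<nu> = \<nu>' then if i = i' then if j = j' then 1 else 0 else 0 else 0)"
    for \<nu> \<nu>' i i' j j'
    by (simp add: e_def axis_def)
  have H: "(\<Sum>\<nu>\<in>UNIV. \<Sum>i\<in>UNIV. \<Sum>j\<in>UNIV. csc (H $ \<nu> $ i $ j) (e \<nu> i j)) = H" for H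
  proof -
    have if0: "(\<Sum>j\<in>A. if P then f j else 0) = (if P then \<Sum>j\<in>A. f j else 0)"
      for A P and f :: "'i \<Rightarrow> complex"
      by simp
    have "(\<Sum>\<nu>\<in>UNIV. \<Sum>i\<in>UNIV. \<Sum>j\<in>UNIV. csc (H $ \<nu> $ i $ j) (e \<nu> i j)) $ \<nu>' $ i' $ j'
      = (\<Sum>\<nu>\<in>UNIV. \<Sum>i\<in>UNIV. \<Sum>j\<in>UNIV. if \<nu> = \<nu>' then if i = i' then if j = j' then H $ \<nu> $ i $ j else 0 else 0 else 0)"
      for \<nu>' i' j'
      unfolding sum_component by (intro sum.cong refl) (simp add: csc_def e_nth)
    then show ?thesis by (simp add: vec_eq_iff if0)
  qed
  have "D H = (\<Sum>\<nu>\<in>UNIV. \<Sum>i\<in>UNIV. \<Sum>j\<in>UNIV. c $ \<nu> $ i $ j * H $ \<nu> $ i $ j)" for H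
    using arg_cong[OF H, of D H] by (simp add: linear_sum[OF lin] D(2) c_def mult.commute)
  then have "D = (\<lambda>H. \<Sum>\<nu>\<in>UNIV. \<Sum>i\<in>UNIV. \<Sum>j\<in>UNIV. c $ \<nu> $ i $ j * H $ \<nu> $ i $ j)" by blast
  from *[unfolded this] show ?thesis by (rule exI)
qed

section \<open>Nonvanishing of the automorphy factor\<close>

lemma field_embedding_simps:
  assumes "field_embedding \<sigma>"
  shows "\<sigma> (x + y) = \<sigma> x + \<sigma> y" "\<sigma> (x * y) = \<sigma> x * \<sigma> y" "\<sigma> 1 = 1" "\<sigma> 0 = 0" "\<sigma> (- x) = - \<sigma> x"
    "\<sigma> (sum f I) = (\<Sum>i\<in>I. \<sigma> (f i))"
proof -
  show a: "\<sigma> (x + y) = \<sigma> x + \<sigma> y" "\<sigma> (x * y) = \<sigma> x * \<sigma> y" "\<sigma> 1 = 1" for x y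
    using assms by (auto simp: field_embedding_def)
  show z: "\<sigma> 0 = 0" using a(1)[of 0 0] by (metis add.right_neutral add_left_imp_eq)
  show "\<sigma> (- x) = - \<sigma> x" using a(1)[of "- x" x] z by (metis add.left_inverse neg_eq_iff_add_eq_0 add.commute)
  show "\<sigma> (sum f I) = (\<Sum>i\<in>I. \<sigma> (f i))"
    by (induction I rule: infinite_finite_induct) (simp_all add: a z)
qed

lemma conj_mat_symplectic:
  assumes \<sigma>: "field_embedding \<sigma>" and \<alpha>: "\<alpha> \<in> Sp UNIV"
  shows "transpose (conj_mat \<sigma> \<alpha>) ** sympl_form ** conj_mat \<sigma> \<alpha> = sympl_form"
proof -
  have mult: "conj_mat \<sigma> (A ** B) = conj_mat \<sigma> A ** conj_mat \<sigma> B" for A B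
    by (simp add: conj_mat_def matrix_matrix_mult_def vec_eq_iff field_embedding_simps[OF \<sigma>])
  have tr: "conj_mat \<sigma> (transpose A) = transpose (conj_mat \<sigma> A)" for A
    by (simp add: conj_mat_def transpose_def vec_eq_iff)
  have J: "conj_mat \<sigma> sympl_form = sympl_form"
    by (auto simp: conj_mat_def sympl_form_def vec_eq_iff field_embedding_simps[OF \<sigma>] split: sum.splits)
  have "transpose \<alpha> ** sympl_form ** \<alpha> = sympl_form" using \<alpha> by (simp add: Sp_def)
  from arg_cong[OF this, of "conj_mat \<sigma>"] show ?thesis by (simp add: mult tr J)
qed

lemma sum_UNIV_sum: "(\<Sum>x\<in>UNIV. f x) = (\<Sum>i\<in>UNIV. f (Inl i)) + (\<Sum>i\<in>UNIV. f (Inr i))"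
  for f :: "'a::finite + 'b::finite \<Rightarrow> 'c::comm_monoid_add"
  using sum.Plus[of "UNIV :: 'a set" "UNIV :: 'b set" f] by (simp add: comp_def)

text \<open>Suppose v is a nonzero kernel vector of C Z + D and put x = (Z v, v). The lower half of
  M x vanishes, so the form y |-> \<open>dot (cj y) (sympl_form *v y)\<close> is 0 at M x. Being
  real and symplectic, M preserves this form, whose value at x is 2 i times the Hermitian form of Im
  Z at v, hence nonzero.\<close>

lemma det_factor_nonzero:
  fixes Z :: "complex ^ 'n ^ 'n::finite"
  assumes \<sigma>: "field_embedding \<sigma>" and \<alpha>: "\<alpha> \<in> Sp UNIV" and Z: "Z \<in> siegel"
  shows "det (blockC (conj_mat \<sigma> \<alpha>) ** Z + blockD (conj_mat \<sigma> \<alpha>)) \<noteq> 0"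
proof
  define M where "M = conj_mat \<sigma> \<alpha>"
  assume "det (blockC (conj_mat \<sigma> \<alpha>) ** Z + blockD (conj_mat \<sigma> \<alpha>)) = 0"
  then have "\<not> invertible (blockC M ** Z + blockD M)" by (simp add: invertible_det_nz M_def)
  then obtain v where v: "(blockC M ** Z + blockD M) *v v = 0" "v \<noteq> 0"
    unfolding invertible_left_inverse matrix_left_invertible_ker by blast
  define dot :: "complex ^ ('n + 'n) \<Rightarrow> complex ^ ('n + 'n) \<Rightarrow> complex"
    where "dot = (\<lambda>x y. \<Sum>k\<in>UNIV. x $ k * y $ k)"
  have dot: "dot (A *v x) y = dot x (transpose A *v y)" for A x y
    unfolding dot_def matrix_vector_mult_def transpose_def vec_lambda_beta sum_distrib_left sum_distrib_right
    by (subst sum.swap) (simp add: mult_ac)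
  define x where "x = (\<chi> k. case k of Inl i \<Rightarrow> (Z *v v) $ i | Inr i \<Rightarrow> v $ i)"
  define cj :: "complex ^ ('n + 'n) \<Rightarrow> complex ^ ('n + 'n)" where "cj = (\<lambda>x. \<chi> k. cnj (x $ k))"
  have cjM: "cj (M *v x) = M *v cj x" for x
    by (simp add: cj_def M_def conj_mat_def matrix_vector_mult_def vec_eq_iff)
  have J: "dot y (sympl_form *v x) = (\<Sum>i\<in>UNIV. y $ Inr i * x $ Inl i - y $ Inl i * x $ Inr i)" for x y
    by (simp add: dot_def sum_UNIV_sum matrix_vector_mult_def sympl_form_def sum_subtractf sum_negf
        if_distrib[of "\<lambda>x. x * _"] cong: if_cong)
  have "dot (cj (M *v x)) (sympl_form *v (M *v x)) = dot (cj x) ((transpose M ** sympl_form ** M) *v x)"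
    by (simp add: cjM dot matrix_vector_mul_assoc matrix_mul_assoc)
  also have "\<dots> = dot (cj x) (sympl_form *v x)"
    using conj_mat_symplectic[OF \<sigma> \<alpha>] by (simp add: M_def)
  finally have eq: "dot (cj (M *v x)) (sympl_form *v (M *v x)) = dot (cj x) (sympl_form *v x)" .
  have "(M *v x) $ Inr i = 0" for i
  proof -
    have "(M *v x) $ Inr i = ((blockC M ** Z + blockD M) *v v) $ i"
      by (simp add: matrix_vector_mult_add_rdistrib matrix_vector_mul_assoc[symmetric])
         (simp add: matrix_vector_mult_def x_def sum_UNIV_sum blockC_def blockD_def)
    then show ?thesis using v by simp
  qed
  then have "dot (cj (M *v x)) (sympl_form *v (M *v x)) = 0" by (simp add: J cj_def)
  with eq have z: "(\<Sum>i\<in>UNIV. cnj (v $ i) * (Z *v v) $ i - cnj ((Z *v v) $ i) * v $ i) = 0"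
    by (simp add: J cj_def x_def)
  have "(\<Sum>i\<in>UNIV. cnj ((Z *v v) $ i) * v $ i) = (\<Sum>i\<in>UNIV. \<Sum>j\<in>UNIV. cnj (Z $ i $ j) * cnj (v $ j) * v $ i)"
    by (simp add: matrix_vector_mult_def sum_distrib_right)
  also have "\<dots> = (\<Sum>j\<in>UNIV. \<Sum>i\<in>UNIV. cnj (Z $ i $ j) * cnj (v $ j) * v $ i)" by (rule sum.swap)
  also have "\<dots> = (\<Sum>i\<in>UNIV. \<Sum>j\<in>UNIV. cnj (v $ i) * (cnj (Z $ i $ j) * v $ j))"
    by (intro sum.cong refl) (simp add: siegel_sym[OF Z] mult_ac)
  finally have eq2: "(\<Sum>i\<in>UNIV. cnj ((Z *v v) $ i) * v $ i) = \<dots>" .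
  define T where "T = (\<Sum>i\<in>UNIV. \<Sum>j\<in>UNIV. cnj (v $ i) * of_real (Im (Z $ i $ j)) * v $ j)"
  have "0 = (\<Sum>i\<in>UNIV. cnj (v $ i) * (Z *v v) $ i) - (\<Sum>i\<in>UNIV. cnj ((Z *v v) $ i) * v $ i)"
    using z by (simp add: sum_subtractf)
  also have "\<dots> = (\<Sum>i\<in>UNIV. \<Sum>j\<in>UNIV. cnj (v $ i) * (Z $ i $ j - cnj (Z $ i $ j)) * v $ j)"
    unfolding eq2 by (simp add: matrix_vector_mult_def sum_distrib_left algebra_simps sum_subtractf)
  also have "(\<Sum>i\<in>UNIV. \<Sum>j\<in>UNIV. cnj (v $ i) * (Z $ i $ j - cnj (Z $ i $ j)) * v $ j) = T * (2 * \<i>)"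
    unfolding T_def complex_diff_cnj sum_distrib_right by (intro sum.cong refl) simp
  finally have "T = 0" by simp
  \<comment> \<open>\<open>siegel\<close> tests positivity on real vectors, so the Hermitian form is
    split along the real and imaginary parts of \<open>v\<close>; the mixed terms are purely
    imaginary.\<close>
  moreover have "Re T = (\<Sum>i\<in>UNIV. \<Sum>j\<in>UNIV. Re (v $ i) * Im (Z $ i $ j) * Re (v $ j))
      + (\<Sum>i\<in>UNIV. \<Sum>j\<in>UNIV. Im (v $ i) * Im (Z $ i $ j) * Im (v $ j))"
    unfolding T_def sum.distrib[symmetric] Re_sum by (intro sum.cong refl) simp
  ultimately have "(\<Sum>i\<in>UNIV. \<Sum>j\<in>UNIV. Re (v $ i) * Im (Z $ i $ j) * Re (v $ j))
      + (\<Sum>i\<in>UNIV. \<Sum>j\<in>UNIV. Im (v $ i) * Im (Z $ i $ j) * Im (v $ j)) = 0"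
    by simp
  moreover define q where "q = (\<lambda>u::real ^ 'n. u \<bullet> ((\<chi> i j. Im (Z $ i $ j)) *v u))"
  have "q u = (\<Sum>i\<in>UNIV. \<Sum>j\<in>UNIV. u $ i * Im (Z $ i $ j) * u $ j)" for u
    by (simp add: q_def inner_vec_def matrix_vector_mult_def sum_distrib_left mult.assoc)
  ultimately have "q (\<chi> i. Re (v $ i)) + q (\<chi> i. Im (v $ i)) = 0" by simp
  moreover have qpos: "q u > 0" if "u \<noteq> 0" for u using Z that by (simp add: siegel_def q_def)
  moreover have qnn: "q u \<ge> 0" for u
    using qpos[of u] by (cases "u = 0") (simp_all add: q_def)
  ultimately have "q (\<chi> i. Re (v $ i)) = 0 \<and> q (\<chi> i. Im (v $ i)) = 0"
    using qnn[of "\<chi> i. Re (v $ i)"] qnn[of "\<chi> i. Im (v $ i)"] by linarith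
  then have "(\<chi> i. Re (v $ i)) = 0 \<and> (\<chi> i. Im (v $ i)) = 0"
    using qpos by (metis less_irrefl)
  then have "v = 0" by (simp add: vec_eq_iff complex_eq_iff)
  with v show False by simp
qed

lemma aut_factor_nonzero:
  assumes "\<And>\<nu>. field_embedding (\<phi> \<nu>)" "\<alpha> \<in> Sp UNIV" "\<Omega> \<in> siegel_prod"
  shows "aut_factor \<phi> \<alpha> \<Omega> \<noteq> 0"
proof -
  have "det (blockC (conj_mat (\<phi> \<nu>) \<alpha>) ** \<Omega> $ \<nu> + blockD (conj_mat (\<phi> \<nu>) \<alpha>)) \<noteq> 0" for \<nu>
    using assms(3) by (intro det_factor_nonzero assms) (simp add: siegel_prod_def)
  then show ?thesis by (simp add: aut_factor_def)
qed


subsection \<open>The universal covering and uniqueness of formal solutions\<close>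

lemma arc_inD:
  assumes "arc_in S w z \<gamma>"
  shows "path \<gamma>" "path_image \<gamma> \<subseteq> S" "pathstart \<gamma> = w" "pathfinish \<gamma> = z" "w \<in> S" "z \<in> S"
  using assms pathstart_in_path_image[of \<gamma>] pathfinish_in_path_image[of \<gamma>]
  unfolding arc_in_def by auto

lemma arc_in_join:
  assumes "arc_in S w x \<gamma>" "closed_segment x z \<subseteq> S"
  shows "arc_in S w z (\<gamma> +++ linepath x z)"
  using assms unfolding arc_in_def by (auto simp: path_image_join)

lemma path_class_cong: "homotopic_paths S \<gamma> \<delta> \<Longrightarrow> path_class S \<gamma> = path_class S \<delta>"
  unfolding path_class_def using homotopic_paths_sym homotopic_paths_trans by blast

lemma homotopic_paths_convex:
  fixes C :: "complex set"
  assumes "convex C" "C \<subseteq> S" "path p" "path_image p \<subseteq> C" "path q" "path_image q \<subseteq> C"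
    "pathstart q = pathstart p" "pathfinish q = pathfinish p"
  shows "homotopic_paths S p q"
  using assms convex_imp_simply_connected[OF assms(1)]
  by (meson homotopic_paths_subset simply_connected_eq_homotopic_paths)

lemma in_univ_cover_iff:
  "p \<in> univ_cover S w \<longleftrightarrow> (\<exists>\<gamma>. arc_in S w (fst p) \<gamma> \<and> p = (fst p, path_class S \<gamma>))"
  by (cases p) (auto simp: univ_cover_def)

lemma sheet_path_class:
  assumes "arc_in S w x \<gamma>" "closed_segment x z \<subseteq> S"
  shows "sheet S (x, path_class S \<gamma>) z = (z, path_class S (\<gamma> +++ linepath x z))"
proof -
  have l: "homotopic_paths S (linepath x z) (linepath x z)" using assms(2) by simp
  have "homotopic_paths S (\<gamma> +++ linepath x z) \<delta>"
    if "homotopic_paths S \<gamma> \<gamma>'" "homotopic_paths S (\<gamma>' +++ linepath x z) \<delta>" for \<gamma>' \<delta>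
    using homotopic_paths_join[OF that(1) l] that(2) arc_inD(4)[OF assms(1)] homotopic_paths_trans
    by (metis pathstart_linepath)
  moreover have "homotopic_paths S \<gamma> \<gamma>" using assms(1) by (simp add: arc_in_def)
  ultimately show ?thesis unfolding sheet_def path_class_def by (auto simp del: homotopic_paths_refl)
qed

lemma sheet_base_path_class:
  assumes "arc_in S w x \<gamma>" "closed_segment x z \<subseteq> S" "closed_segment w' w \<subseteq> S"
  shows "sheet_base S w (x, path_class S \<gamma>) w' z
    = (z, path_class S (linepath w' w +++ (\<gamma> +++ linepath x z)))"
proof -
  have l: "homotopic_paths S (linepath x z) (linepath x z)" "homotopic_paths S (linepath w' w) (linepath w' w)"
    using assms(2,3) by simp_all
  have "homotopic_paths S (linepath w' w +++ (\<gamma> +++ linepath x z)) \<delta>"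
    if *: "homotopic_paths S \<gamma> \<gamma>'" "homotopic_paths S (linepath w' w +++ (\<gamma>' +++ linepath x z)) \<delta>" for \<gamma>' \<delta>
  proof -
    have "homotopic_paths S (\<gamma> +++ linepath x z) (\<gamma>' +++ linepath x z)"
      using homotopic_paths_join[OF *(1) l(1)] arc_inD(4)[OF assms(1)] by simp
    from homotopic_paths_join[OF l(2) this] show ?thesis
      using *(2) arc_inD(3)[OF assms(1)] homotopic_paths_trans
      by (metis pathfinish_linepath pathstart_join)
  qed
  moreover have "homotopic_paths S \<gamma> \<gamma>" using assms(1) by (simp add: arc_in_def)
  ultimately show ?thesis unfolding sheet_base_def path_class_def by (auto simp del: homotopic_paths_refl)
qed

lemma fst_sheet [simp]: "fst (sheet S p z) = z"
  by (simp add: sheet_def)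

lemma segment_in_ball: "z \<in> ball x r \<Longrightarrow> z' \<in> ball x r \<Longrightarrow> ball x r \<subseteq> S \<Longrightarrow> closed_segment z z' \<subseteq> S"
  for x z z' :: complex
  by (meson closed_segment_subset convex_ball order_trans)

lemma centre_in_ball': "z \<in> ball x r \<Longrightarrow> x \<in> ball x r" for x z :: complex
  using zero_le_dist[of x z] by (simp del: zero_le_dist)

lemma sheet_in_univ_cover:
  assumes "p \<in> univ_cover S w" "ball (fst p) r \<subseteq> S" "z \<in> ball (fst p) r"
  shows "sheet S p z \<in> univ_cover S w"
proof -
  obtain \<gamma> where g: "arc_in S w (fst p) \<gamma>" "p = (fst p, path_class S \<gamma>)"
    using assms(1) in_univ_cover_iff by blast
  have seg: "closed_segment (fst p) z \<subseteq> S"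
    by (rule segment_in_ball[OF centre_in_ball'[OF assms(3)] assms(3,2)])
  have "sheet S p z = (z, path_class S (\<gamma> +++ linepath (fst p) z))"
    by (subst g(2)) (rule sheet_path_class[OF g(1) seg])
  then show ?thesis using arc_in_join[OF g(1) seg] by (auto simp: univ_cover_def)
qed

text \<open>Both routes from \<open>fst p\<close> to \<open>z'\<close> stay in a convex ball inside
  \<open>S\<close> and are homotopic there. This compatibility of charts allows local statements to
  be proved in the single chart of \<open>p\<close>.\<close>

lemma sheet_sheet:
  assumes p: "p \<in> univ_cover S w" and r: "ball (fst p) r \<subseteq> S"
    and z: "z \<in> ball (fst p) r" "z' \<in> ball (fst p) r"
  shows "sheet S (sheet S p z) z' = sheet S p z'"
proof -
  obtain \<gamma> where g: "arc_in S w (fst p) \<gamma>" "p = (fst p, path_class S \<gamma>)"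
    using p in_univ_cover_iff by blast
  let ?x = "fst p"
  note x = centre_in_ball'[OF z(1)]
  have seg: "closed_segment ?x z \<subseteq> S" "closed_segment ?x z' \<subseteq> S" "closed_segment z z' \<subseteq> S"
    using segment_in_ball r z x by blast+
  have eq: "sheet S p y = (y, path_class S (\<gamma> +++ linepath ?x y))" if "closed_segment ?x y \<subseteq> S" for y
    by (subst g(2)) (rule sheet_path_class[OF g(1) that])
  have "homotopic_paths S (\<gamma> +++ (linepath ?x z +++ linepath z z')) ((\<gamma> +++ linepath ?x z) +++ linepath z z')"
    by (rule homotopic_paths_assoc) (use arc_inD[OF g(1)] seg in auto)
  moreover have "homotopic_paths S (\<gamma> +++ (linepath ?x z +++ linepath z z')) (\<gamma> +++ linepath ?x z')"
  proof (rule homotopic_paths_join)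
    show "homotopic_paths S \<gamma> \<gamma>" using g(1) by (simp add: arc_in_def)
    show "homotopic_paths S (linepath ?x z +++ linepath z z') (linepath ?x z')"
    proof (rule homotopic_paths_convex[OF convex_ball r])
      show "path_image (linepath ?x z +++ linepath z z') \<subseteq> ball ?x r"
        using segment_in_ball[of _ ?x r _ "ball ?x r"] z x by (intro subset_path_image_join) auto
      show "path_image (linepath ?x z') \<subseteq> ball ?x r"
        using segment_in_ball[of _ ?x r _ "ball ?x r"] z x by auto
    qed auto
  qed (use arc_inD[OF g(1)] in auto)
  ultimately have "path_class S ((\<gamma> +++ linepath ?x z) +++ linepath z z') = path_class S (\<gamma> +++ linepath ?x z')"
    by (metis path_class_cong)
  then show ?thesis
    using sheet_path_class[OF arc_in_join[OF g(1) seg(1)] seg(3)] by (simp add: eq seg)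
qed

lemma sheet_self:
  assumes p: "p \<in> univ_cover S w"
  shows "sheet S p (fst p) = p"
proof -
  obtain \<gamma> where g: "arc_in S w (fst p) \<gamma>" "p = (fst p, path_class S \<gamma>)"
    using p in_univ_cover_iff by blast
  have "sheet S p (fst p) = (fst p, path_class S (\<gamma> +++ linepath (fst p) (fst p)))"
    by (subst g(2)) (rule sheet_path_class[OF g(1)], use arc_inD[OF g(1)] in auto)
  also have "homotopic_paths S (\<gamma> +++ linepath (fst p) (fst p)) \<gamma>"
    using homotopic_paths_rid[of \<gamma> S] arc_inD[OF g(1)] by simp
  then have "path_class S (\<gamma> +++ linepath (fst p) (fst p)) = path_class S \<gamma>" by (rule path_class_cong)
  finally show ?thesis using g(2) by simp
qed

lemma univ_cover_ball:
  assumes "open S" "p \<in> univ_cover S w"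
  obtains r where "0 < r" "ball (fst p) r \<subseteq> S"
proof -
  have "fst p \<in> S" using assms(2) arc_inD(6) in_univ_cover_iff by blast
  then show ?thesis using assms(1) that open_contains_ball by blast
qed

lemma cover_holomorphic_local:
  assumes h: "cover_holomorphic S w h" and p: "p \<in> univ_cover S w" and r: "ball (fst p) r \<subseteq> S"
  shows "(\<lambda>z. h (sheet S p z)) holomorphic_on ball (fst p) r"
proof (rule analytic_imp_holomorphic, subst analytic_on_analytic_at, rule ballI)
  fix z assume z: "z \<in> ball (fst p) r"
  have *: "(\<lambda>z'. h (sheet S (sheet S p z) z')) analytic_on {z}"
    using h sheet_in_univ_cover[OF p r z] unfolding cover_holomorphic_def by fastforce
  have "\<forall>\<^sub>F z' in nhds z. h (sheet S (sheet S p z) z') = h (sheet S p z')"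
    using eventually_nhds_in_open[OF open_ball z]
    by eventually_elim (simp add: sheet_sheet[OF p r z])
  from * analytic_at_cong[OF this refl] show "(\<lambda>z. h (sheet S p z)) analytic_on {z}" by simp
qed

lemma cover_deriv_local:
  assumes p: "p \<in> univ_cover S w" and r: "ball (fst p) r \<subseteq> S" and z: "z \<in> ball (fst p) r"
  shows "cover_deriv S h (sheet S p z) = deriv (\<lambda>z. h (sheet S p z)) z"
  unfolding cover_deriv_def fst_sheet
proof (rule deriv_cong_ev)
  show "\<forall>\<^sub>F z' in nhds z. h (sheet S (sheet S p z) z') = h (sheet S p z')"
    using eventually_nhds_in_open[OF open_ball z]
    by eventually_elim (simp add: sheet_sheet[OF p r z])
qed simp

lemma cover_holomorphicI:
  assumes S: "open S"
    and h: "\<And>p r. p \<in> univ_cover S w \<Longrightarrow> 0 < r \<Longrightarrow> ball (fst p) r \<subseteq> S \<Longrightarrow>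
      (\<lambda>z. h (sheet S p z)) holomorphic_on ball (fst p) r"
  shows "cover_holomorphic S w h"
  unfolding cover_holomorphic_def
proof
  fix p assume p: "p \<in> univ_cover S w"
  obtain r where r: "0 < r" "ball (fst p) r \<subseteq> S" by (rule univ_cover_ball[OF S p])
  show "(\<lambda>z. h (sheet S p z)) analytic_on {fst p}"
    using h[OF p r] r(1) by (meson analytic_at centre_in_ball open_ball)
qed

lemma cover_holomorphic_deriv:
  assumes S: "open S" and h: "cover_holomorphic S w h"
  shows "cover_holomorphic S w (cover_deriv S h)"
proof (rule cover_holomorphicI[OF S])
  fix p r assume p: "p \<in> univ_cover S w" "ball (fst p) r \<subseteq> S"
  have "deriv (\<lambda>z. h (sheet S p z)) holomorphic_on ball (fst p) r"
    by (rule holomorphic_deriv[OF cover_holomorphic_local[OF h p] open_ball])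
  then show "(\<lambda>z. cover_deriv S h (sheet S p z)) holomorphic_on ball (fst p) r"
    by (rule holomorphic_transform) (simp add: cover_deriv_local[OF p])
qed

lemma cover_holomorphic_add:
  "cover_holomorphic S w f \<Longrightarrow> cover_holomorphic S w g \<Longrightarrow> cover_holomorphic S w (\<lambda>p. f p + g p)"
  unfolding cover_holomorphic_def by (auto intro!: analytic_intros)

lemma cover_holomorphic_diff:
  "cover_holomorphic S w f \<Longrightarrow> cover_holomorphic S w g \<Longrightarrow> cover_holomorphic S w (\<lambda>p. f p - g p)"
  unfolding cover_holomorphic_def by (auto intro!: analytic_intros)

lemma cover_holomorphic_const: "cover_holomorphic S w (\<lambda>p. c)"
  unfolding cover_holomorphic_def by simp

text \<open>An arc lifts to the covering through the classes of its initial pieces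
  \<open>subpath 0 t \<gamma>\<close>. In each chart h has derivative zero, so it is locally
  constant along the lift, and the unit interval is connected.\<close>

lemma cover_constant:
  assumes S: "open S" and h: "cover_holomorphic S w h"
    and d: "\<And>p. p \<in> univ_cover S w \<Longrightarrow> cover_deriv S h p = 0"
    and p: "p \<in> univ_cover S w"
  shows "h p = h (w, path_class S (\<lambda>t. w))"
proof -
  obtain \<gamma> where g: "arc_in S w (fst p) \<gamma>" "p = (fst p, path_class S \<gamma>)"
    using p in_univ_cover_iff by blast
  note \<gamma> = arc_inD[OF g(1)]
  define q where "q = (\<lambda>t. (\<gamma> t, path_class S (subpath 0 t \<gamma>)))"
  have gS: "\<gamma> t \<in> S" if "t \<in> {0..1}" for t using \<gamma>(2) that by (auto simp: path_image_def)
  have arc: "arc_in S w (\<gamma> t) (subpath 0 t \<gamma>)" if "t \<in> {0..1}" for t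
    unfolding arc_in_def using that \<gamma> path_image_subpath_subset[of 0 t \<gamma>]
      \<gamma>(3)[unfolded pathstart_def]
    by auto
  have qU: "q t \<in> univ_cover S w" if "t \<in> {0..1}" for t
    using arc[OF that] by (auto simp: q_def univ_cover_def)
  have const: "h (sheet S q0 z) = h q0"
    if q0: "q0 \<in> univ_cover S w" "0 < r" "ball (fst q0) r \<subseteq> S" "z \<in> ball (fst q0) r" for q0 r z
  proof -
    have "(\<lambda>z. h (sheet S q0 z)) constant_on ball (fst q0) r"
    proof (rule has_field_derivative_0_imp_constant_on)
      fix z assume z: "z \<in> ball (fst q0) r"
      have "deriv (\<lambda>z. h (sheet S q0 z)) z = 0"
        using d[OF sheet_in_univ_cover[OF q0(1,3) z]] cover_deriv_local[OF q0(1,3) z, of h] by simp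
      then show "((\<lambda>z. h (sheet S q0 z)) has_field_derivative 0) (at z)"
        using holomorphic_derivI[OF cover_holomorphic_local[OF h q0(1,3)] open_ball z] by simp
    qed auto
    then have "h (sheet S q0 z) = h (sheet S q0 (fst q0))"
      using q0(2,4) unfolding constant_on_def by (metis centre_in_ball)
    then show ?thesis using sheet_self[OF q0(1)] by simp
  qed
  have "(\<lambda>t. h (q t)) constant_on {0..1}"
  proof (rule locally_constant_imp_constant)
    fix t assume t: "t \<in> {0..1::real}"
    obtain r where r: "0 < r" "ball (\<gamma> t) r \<subseteq> S" using gS[OF t] S open_contains_ball by blast
    have "continuous (at t within {0..1}) \<gamma>"
      using \<gamma>(1) t by (simp add: path_def continuous_on_eq_continuous_within)
    then obtain e where e: "0 < e" "\<And>s. s \<in> {0..1} \<Longrightarrow> dist s t < e \<Longrightarrow> dist (\<gamma> s) (\<gamma> t) < r"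
      using r(1) unfolding continuous_within_eps_delta by blast
    define T where "T = {0..1} \<inter> ball t e"
    have "h (q s) = h (q t)" if s: "s \<in> T" for s
    proof -
      have s01: "s \<in> {0..1}" using s by (simp add: T_def)
      have near: "\<gamma> u \<in> ball (\<gamma> t) r" if "u \<in> closed_segment t s" for u
      proof -
        have "u \<in> {0..1}" using that t s01 by (auto simp: closed_segment_eq_real_ivl split: if_splits)
        moreover have "dist u t < e"
          using that s by (auto simp: T_def closed_segment_eq_real_ivl dist_real_def split: if_splits)
        ultimately have "dist (\<gamma> u) (\<gamma> t) < r" by (rule e(2))
        then show ?thesis by (simp add: dist_commute)
      qed
      have zs: "\<gamma> s \<in> ball (\<gamma> t) r" by (rule near) simp
      have "homotopic_paths S (subpath t s \<gamma>) (linepath (\<gamma> t) (\<gamma> s))"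
      proof (rule homotopic_paths_convex[OF convex_ball r(2)])
        show "path_image (subpath t s \<gamma>) \<subseteq> ball (\<gamma> t) r"
          unfolding path_image_subpath_gen using near by auto
        show "path_image (linepath (\<gamma> t) (\<gamma> s)) \<subseteq> ball (\<gamma> t) r"
          using segment_in_ball[of "\<gamma> t" "\<gamma> t" r "\<gamma> s" "ball (\<gamma> t) r"] zs r(1) by simp
      qed (use \<gamma>(1) t s01 in auto)
      moreover have "homotopic_paths S (subpath 0 t \<gamma>) (subpath 0 t \<gamma>)"
        using arc[OF t] by (simp add: arc_in_def)
      ultimately have "homotopic_paths S (subpath 0 t \<gamma> +++ subpath t s \<gamma>) (subpath 0 t \<gamma> +++ linepath (\<gamma> t) (\<gamma> s))"
        by (intro homotopic_paths_join) auto
      moreover have "homotopic_paths S (subpath 0 t \<gamma> +++ subpath t s \<gamma>) (subpath 0 s \<gamma>)"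
        by (rule homotopic_join_subpaths) (use \<gamma> t s01 in auto)
      ultimately have "path_class S (subpath 0 t \<gamma> +++ linepath (\<gamma> t) (\<gamma> s)) = path_class S (subpath 0 s \<gamma>)"
        by (metis path_class_cong)
      moreover have "sheet S (q t) (\<gamma> s) = (\<gamma> s, path_class S (subpath 0 t \<gamma> +++ linepath (\<gamma> t) (\<gamma> s)))"
        unfolding q_def
        by (rule sheet_path_class[OF arc[OF t]])
          (use segment_in_ball[of "\<gamma> t" "\<gamma> t" r "\<gamma> s"] zs r in auto)
      ultimately have "q s = sheet S (q t) (\<gamma> s)" by (simp add: q_def)
      then show ?thesis using const[OF qU[OF t] r(1)] r(2) zs by (simp add: q_def)
    qed
    moreover have "openin (top_of_set {0..1}) T" "t \<in> T" using t e by (auto simp: T_def)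
    ultimately show "\<exists>T. openin (top_of_set {0..1}) T \<and> t \<in> T \<and> (\<forall>x\<in>T. h (q x) = h (q t))" by blast
  qed simp
  then have "h (q 1) = h (q 0)" unfolding constant_on_def by (metis atLeastAtMost_iff order_refl zero_le_one)
  moreover have "q 1 = p" using g(2) \<gamma>(4) by (simp add: q_def pathfinish_def subpath_trivial)
  moreover have "q 0 = (w, path_class S (\<lambda>t. w))"
    using \<gamma>(3) by (simp add: q_def pathstart_def subpath_def)
  ultimately show ?thesis by simp
qed

section \<open>Termwise differentiation and uniqueness\<close>

definition formal_step :: "(int \<Rightarrow> complex \<Rightarrow> complex) \<Rightarrow> int \<Rightarrow> complex \<Rightarrow> complex" where
  "formal_step F k z = deriv (F k) z + F (k - 1) z"

lemma formal_step_holomorphic: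
  assumes "open T" "\<And>k. F k holomorphic_on T"
  shows "(formal_step ^^ m) F k holomorphic_on T"
proof (induction m arbitrary: k)
  case (Suc m)
  have "(\<lambda>z. deriv ((formal_step ^^ m) F k) z + (formal_step ^^ m) F (k - 1) z) holomorphic_on T"
    by (intro holomorphic_intros Suc assms(1))
  then show ?case by (simp add: formal_step_def[abs_def])
qed (simp add: assms)

text \<open>On coefficient sequences \<open>formal_step\<close> is the operator d/dz + \<lambda>,
  whose m-th power is \<lambda>^m + m \<lambda>^(m-1) d/dz + terms of lower order in \<lambda>.
  Applied to F - G, whose leading power is at most \<open>k0\<close>, this gives the three
  claims.\<close>

lemma formal_step_diff:
  assumes T: "open T" and F: "\<And>k. F k holomorphic_on T" and G: "\<And>k. G k holomorphic_on T"
    and eq: "\<And>k z. k > k0 \<Longrightarrow> z \<in> T \<Longrightarrow> F k z = G k z" and z: "z \<in> T"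
  shows "(\<forall>k>k0 + int m. (formal_step ^^ m) F k z = (formal_step ^^ m) G k z) \<and>
    (formal_step ^^ m) F (k0 + int m) z - (formal_step ^^ m) G (k0 + int m) z = F k0 z - G k0 z \<and>
    (formal_step ^^ m) F (k0 + int m - 1) z - (formal_step ^^ m) G (k0 + int m - 1) z
      = of_nat m * (deriv (F k0) z - deriv (G k0) z) + (F (k0 - 1) z - G (k0 - 1) z)"
  using z
proof (induction m arbitrary: z)
  case (Suc m)
  let ?F = "(formal_step ^^ m) F" and ?G = "(formal_step ^^ m) G"
  note hF = formal_step_holomorphic[OF T F] and hG = formal_step_holomorphic[OF T G]
  have cong: "deriv f z = deriv g z" if "\<And>y. y \<in> T \<Longrightarrow> f y = g y" for f g :: "complex \<Rightarrow> complex"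
    by (rule deriv_cong_ev) (use eventually_nhds_in_open[OF T Suc.prems] that in \<open>auto elim: eventually_mono\<close>)
  have dd: "deriv (\<lambda>y. f y - g y) z = deriv f z - deriv g z"
    if "f holomorphic_on T" "g holomorphic_on T" for f g
    by (rule deriv_diff) (use that T Suc.prems in \<open>auto intro: holomorphic_on_imp_differentiable_at\<close>)
  have 1: "deriv (?F k) z = deriv (?G k) z" if "k > k0 + int m" for k
    by (rule cong) (use Suc.IH that in blast)
  have "deriv (\<lambda>y. ?F (k0 + int m) y - ?G (k0 + int m) y) z = deriv (\<lambda>y. F k0 y - G k0 y) z"
    by (rule cong) (use Suc.IH in blast)
  then have 2: "deriv (?F (k0 + int m)) z - deriv (?G (k0 + int m)) z = deriv (F k0) z - deriv (G k0) z"
    by (simp add: dd hF hG F G)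
  have 3: "k0 + int (Suc m) - 1 = k0 + int m" by simp
  have 4: "(formal_step ^^ Suc m) F k z = deriv (?F k) z + ?F (k - 1) z"
    "(formal_step ^^ Suc m) G k z = deriv (?G k) z + ?G (k - 1) z" for k
    by (simp_all add: formal_step_def)
  from Suc.IH[OF Suc.prems] show ?case
    unfolding 3 4 using 1 2 by (auto simp: algebra_simps)
qed (use eq in auto)

lemma formal_deriv_eq:
  assumes "\<And>q. snd (u q) = fst q - w"
  shows "formal_deriv S u p = (\<lambda>k. cover_deriv S (\<lambda>q. fst (u q) k) p + fst (u p) (k - 1), snd (u p))"
proof -
  have "deriv (\<lambda>z. z - w) (fst p) = 1"
    by (rule DERIV_imp_deriv) (auto intro!: derivative_eq_intros)
  then have "cover_deriv S (\<lambda>q. snd (u q)) p = 1"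
    by (simp add: cover_deriv_def assms)
  then show ?thesis by (simp add: formal_deriv_def)
qed

text \<open>The exponent z - w has derivative 1 and survives every differentiation, so only the
  coefficients change; in one chart they are governed by ordinary derivatives.\<close>

lemma formal_deriv_local:
  assumes S: "open S" and snd: "\<And>q. snd (u q) = fst q - w"
    and hol: "\<And>k. cover_holomorphic S w0 (\<lambda>p. fst (u p) k)"
  shows "(\<forall>q. snd ((formal_deriv S ^^ m) u q) = fst q - w) \<and>
    (\<forall>k. cover_holomorphic S w0 (\<lambda>p. fst ((formal_deriv S ^^ m) u p) k)) \<and>
    (\<forall>p r z k. p \<in> univ_cover S w0 \<longrightarrow> ball (fst p) r \<subseteq> S \<longrightarrow> z \<in> ball (fst p) r \<longrightarrow>
      fst ((formal_deriv S ^^ m) u (sheet S p z)) k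
        = (formal_step ^^ m) (\<lambda>k z. fst (u (sheet S p z)) k) k z)"
proof (induction m)
  case (Suc m)
  let ?u = "(formal_deriv S ^^ m) u"
  have s: "\<And>q. snd (?u q) = fst q - w" and h: "\<And>k. cover_holomorphic S w0 (\<lambda>p. fst (?u p) k)"
    using Suc.IH by blast+
  have eq: "(formal_deriv S ^^ Suc m) u p
      = (\<lambda>k. cover_deriv S (\<lambda>q. fst (?u q) k) p + fst (?u p) (k - 1), snd (?u p))" for p
    using formal_deriv_eq[of ?u w, OF s] by simp
  have "fst ((formal_deriv S ^^ Suc m) u (sheet S p z)) k
        = (formal_step ^^ Suc m) (\<lambda>k z. fst (u (sheet S p z)) k) k z"
    if p: "p \<in> univ_cover S w0" "ball (fst p) r \<subseteq> S" "z \<in> ball (fst p) r" for p r z k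
  proof -
    have loc: "fst (?u (sheet S p y)) k = (formal_step ^^ m) (\<lambda>k z. fst (u (sheet S p z)) k) k y"
      if "y \<in> ball (fst p) r" for y k
      using Suc.IH p that by blast
    have "cover_deriv S (\<lambda>q. fst (?u q) k) (sheet S p z) = deriv (\<lambda>z. fst (?u (sheet S p z)) k) z"
      by (rule cover_deriv_local[OF p])
    also have "\<dots> = deriv ((formal_step ^^ m) (\<lambda>k z. fst (u (sheet S p z)) k) k) z"
      by (rule deriv_cong_ev)
        (use eventually_nhds_in_open[OF open_ball p(3)] loc in \<open>auto elim: eventually_mono\<close>)
    finally show ?thesis by (simp add: eq loc[OF p(3)] formal_step_def del: funpow.simps) (simp add: formal_step_def)
  qed
  moreover have "cover_holomorphic S w0 (\<lambda>p. fst ((formal_deriv S ^^ Suc m) u p) k)" for k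
    unfolding eq fst_conv by (intro cover_holomorphic_add cover_holomorphic_deriv S h)
  ultimately show ?case using s by (simp add: eq del: funpow.simps)
qed (use snd hol in auto)

lemma snd_Psi: "snd (Psi w \<xi> q) = fst q - w"
  by (simp add: Psi_def)

lemma Psi_holomorphic:
  assumes "\<And>s. cover_holomorphic S w (\<xi> s)"
  shows "cover_holomorphic S w (\<lambda>p. fst (Psi w \<xi> p) k)"
  using assms by (cases "k \<le> 0") (simp_all add: Psi_def cover_holomorphic_const)

text \<open>Let two solutions agree in all coefficients before the s-th. At \<lambda>^(N - 1 - s)
  the terms with a_l do not contribute to the difference, since l \<ge> 2, and the (s+1)-st
  difference cancels against \<lambda>^N u. What remains is N times the derivative of the s-th
  difference, which is thus constant and is determined at the base point.\<close>

lemma normalized_formal_solution_unique: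
  assumes S: "open S" and N: "N \<ge> 1"
    and \<xi>: "normalized_formal_solution N A S w \<xi>" and \<eta>: "normalized_formal_solution N A S w \<eta>"
    and p: "p \<in> univ_cover S w"
  shows "\<eta> s p = \<xi> s p"
  using p
proof (induction s arbitrary: p rule: less_induct)
  case (less s)
  have hx: "\<And>s. cover_holomorphic S w (\<xi> s)" and hy: "\<And>s. cover_holomorphic S w (\<eta> s)"
    using \<xi> \<eta> unfolding normalized_formal_solution_def by blast+
  show ?case
  proof (cases "s = 0")
    case True
    then show ?thesis using \<xi> \<eta> less.prems unfolding normalized_formal_solution_def by simp
  next
    case False
    have "(\<lambda>p. \<eta> s p - \<xi> s p) p = (\<lambda>p. \<eta> s p - \<xi> s p) (w, path_class S (\<lambda>t. w))"
    proof (rule cover_constant[OF S cover_holomorphic_diff[OF hy hx] _ less.prems])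
      fix p assume p: "p \<in> univ_cover S w"
      obtain r where r: "0 < r" "ball (fst p) r \<subseteq> S" by (rule univ_cover_ball[OF S p])
      have z: "fst p \<in> ball (fst p) r" using r by simp
      define F where "F = (\<lambda>k z. fst (Psi w \<eta> (sheet S p z)) k)"
      define G where "G = (\<lambda>k z. fst (Psi w \<xi> (sheet S p z)) k)"
      define k0 where "k0 = - int s"
      note locF = formal_deriv_local[OF S snd_Psi Psi_holomorphic[where \<xi> = \<eta>, OF hy]]
      note locG = formal_deriv_local[OF S snd_Psi Psi_holomorphic[where \<xi> = \<xi>, OF hx]]
      have F: "fst ((formal_deriv S ^^ m) (Psi w \<eta>) p) k = (formal_step ^^ m) F k (fst p)" for m k
      proof -
        have "fst ((formal_deriv S ^^ m) (Psi w \<eta>) (sheet S p (fst p))) k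
            = (formal_step ^^ m) (\<lambda>k z. fst (Psi w \<eta> (sheet S p z)) k) k (fst p)"
          using locF[where m = m] p r(2) z by blast
        then show ?thesis by (simp add: sheet_self[OF p] F_def)
      qed
      have G: "fst ((formal_deriv S ^^ m) (Psi w \<xi>) p) k = (formal_step ^^ m) G k (fst p)" for m k
      proof -
        have "fst ((formal_deriv S ^^ m) (Psi w \<xi>) (sheet S p (fst p))) k
            = (formal_step ^^ m) (\<lambda>k z. fst (Psi w \<xi> (sheet S p z)) k) k (fst p)"
          using locG[where m = m] p r(2) z by blast
        then show ?thesis by (simp add: sheet_self[OF p] G_def)
      qed
      have hF: "F k holomorphic_on ball (fst p) r" for k
        unfolding F_def by (rule cover_holomorphic_local[OF Psi_holomorphic[where \<xi> = \<eta>, OF hy] p r(2)])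
      have hG: "G k holomorphic_on ball (fst p) r" for k
        unfolding G_def by (rule cover_holomorphic_local[OF Psi_holomorphic[where \<xi> = \<xi>, OF hx] p r(2)])
      have FG: "F k y = G k y" if "k > k0" "y \<in> ball (fst p) r" for k y
        using less.IH[of "nat (- k)" "sheet S p y"] sheet_in_univ_cover[OF p r(2) that(2)] that(1)
        unfolding F_def G_def k0_def Psi_def by auto
      note diff = formal_step_diff[where F = F and G = G, OF open_ball hF hG FG z]
      define k where "k = k0 + int N - 1"
      have eqF: "(formal_step ^^ N) F k (fst p) + (\<Sum>l=2..N. A l (fst p) * (formal_step ^^ (N - l)) F k (fst p))
          = F (k - int N) (fst p)"
        using \<eta> p sheet_self[OF p] unfolding normalized_formal_solution_def solves_formally_def F[symmetric]
        by (simp add: F_def)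
      have eqG: "(formal_step ^^ N) G k (fst p) + (\<Sum>l=2..N. A l (fst p) * (formal_step ^^ (N - l)) G k (fst p))
          = G (k - int N) (fst p)"
        using \<xi> p sheet_self[OF p] unfolding normalized_formal_solution_def solves_formally_def G[symmetric]
        by (simp add: G_def)
      have "(\<Sum>l=2..N. A l (fst p) * (formal_step ^^ (N - l)) F k (fst p))
          = (\<Sum>l=2..N. A l (fst p) * (formal_step ^^ (N - l)) G k (fst p))"
      proof (intro sum.cong refl)
        fix l assume "l \<in> {2..N}"
        then have "k > k0 + int (N - l)" by (simp add: k_def)
        then show "A l (fst p) * (formal_step ^^ (N - l)) F k (fst p) = A l (fst p) * (formal_step ^^ (N - l)) G k (fst p)"
          using diff[where m = "N - l", THEN conjunct1] by simp
      qed
      then have "(formal_step ^^ N) F k (fst p) - (formal_step ^^ N) G k (fst p)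
          = F (k - int N) (fst p) - G (k - int N) (fst p)"
        unfolding eqF[symmetric] eqG[symmetric] by simp
      moreover have "(formal_step ^^ N) F k (fst p) - (formal_step ^^ N) G k (fst p)
          = of_nat N * (deriv (F k0) (fst p) - deriv (G k0) (fst p)) + (F (k0 - 1) (fst p) - G (k0 - 1) (fst p))"
        using diff[where m = N] unfolding k_def by blast
      moreover have "k - int N = k0 - 1" by (simp add: k_def)
      ultimately have "of_nat N * (deriv (F k0) (fst p) - deriv (G k0) (fst p)) = 0" by simp
      then have "deriv (F k0) (fst p) = deriv (G k0) (fst p)" using N by simp
      moreover have "F k0 = (\<lambda>z. \<eta> s (sheet S p z))" "G k0 = (\<lambda>z. \<xi> s (sheet S p z))"
        by (simp_all add: F_def G_def Psi_def k0_def)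
      ultimately show "cover_deriv S (\<lambda>p. \<eta> s p - \<xi> s p) p = 0"
        unfolding cover_deriv_def
        using hF[of k0] hG[of k0] z
        by (subst deriv_diff) (auto intro: holomorphic_on_imp_differentiable_at)
    qed
    then show ?thesis using \<xi> \<eta> False unfolding normalized_formal_solution_def by simp
  qed
qed


subsection \<open>Integrals on the covering and the Riccati recursion\<close>

text \<open>A homotopy class also contains paths that are merely continuous, so the integral is
  taken along some piecewise differentiable member; by Cauchy's theorem the choice does not matter
  for holomorphic integrands.\<close>

definition cover_integral :: "(complex \<Rightarrow> complex) \<Rightarrow> cover_point \<Rightarrow> complex" where
  "cover_integral f p = contour_integral (SOME \<delta>. \<delta> \<in> snd p \<and> valid_path \<delta>) f"

text \<open>In an open set, paths close enough to a given one with the same ends are homotopic to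
  it, and uniform approximation supplies a polynomial one.\<close>

lemma polynomial_path_in_class:
  assumes S: "open S" and \<gamma>: "arc_in S w z \<gamma>"
  obtains \<delta> where "polynomial_function \<delta>" "homotopic_paths S \<gamma> \<delta>"
proof -
  note \<gamma> = arc_inD[OF \<gamma>]
  obtain e where e: "0 < e" "\<And>h. path h \<and> pathstart h = pathstart \<gamma> \<and> pathfinish h = pathfinish \<gamma> \<and>
      (\<forall>t \<in> {0..1}. norm (h t - \<gamma> t) < e) \<Longrightarrow> homotopic_paths S \<gamma> h"
    using homotopic_nearby_paths[OF \<gamma>(1) S \<gamma>(2)] by blast
  obtain p where "polynomial_function p" "pathstart p = pathstart \<gamma>" "pathfinish p = pathfinish \<gamma>"
      "\<And>t. t \<in> {0..1} \<Longrightarrow> norm (p t - \<gamma> t) < e"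
    using path_approx_polynomial_function[OF \<gamma>(1) e(1)] by blast
  then show thesis using e(2) path_polynomial_function that by blast
qed

lemma cover_integral_eq:
  assumes S: "open S" and f: "f holomorphic_on S" and \<delta>: "valid_path \<delta>" "homotopic_paths S \<gamma> \<delta>"
  shows "cover_integral f (z, path_class S \<gamma>) = contour_integral \<delta> f"
proof -
  define \<delta>' where "\<delta>' = (SOME \<delta>. \<delta> \<in> path_class S \<gamma> \<and> valid_path \<delta>)"
  have "\<delta>' \<in> path_class S \<gamma> \<and> valid_path \<delta>'"
    unfolding \<delta>'_def by (rule someI[of _ \<delta>]) (use \<delta> in \<open>simp add: path_class_def\<close>)
  then have "homotopic_paths S \<delta>' \<delta>" "valid_path \<delta>'"
    using \<delta>(2) homotopic_paths_sym homotopic_paths_trans unfolding path_class_def by blast+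
  then show ?thesis
    unfolding cover_integral_def snd_conv \<delta>'_def[symmetric]
    by (intro Cauchy_theorem_homotopic_paths[OF _ S f] \<delta>(1))
qed

lemma cover_integral_base:
  assumes "open S" "f holomorphic_on S" "w \<in> S"
  shows "cover_integral f (w, path_class S (\<lambda>t. w)) = 0"
proof -
  have eq: "(\<lambda>t::real. w) = linepath w w" by (simp add: linepath_refl)
  have "homotopic_paths S (\<lambda>t. w) (linepath w w)" unfolding eq using assms(3) by simp
  from cover_integral_eq[OF assms(1,2) valid_path_linepath this] show ?thesis by simp
qed

lemma cover_integral_sheet_base:
  assumes S: "open S" and f: "f holomorphic_on S" and p: "p \<in> univ_cover S w"
    and seg: "closed_segment (fst p) z \<subseteq> S" "closed_segment w' w \<subseteq> S"
  shows "cover_integral f (sheet_base S w p w' z)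
    = contour_integral (linepath w' w) f + cover_integral f p + contour_integral (linepath (fst p) z) f"
proof -
  obtain \<gamma> where g: "arc_in S w (fst p) \<gamma>" "p = (fst p, path_class S \<gamma>)"
    using p in_univ_cover_iff by blast
  obtain \<delta> where \<delta>: "polynomial_function \<delta>" "homotopic_paths S \<gamma> \<delta>"
    by (rule polynomial_path_in_class[OF S g(1)])
  note vd = valid_path_polynomial_function[OF \<delta>(1)]
  have ends: "pathstart \<delta> = w" "pathfinish \<delta> = fst p" "path_image \<delta> \<subseteq> S"
    using arc_inD[OF g(1)] homotopic_paths_imp_pathstart[OF \<delta>(2)]
      homotopic_paths_imp_pathfinish[OF \<delta>(2)] homotopic_paths_imp_subset[OF \<delta>(2)] by simp_all
  have int: "f contour_integrable_on g" if "valid_path g" "path_image g \<subseteq> S" for g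
    using contour_integrable_holomorphic_simple[OF f S that] .
  have 1: "homotopic_paths S (\<gamma> +++ linepath (fst p) z) (\<delta> +++ linepath (fst p) z)"
    using \<delta>(2) arc_inD[OF g(1)] seg by (intro homotopic_paths_join) auto
  have "homotopic_paths S (linepath w' w +++ (\<gamma> +++ linepath (fst p) z)) (linepath w' w +++ (\<delta> +++ linepath (fst p) z))"
    by (rule homotopic_paths_join[OF _ 1]) (use arc_inD[OF g(1)] seg in auto)
  moreover have v: "valid_path (\<delta> +++ linepath (fst p) z)" using vd ends by (intro valid_path_join) auto
  then have "valid_path (linepath w' w +++ (\<delta> +++ linepath (fst p) z))"
    using ends by (intro valid_path_join) auto
  ultimately have "cover_integral f (z, path_class S (linepath w' w +++ (\<gamma> +++ linepath (fst p) z)))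
      = contour_integral (linepath w' w +++ (\<delta> +++ linepath (fst p) z)) f"
    by (intro cover_integral_eq[OF S f])
  also have "\<dots> = contour_integral (linepath w' w) f + contour_integral (\<delta> +++ linepath (fst p) z) f"
    using v seg ends by (intro contour_integral_join int) (auto simp: path_image_join)
  also have "contour_integral (\<delta> +++ linepath (fst p) z) f = contour_integral \<delta> f + contour_integral (linepath (fst p) z) f"
    using vd seg ends by (intro contour_integral_join int) auto
  also have "contour_integral \<delta> f = cover_integral f p"
    by (subst g(2)) (rule cover_integral_eq[OF S f vd \<delta>(2), symmetric])
  also have "(z, path_class S (linepath w' w +++ (\<gamma> +++ linepath (fst p) z))) = sheet_base S w p w' z"
    using sheet_base_path_class[OF g(1) seg] g(2) by simp
  finally show ?thesis by simp
qed

lemma sheet_base_self: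
  assumes p: "p \<in> univ_cover S w" and seg: "closed_segment (fst p) z \<subseteq> S"
  shows "sheet_base S w p w z = sheet S p z"
proof -
  obtain \<gamma> where g: "arc_in S w (fst p) \<gamma>" "p = (fst p, path_class S \<gamma>)"
    using p in_univ_cover_iff by blast
  note \<gamma> = arc_inD[OF arc_in_join[OF g(1) seg]]
  have "homotopic_paths S (linepath w w +++ (\<gamma> +++ linepath (fst p) z)) (\<gamma> +++ linepath (fst p) z)"
    using homotopic_paths_lid[OF \<gamma>(1,2)] \<gamma>(3) by simp
  from path_class_cong[OF this] show ?thesis
    using sheet_base_path_class[OF g(1) seg, of w] sheet_path_class[OF g(1) seg] g(2) \<gamma>(5) by simp
qed

lemma cover_integral_sheet:
  assumes "open S" "f holomorphic_on S" and p: "p \<in> univ_cover S w" and seg: "closed_segment (fst p) z \<subseteq> S"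
  shows "cover_integral f (sheet S p z) = cover_integral f p + contour_integral (linepath (fst p) z) f"
proof -
  have "w \<in> S" using p arc_inD(5) in_univ_cover_iff by blast
  then show ?thesis
    using cover_integral_sheet_base[OF assms, of w] sheet_base_self[OF p seg] by simp
qed

lemma ball_primitive:
  assumes f: "f holomorphic_on ball x r"
  obtains P where "\<And>z. z \<in> ball x r \<Longrightarrow> (P has_field_derivative f z) (at z)"
    "\<And>y z. y \<in> ball x r \<Longrightarrow> z \<in> ball x r \<Longrightarrow> contour_integral (linepath y z) f = P z - P y"
proof -
  obtain P where P: "\<And>z. z \<in> ball x r \<Longrightarrow> (P has_field_derivative f z) (at z within ball x r)"
    using holomorphic_convex_primitive'[OF convex_ball open_ball f] by blast
  have "contour_integral (linepath y z) f = P z - P y" if "y \<in> ball x r" "z \<in> ball x r" for y z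
  proof -
    have "(f has_contour_integral (P (pathfinish (linepath y z)) - P (pathstart (linepath y z)))) (linepath y z)"
      by (rule contour_integral_primitive[OF P])
        (use segment_in_ball[OF that, of "ball x r"] in auto)
    then show ?thesis using contour_integral_unique by fastforce
  qed
  moreover have "(P has_field_derivative f z) (at z)" if "z \<in> ball x r" for z
    using P[OF that] at_within_open[OF that open_ball] by simp
  ultimately show thesis using that by blast
qed

lemma cover_integral_has_derivative:
  assumes S: "open S" and f: "f holomorphic_on S" and p: "p \<in> univ_cover S w"
    and r: "ball (fst p) r \<subseteq> S" and z: "z \<in> ball (fst p) r"
  shows "((\<lambda>z. cover_integral f (sheet S p z)) has_field_derivative f z) (at z)"
proof -
  obtain P where P: "\<And>z. z \<in> ball (fst p) r \<Longrightarrow> (P has_field_derivative f z) (at z)"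
    "\<And>y z. y \<in> ball (fst p) r \<Longrightarrow> z \<in> ball (fst p) r \<Longrightarrow> contour_integral (linepath y z) f = P z - P y"
    using ball_primitive[OF holomorphic_on_subset[OF f r]] by blast
  have "cover_integral f p + (P y - P (fst p)) = cover_integral f (sheet S p y)" if y: "y \<in> ball (fst p) r" for y
    using cover_integral_sheet[OF S f p segment_in_ball[OF centre_in_ball'[OF y] y r]]
      P(2)[OF centre_in_ball'[OF y] y] by simp
  moreover have "((\<lambda>y. cover_integral f p + (P y - P (fst p))) has_field_derivative f z) (at z)"
    by (auto intro!: derivative_eq_intros P(1)[OF z])
  ultimately show ?thesis
    by (rule has_field_derivative_transform_within_open[OF _ open_ball z, rotated])
qed

section \<open>Exponentials of formal power series\<close>

fun exp_coeff :: "(nat \<Rightarrow> complex) \<Rightarrow> nat \<Rightarrow> complex" where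
  "exp_coeff I 0 = 1"
| "exp_coeff I (Suc s) = (\<Sum>j\<le>s. of_nat (Suc j) * I (Suc j) * exp_coeff I (s - j)) / of_nat (Suc s)"

text \<open>The recursion of \<open>exp_coeff\<close> is this differential equation E' = I' E read
  off coefficientwise, so \<open>exp_coeff I\<close> lists the coefficients of the exponential of
  the series with coefficients I 1, I 2, ... and constant term 0.\<close>

lemma exp_coeff_fps_deriv:
  "fps_deriv (Abs_fps (exp_coeff I)) = fps_deriv (Abs_fps I) * Abs_fps (exp_coeff I)"
  by (rule fps_ext) (simp add: fps_mult_nth atMost_atLeast0 del: of_nat_Suc)

text \<open>The chain rule for exp, with D the z-derivative of the exponent. Differentiating the
  recursion in z gives D' E + I' (D E), the prime referring to the formal variable; as E' = I' E,
  this is (D E)'. The constant term of D is 0 because the exponent has none.\<close>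

lemma exp_coeff_has_derivative:
  assumes "\<And>j. ((\<lambda>z. I z j) has_field_derivative d j) (at z)"
  shows "((\<lambda>z. exp_coeff (I z) s) has_field_derivative
    (Abs_fps (\<lambda>j. if j = 0 then 0 else d j) * Abs_fps (exp_coeff (I z))) $ s) (at z)"
proof (induction s rule: less_induct)
  case (less s)
  let ?D = "Abs_fps (\<lambda>j. if j = 0 then 0 else d j)" and ?E = "Abs_fps (exp_coeff (I z))" and ?I = "Abs_fps (I z)"
  show ?case
  proof (cases s)
    case 0
    then show ?thesis by simp
  next
    case (Suc n)
    have "((\<lambda>z. \<Sum>j\<le>n. of_nat (Suc j) * I z (Suc j) * exp_coeff (I z) (n - j)) has_field_derivative
        (\<Sum>j\<le>n. of_nat (Suc j) * d (Suc j) * exp_coeff (I z) (n - j)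
          + of_nat (Suc j) * I z (Suc j) * (?D * ?E) $ (n - j))) (at z)"
    proof (rule DERIV_sum)
      fix j assume "j \<in> {..n}"
      have "((\<lambda>z. exp_coeff (I z) (n - j)) has_field_derivative (?D * ?E) $ (n - j)) (at z)"
        by (rule less.IH) (use Suc in simp)
      then show "((\<lambda>z. of_nat (Suc j) * I z (Suc j) * exp_coeff (I z) (n - j)) has_field_derivative
          of_nat (Suc j) * d (Suc j) * exp_coeff (I z) (n - j)
            + of_nat (Suc j) * I z (Suc j) * (?D * ?E) $ (n - j)) (at z)"
        by (auto intro!: derivative_eq_intros assms simp: algebra_simps)
    qed
    then have "((\<lambda>z. exp_coeff (I z) s) has_field_derivative
        (\<Sum>j\<le>n. of_nat (Suc j) * d (Suc j) * exp_coeff (I z) (n - j)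
          + of_nat (Suc j) * I z (Suc j) * (?D * ?E) $ (n - j)) / of_nat (Suc n)) (at z)"
      unfolding Suc exp_coeff.simps by (rule DERIV_cdivide)
    moreover have "(\<Sum>j\<le>n. of_nat (Suc j) * d (Suc j) * exp_coeff (I z) (n - j)
          + of_nat (Suc j) * I z (Suc j) * (?D * ?E) $ (n - j)) = of_nat (Suc n) * (?D * ?E) $ Suc n"
    proof -
      have "(\<Sum>j\<le>n. of_nat (Suc j) * d (Suc j) * exp_coeff (I z) (n - j)
          + of_nat (Suc j) * I z (Suc j) * (?D * ?E) $ (n - j))
        = (fps_deriv ?D * ?E + fps_deriv ?I * (?D * ?E)) $ n"
        by (simp add: fps_mult_nth[of "fps_deriv _"] atMost_atLeast0 sum.distrib del: of_nat_Suc)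
      also have "fps_deriv ?D * ?E + fps_deriv ?I * (?D * ?E) = fps_deriv (?D * ?E)"
        by (simp only: fps_deriv_mult exp_coeff_fps_deriv) (simp only: algebra_simps)
      finally show ?thesis by (simp only: fps_deriv_nth Suc_eq_plus1)
    qed
    moreover have "of_nat (Suc n) * (?D * ?E) $ Suc n / of_nat (Suc n) = (?D * ?E) $ Suc n"
      by (rule nonzero_mult_div_cancel_left) (rule of_nat_neq_0)
    ultimately show ?thesis by (simp only: Suc)
  qed
qed

text \<open>Weighting the exponent in this way amounts to replacing the formal variable x by c
  x.\<close>

lemma exp_coeff_scale: "exp_coeff (\<lambda>j. c ^ j * I j) s = c ^ s * exp_coeff I s"
proof (induction s rule: less_induct)
  case (less s)
  show ?case
  proof (cases s)
    case (Suc n)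
    have "(\<Sum>j\<le>n. of_nat (Suc j) * (c ^ Suc j * I (Suc j)) * exp_coeff (\<lambda>j. c ^ j * I j) (n - j))
       = (\<Sum>j\<le>n. c ^ s * (of_nat (Suc j) * I (Suc j) * exp_coeff I (n - j)))"
    proof (intro sum.cong refl)
      fix j assume "j \<in> {..n}"
      then have "c ^ Suc j * c ^ (n - j) = c ^ s" "n - j < s" by (simp_all add: Suc power_add[symmetric])
      then show "of_nat (Suc j) * (c ^ Suc j * I (Suc j)) * exp_coeff (\<lambda>j. c ^ j * I j) (n - j)
          = c ^ s * (of_nat (Suc j) * I (Suc j) * exp_coeff I (n - j))"
        unfolding less.IH[OF \<open>n - j < s\<close>] \<open>c ^ Suc j * c ^ (n - j) = c ^ s\<close>[symmetric]
        by (simp only: mult_ac)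
    qed
    then show ?thesis
      by (simp only: Suc exp_coeff.simps sum_distrib_left[symmetric] times_divide_eq_right)
  qed simp
qed

text \<open>The Riccati recursion for the logarithmic derivative of a formal solution: with
  \<open>v = (\<Sum>s. riccati_v N A s * \<lambda>^(-s))\<close> one has \<open>u' = \<lambda> (1 + v) u\<close> and
  \<open>u^(m) = \<lambda>^m (\<Sum>s. riccati_q N A s m * \<lambda>^(-s)) u\<close>.\<close>

function riccati_v :: "nat \<Rightarrow> (nat \<Rightarrow> complex \<Rightarrow> complex) \<Rightarrow> nat \<Rightarrow> complex \<Rightarrow> complex"
  and riccati_q :: "nat \<Rightarrow> (nat \<Rightarrow> complex \<Rightarrow> complex) \<Rightarrow> nat \<Rightarrow> nat \<Rightarrow> complex \<Rightarrow> complex" where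
  "riccati_v N A s = (if s = 0 then (\<lambda>z. 0) else (\<lambda>z. - ((\<Sum>k<N. deriv (riccati_q N A (s - 1) k) z
      + (\<Sum>i\<in>{1..<s}. riccati_v N A i z * riccati_q N A (s - i) k z))
      + (\<Sum>l\<in>{2..min N s}. A l z * riccati_q N A (s - l) (N - l) z)) / of_nat N))"
| "riccati_q N A s m = (if s = 0 then (\<lambda>z. 1) else (\<lambda>z. \<Sum>k<m. deriv (riccati_q N A (s - 1) k) z
      + (\<Sum>i\<in>{1..s}. riccati_v N A i z * riccati_q N A (s - i) k z)))"
  by pat_completeness auto
termination
  \<comment> \<open>\<open>riccati_q\<close> at s calls \<open>riccati_v\<close> at the same s,
    whereas \<open>riccati_v\<close> at s calls \<open>riccati_q\<close> only below s; odd and even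
    values of the measure respect this order. The recursion in m is already summed out over k < m,
    so m does not enter.\<close>
  by (relation "Wellfounded.measure (case_sum (\<lambda>(N, A, s). 2 * s) (\<lambda>(N, A, s, m). 2 * s + 1))") auto

declare riccati_v.simps [simp del] riccati_q.simps [simp del]

lemma riccati_v_0: "riccati_v N A 0 = (\<lambda>z. 0)"
  by (simp add: riccati_v.simps)

lemma riccati_q_0: "riccati_q N A 0 m = (\<lambda>z. 1)"
  by (simp add: riccati_q.simps)

text \<open>The operator has no term with l = 1. Hence u'/u - \<lambda> = \<lambda> v begins with
  \<lambda>^(-1), in agreement with the leading coefficient 1 of the solution.\<close>

lemma riccati_v_1: "riccati_v N A (Suc 0) z = 0"
  by (simp add: riccati_v.simps riccati_q_0)

lemma riccati_q_m0: "riccati_q N A (Suc s) 0 z = 0"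
  by (simp add: riccati_q.simps)

text \<open>Differentiating \<lambda>^m q_m u with u' = \<lambda> (1 + v) u gives q_(m+1) = (1 + v)
  q_m + q_m' / \<lambda>. Since v has no constant term, its series is shifted by one and the product
  is read at s instead of s + 1.\<close>

lemma riccati_q_Suc:
  "riccati_q N A (Suc s) (Suc m) z = riccati_q N A (Suc s) m z + deriv (riccati_q N A s m) z
    + (Abs_fps (\<lambda>j. riccati_v N A (Suc j) z) * Abs_fps (\<lambda>i. riccati_q N A i m z)) $ s"
proof -
  have "(\<Sum>i\<in>{1..Suc s}. riccati_v N A i z * riccati_q N A (Suc s - i) m z)
      = (\<Sum>i\<in>{0..s}. riccati_v N A (Suc i) z * riccati_q N A (s - i) m z)"
    using sum.shift_bounds_cl_Suc_ivl[of "\<lambda>i. riccati_v N A i z * riccati_q N A (Suc s - i) m z" 0 s] by simp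
  then show ?thesis
    by (subst (1 2) riccati_q.simps) (simp add: fps_mult_nth)
qed

text \<open>The unknown \<open>riccati_v N A s\<close> occurs in \<open>riccati_q N A s N\<close>
  once for each k < N, with factor \<open>riccati_q N A 0 k\<close> = 1. Its definition solves the
  equation for this N-fold occurrence.\<close>

lemma riccati_equation:
  assumes "N \<ge> 1" "s \<ge> 1"
  shows "riccati_q N A s N z + (\<Sum>l\<in>{2..min N s}. A l z * riccati_q N A (s - l) (N - l) z) = 0"
proof -
  have "{1..s} = insert s {1..<s}" using assms(2) by auto
  then have "riccati_q N A s N z = (\<Sum>k<N. deriv (riccati_q N A (s - 1) k) z
      + (riccati_v N A s z + (\<Sum>i\<in>{1..<s}. riccati_v N A i z * riccati_q N A (s - i) k z)))"
    using assms by (subst riccati_q.simps) (simp add: riccati_q_0)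
  also have "\<dots> = (\<Sum>k<N. deriv (riccati_q N A (s - 1) k) z
      + (\<Sum>i\<in>{1..<s}. riccati_v N A i z * riccati_q N A (s - i) k z)) + of_nat N * riccati_v N A s z"
    by (simp add: sum.distrib)
  finally show ?thesis using assms by (subst (asm) riccati_v.simps) (simp add: field_simps)
qed

lemma riccati_holomorphic:
  assumes S: "open S" and A: "\<And>l. l \<in> {2..N} \<Longrightarrow> A l holomorphic_on S"
  shows "riccati_v N A s holomorphic_on S \<and> (\<forall>m. riccati_q N A s m holomorphic_on S)"
proof (induction s rule: less_induct)
  case (less s)
  have v: "riccati_v N A s holomorphic_on S"
  proof (cases "s = 0")
    case False
    then show ?thesis
      by (subst riccati_v.simps) (auto intro!: holomorphic_intros S A less.IH[THEN conjunct1] less.IH[THEN conjunct2, rule_format])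
  qed (simp add: riccati_v_0)
  have v': "riccati_v N A i holomorphic_on S" if "i \<le> s" for i
    using v less.IH[of i] that by (cases "i = s") auto
  have "riccati_q N A s m holomorphic_on S" for m
  proof (cases "s = 0")
    case False
    then show ?thesis
      by (subst riccati_q.simps) (auto intro!: holomorphic_intros S v' less.IH[THEN conjunct2, rule_format])
  qed (simp add: riccati_q_0)
  with v show ?case by blast
qed

text \<open>The hypothesis on \<xi> says \<Xi>' = \<lambda> v \<Xi>. In powers of x = 1 / \<lambda>
  the m-th formal derivative is therefore \<lambda>^m R_m \<Xi>, and the differential equation
  becomes the Riccati identity \<open>one\<close> multiplied by \<Xi>.\<close>

lemma riccati_solves:
  assumes T: "open T" and N: "N \<ge> 1" and A: "\<And>l. l \<in> {2..N} \<Longrightarrow> A l holomorphic_on T"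
    and \<xi>0: "\<And>z. z \<in> T \<Longrightarrow> \<xi> 0 z = 1"
    and \<xi>: "\<And>z s. z \<in> T \<Longrightarrow> (\<xi> s has_field_derivative
      (Abs_fps (\<lambda>j. riccati_v N A (Suc j) z) * Abs_fps (\<lambda>s. \<xi> s z)) $ s) (at z)"
    and z: "z \<in> T"
  defines "F \<equiv> \<lambda>(k::int) z. if k \<le> 0 then \<xi> (nat (- k)) z else 0"
  shows "(formal_step ^^ N) F k z + (\<Sum>l=2..N. A l z * (formal_step ^^ (N - l)) F k z) = F (k - int N) z"
proof -
  define R where "R = (\<lambda>m z. Abs_fps (\<lambda>i. riccati_q N A i m z))"
  define V where "V = (\<lambda>z. Abs_fps (\<lambda>j. riccati_v N A (Suc j) z))"
  define \<Xi> where "\<Xi> = (\<lambda>z. Abs_fps (\<lambda>s. \<xi> s z))"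
  have step: "(formal_step ^^ m) F k z = (if k \<le> int m then (R m z * \<Xi> z) $ nat (int m - k) else 0)"
    if "z \<in> T" for m k z
    using that
  proof (induction m arbitrary: k z)
    case 0
    have "R 0 z $ n = 1 $ n" for n
      by (cases n) (simp_all add: R_def riccati_q_0 riccati_q_m0)
    then have "R 0 z = 1" by (rule fps_ext)
    then show ?case by (simp add: F_def \<Xi>_def)
  next
    case (Suc m)
    have IH: "(formal_step ^^ m) F k y = (if k \<le> int m then (R m y * \<Xi> y) $ nat (int m - k) else 0)" if "y \<in> T" for k y
      by (rule Suc.IH[OF that])
    have d: "deriv ((formal_step ^^ m) F k) z = deriv (\<lambda>y. if k \<le> int m then (R m y * \<Xi> y) $ nat (int m - k) else 0) z"
      by (rule deriv_cong_ev) (use eventually_nhds_in_open[OF T Suc.prems] IH in \<open>auto elim: eventually_mono\<close>)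
    have prod: "((\<lambda>y. (R m y * \<Xi> y) $ n) has_field_derivative
        (Abs_fps (\<lambda>i. deriv (riccati_q N A i m) z) * \<Xi> z + R m z * (V z * \<Xi> z)) $ n) (at z)" for n
    proof -
      have q: "(riccati_q N A i m has_field_derivative deriv (riccati_q N A i m) z) (at z)" for i
        using riccati_holomorphic[where A = A and S = T and s = i, OF T A] T Suc.prems holomorphic_derivI by blast
      have "((\<lambda>y. \<Sum>i=0..n. riccati_q N A i m y * \<xi> (n - i) y) has_field_derivative
        (\<Sum>i=0..n. deriv (riccati_q N A i m) z * \<xi> (n - i) z + riccati_q N A i m z * (V z * \<Xi> z) $ (n - i))) (at z)"
      proof (rule DERIV_sum)
        fix i
        show "((\<lambda>y. riccati_q N A i m y * \<xi> (n - i) y) has_field_derivative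
            deriv (riccati_q N A i m) z * \<xi> (n - i) z + riccati_q N A i m z * (V z * \<Xi> z) $ (n - i)) (at z)"
          using DERIV_mult[OF q[of i] \<xi>[OF Suc.prems, of "n - i"]]
          by (simp add: V_def \<Xi>_def algebra_simps)
      qed
      then show ?thesis
        by (simp add: fps_mult_nth[of "R m _"] fps_mult_nth[of "Abs_fps _" "\<Xi> z"] sum.distrib)
           (simp add: R_def \<Xi>_def)
    qed
    have rec: "(R (Suc m) z * \<Xi> z) $ Suc n
        = (R m z * \<Xi> z) $ Suc n + (Abs_fps (\<lambda>i. deriv (riccati_q N A i m) z) * \<Xi> z + R m z * (V z * \<Xi> z)) $ n" for n
    proof -
      have "R (Suc m) z = R m z + fps_X * (Abs_fps (\<lambda>i. deriv (riccati_q N A i m) z) + V z * R m z)"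
      proof (rule fps_ext)
        fix i
        show "R (Suc m) z $ i = (R m z + fps_X * (Abs_fps (\<lambda>i. deriv (riccati_q N A i m) z) + V z * R m z)) $ i"
          by (cases i) (simp_all add: R_def V_def riccati_q_0 riccati_q_Suc)
      qed
      then have "R (Suc m) z * \<Xi> z = R m z * \<Xi> z
          + fps_X * (Abs_fps (\<lambda>i. deriv (riccati_q N A i m) z) * \<Xi> z + R m z * (V z * \<Xi> z))"
        by (simp add: algebra_simps)
      then show ?thesis by simp
    qed
    have step: "(formal_step ^^ Suc m) F k z = deriv ((formal_step ^^ m) F k) z + (formal_step ^^ m) F (k - 1) z"
      by (simp add: formal_step_def)
    consider "k > int (Suc m)" | "k = int (Suc m)" | "k \<le> int m" by linarith
    then show ?case
    proof cases
      case 1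
      then show ?thesis unfolding step d IH[OF Suc.prems] by simp
    next
      case 2
      then show ?thesis unfolding step d IH[OF Suc.prems] by (simp add: R_def riccati_q_0)
    next
      case 3
      then have n: "nat (int m - (k - 1)) = Suc (nat (int m - k))" "nat (int (Suc m) - k) = Suc (nat (int m - k))"
        by linarith+
      from 3 show ?thesis
        unfolding step d IH[OF Suc.prems] n using DERIV_imp_deriv[OF prod[of "nat (int m - k)"]]
        by (simp add: rec)
    qed
  qed
  have one: "R N z + (\<Sum>l=2..N. fps_const (A l z) * (fps_X ^ l * R (N - l) z)) = 1"
  proof (rule fps_ext)
    fix n
    have "(\<Sum>l=2..N. A l z * (if n < l then 0 else riccati_q N A (n - l) (N - l) z))
        = (\<Sum>l\<in>{2..min N n}. A l z * riccati_q N A (n - l) (N - l) z)"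
      by (rule sum.mono_neutral_cong_right) auto
    then have "(R N z + (\<Sum>l=2..N. fps_const (A l z) * (fps_X ^ l * R (N - l) z))) $ n
        = riccati_q N A n N z + (\<Sum>l\<in>{2..min N n}. A l z * riccati_q N A (n - l) (N - l) z)"
      by (simp add: fps_sum_nth fps_X_power_mult_nth R_def cong: if_cong)
    also have "\<dots> = 1 $ n"
    proof (cases "n = 0")
      case False
      then show ?thesis using riccati_equation[OF N, of n A z] by simp
    qed (simp add: riccati_q_0)
    finally show "(R N z + (\<Sum>l=2..N. fps_const (A l z) * (fps_X ^ l * R (N - l) z))) $ n = 1 $ n" .
  qed
  show ?thesis
  proof (cases "k \<le> int N")
    case True
    define n where "n = nat (int N - k)"
    have "(formal_step ^^ (N - l)) F k z = (fps_X ^ l * (R (N - l) z * \<Xi> z)) $ n" if "l \<in> {2..N}" for l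
    proof -
      have "k \<le> int (N - l) \<longleftrightarrow> \<not> n < l" "nat (int (N - l) - k) = n - l"
        using that True by (auto simp: n_def)
      then show ?thesis by (simp add: step[OF z] fps_X_power_mult_nth)
    qed
    then have "(formal_step ^^ N) F k z + (\<Sum>l=2..N. A l z * (formal_step ^^ (N - l)) F k z)
        = (R N z * \<Xi> z + (\<Sum>l=2..N. fps_const (A l z) * (fps_X ^ l * (R (N - l) z * \<Xi> z)))) $ n"
      using True by (simp add: step[OF z] n_def fps_sum_nth)
    also have "R N z * \<Xi> z + (\<Sum>l=2..N. fps_const (A l z) * (fps_X ^ l * (R (N - l) z * \<Xi> z)))
        = (R N z + (\<Sum>l=2..N. fps_const (A l z) * (fps_X ^ l * R (N - l) z))) * \<Xi> z"
      by (simp add: distrib_right sum_distrib_right mult.assoc)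
    also have "\<dots> $ n = \<xi> n z" unfolding one by (simp add: \<Xi>_def)
    also have "\<dots> = F (k - int N) z" using True by (simp add: F_def n_def)
    finally show ?thesis .
  next
    case False
    have "(\<Sum>l=2..N. A l z * (formal_step ^^ (N - l)) F k z) = 0"
      using False by (intro sum.neutral) (auto simp: step[OF z])
    moreover have "(formal_step ^^ N) F k z = 0" using False by (simp add: step[OF z])
    moreover have "F (k - int N) z = 0" using False by (simp add: F_def)
    ultimately show ?thesis by simp
  qed
qed

text \<open>The shift of the index is due to \<open>u' / u - \<lambda> = \<lambda> v\<close>.\<close>

definition wkb :: "nat \<Rightarrow> (nat \<Rightarrow> complex \<Rightarrow> complex) \<Rightarrow> nat \<Rightarrow> cover_point \<Rightarrow> complex" where
  "wkb N A s p = exp_coeff (\<lambda>j. cover_integral (riccati_v N A (Suc j)) p) s"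

theorem wkb_normalized_formal_solution:
  assumes S: "open S" and N: "N \<ge> 1" and A: "\<And>l. l \<in> {2..N} \<Longrightarrow> A l holomorphic_on S" and w: "w \<in> S"
  shows "normalized_formal_solution N A S w (wkb N A)"
proof -
  have rv: "riccati_v N A j holomorphic_on S" for j
    using riccati_holomorphic[where A = A and S = S, OF S A] by blast
  have der: "((\<lambda>z. wkb N A s (sheet S p z)) has_field_derivative
      (Abs_fps (\<lambda>j. riccati_v N A (Suc j) z) * Abs_fps (\<lambda>s. wkb N A s (sheet S p z))) $ s) (at z)"
    if p: "p \<in> univ_cover S w" "ball (fst p) r \<subseteq> S" "z \<in> ball (fst p) r" for p r z s
  proof -
    \<comment> \<open>The constant term set to 0 by the rule for derivatives of exponentials is
      \<open>riccati_v N A (Suc 0)\<close>, which vanishes.\<close>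
    have "(\<lambda>j. if j = 0 then 0 else riccati_v N A (Suc j) z) = (\<lambda>j. riccati_v N A (Suc j) z)"
      using riccati_v_1 by auto
    then show ?thesis
      unfolding wkb_def
      using exp_coeff_has_derivative[OF cover_integral_has_derivative[OF S rv p], of "\<lambda>j. Suc j" s] by simp
  qed
  have hol: "cover_holomorphic S w (wkb N A s)" for s
  proof (rule cover_holomorphicI[OF S])
    fix p r assume p: "p \<in> univ_cover S w" "ball (fst p) r \<subseteq> S"
    show "(\<lambda>z. wkb N A s (sheet S p z)) holomorphic_on ball (fst p) r"
      using der[OF p] unfolding holomorphic_on_open[OF open_ball] by blast
  qed
  have "solves_formally N A S w (Psi w (wkb N A))"
    unfolding solves_formally_def
  proof (intro ballI allI)
    fix p k assume p: "p \<in> univ_cover S w"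
    obtain r where r: "0 < r" "ball (fst p) r \<subseteq> S" by (rule univ_cover_ball[OF S p])
    have z: "fst p \<in> ball (fst p) r" using r by simp
    define F where "F = (\<lambda>(k::int) z. if k \<le> 0 then wkb N A (nat (- k)) (sheet S p z) else 0)"
    have F: "fst ((formal_deriv S ^^ m) (Psi w (wkb N A)) p) k = (formal_step ^^ m) F k (fst p)" for m
    proof -
      have "fst ((formal_deriv S ^^ m) (Psi w (wkb N A)) (sheet S p (fst p))) k
          = (formal_step ^^ m) (\<lambda>k z. fst (Psi w (wkb N A) (sheet S p z)) k) k (fst p)"
        using formal_deriv_local[OF S snd_Psi Psi_holomorphic[where \<xi> = "wkb N A", OF hol], where m = m] p r(2) z by blast
      then show ?thesis by (simp add: sheet_self[OF p] F_def Psi_def)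
    qed
    have "(formal_step ^^ N) F k (fst p) + (\<Sum>l=2..N. A l (fst p) * (formal_step ^^ (N - l)) F k (fst p)) = F (k - int N) (fst p)"
      unfolding F_def
    proof (rule riccati_solves[OF open_ball N _ _ _ z])
      show "A l holomorphic_on ball (fst p) r" if "l \<in> {2..N}" for l
        using A[OF that] r(2) holomorphic_on_subset by blast
      show "wkb N A 0 (sheet S p y) = 1" for y by (simp add: wkb_def)
    qed (rule der[OF p r(2)])
    then show "fst ((formal_deriv S ^^ N) (Psi w (wkb N A)) p) k
          + (\<Sum>l=2..N. A l (fst p) * fst ((formal_deriv S ^^ (N - l)) (Psi w (wkb N A)) p) k)
        = fst (Psi w (wkb N A) p) (k - int N)"
      unfolding F by (simp add: F_def Psi_def sheet_self[OF p])
  qed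
  moreover have "wkb N A s (w, path_class S (\<lambda>t. w)) = 0" if "s \<ge> 1" for s
    using that by (cases s) (simp_all add: wkb_def cover_integral_base[OF S rv w])
  moreover have "wkb N A 0 p = 1" for p by (simp add: wkb_def)
  ultimately show ?thesis unfolding normalized_formal_solution_def using hol by blast
qed


subsection \<open>Dependence on parameters and the transformation law\<close>

context complex_scaling
begin

lemma cdiff_exp_coeff:
  assumes "\<And>j. cdiff (\<lambda>X. I X j) X0"
  shows "cdiff (\<lambda>X. exp_coeff (I X) s) X0"
proof (induction s rule: less_induct)
  case (less s)
  show ?case
  proof (cases s)
    case (Suc n)
    have "cdiff (\<lambda>X. 1 / of_nat (Suc n) * (\<Sum>j\<le>n. of_nat (Suc j) * I X (Suc j) * exp_coeff (I X) (n - j))) X0"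
      by (intro cdiff_mult cdiff_const cdiff_sum assms less.IH) (use Suc in auto)
    then show ?thesis by (simp add: Suc)
  qed (simp add: cdiff_const)
qed

lemma riccati_sep_hol:
  assumes V: "open V" and W: "open W" and A: "\<And>l. l \<in> {2..N} \<Longrightarrow> sep_hol V W (\<lambda>X. A X l)"
  shows "sep_hol V W (\<lambda>X. riccati_v N (A X) s) \<and> (\<forall>m. sep_hol V W (\<lambda>X. riccati_q N (A X) s m))"
proof (induction s rule: less_induct)
  case (less s)
  note D = sep_hol_deriv[OF V W]
  have v: "sep_hol V W (\<lambda>X. riccati_v N (A X) s)"
  proof (cases "s = 0")
    case False
    have "sep_hol V W (\<lambda>X z. - 1 / of_nat N * ((\<Sum>k<N. deriv (riccati_q N (A X) (s - 1) k) z
        + (\<Sum>i\<in>{1..<s}. riccati_v N (A X) i z * riccati_q N (A X) (s - i) k z))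
      + (\<Sum>l\<in>{2..min N s}. A X l z * riccati_q N (A X) (s - l) (N - l) z)))"
      by (intro sep_hol_mult sep_hol_add sep_hol_sum sep_hol_const D A
          less.IH[THEN conjunct1] less.IH[THEN conjunct2, rule_format]) (use False in auto)
    moreover have "- 1 / of_nat N * x = - x / of_nat N" for x :: complex by simp
    ultimately show ?thesis by (subst riccati_v.simps) (simp only: False if_False)
  qed (simp add: riccati_v_0 sep_hol_const)
  have v': "sep_hol V W (\<lambda>X. riccati_v N (A X) i)" if "i \<le> s" for i
    using v less.IH[of i] that by (cases "i = s") auto
  have "sep_hol V W (\<lambda>X. riccati_q N (A X) s m)" for m
  proof (cases "s = 0")
    case False
    have "sep_hol V W (\<lambda>X z. \<Sum>k<m. deriv (riccati_q N (A X) (s - 1) k) z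
        + (\<Sum>i\<in>{1..s}. riccati_v N (A X) i z * riccati_q N (A X) (s - i) k z))"
      by (intro sep_hol_mult sep_hol_add sep_hol_sum D v' less.IH[THEN conjunct2, rule_format])
        (use False in auto)
    then show ?thesis by (subst riccati_q.simps) (simp only: False if_False)
  qed (simp add: riccati_q_0 sep_hol_const)
  with v show ?case by blast
qed

end

section \<open>Joint holomorphy in the end point and the base point\<close>

lemma complex_scaling_pair: "complex_scaling (\<lambda>c x :: complex \<times> complex. (c * fst x, c * snd x))"
proof (rule complex_scaling.intro)
  show "bounded_bilinear (\<lambda>c x :: complex \<times> complex. (c * fst x, c * snd x))"
    unfolding bilinear_conv_bounded_bilinear[symmetric] bilinear_def
    by (auto intro!: linearI simp: algebra_simps)
  show "norm (c * fst x, c * snd x) = norm c * norm x" for c and x :: "complex \<times> complex"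
    by (simp add: norm_prod_def norm_mult power_mult_distrib distrib_left[symmetric] real_sqrt_mult)
qed (simp_all add: mult.assoc)

interpretation pair: complex_scaling "\<lambda>c x :: complex \<times> complex. (c * fst x, c * snd x)"
  by (rule complex_scaling_pair)

lemma pair_cdiff_fst:
  assumes "(f has_field_derivative f') (at (fst x))"
  shows "pair.cdiff (\<lambda>x. f (fst x)) x"
proof -
  have "((\<lambda>x. f (fst x)) has_derivative (\<lambda>h. f' * fst h)) (at x)"
    using has_derivative_compose[OF has_derivative_fst[OF has_derivative_ident] assms[unfolded has_field_derivative_def]]
    by simp
  then show ?thesis unfolding pair.cdiff_def by (intro exI conjI) auto
qed

lemma pair_cdiff_snd:
  assumes "(f has_field_derivative f') (at (snd x))"
  shows "pair.cdiff (\<lambda>x. f (snd x)) x"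
proof -
  have "((\<lambda>x. f (snd x)) has_derivative (\<lambda>h. f' * snd h)) (at x)"
    using has_derivative_compose[OF has_derivative_snd[OF has_derivative_ident] assms[unfolded has_field_derivative_def]]
    by simp
  then show ?thesis unfolding pair.cdiff_def by (intro exI conjI) auto
qed

lemma pair_cdiff_imp_holomorphic_two:
  assumes "\<And>x. x \<in> U \<Longrightarrow> pair.cdiff f x"
  shows "holomorphic_two f U"
  unfolding holomorphic_two_def
proof
  fix x assume "x \<in> U"
  then obtain D where D: "(f has_derivative D) (at x)" "\<And>c h. D (c * fst h, c * snd h) = c * D h"
    using assms unfolding pair.cdiff_def by blast
  have "D h = D (1, 0) * fst h + D (0, 1) * snd h" for h
  proof -
    have "D h = D ((fst h, 0) + (0, snd h))" by simp
    also have "\<dots> = D (fst h, 0) + D (0, snd h)"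
      using D(1) by (intro linear_add has_derivative_linear)
    finally show ?thesis using D(2)[of "fst h" "(1, 0)"] D(2)[of "snd h" "(0, 1)"] by simp
  qed
  then have "D = (\<lambda>h. D (1, 0) * fst h + D (0, 1) * snd h)" by blast
  with D(1) have "(f has_derivative (\<lambda>h. D (1, 0) * fst h + D (0, 1) * snd h)) (at x)" by simp
  then show "\<exists>A B. (f has_derivative (\<lambda>h. A * fst h + B * snd h)) (at x)" by blast
qed

text \<open>On a product of two balls the integral along the moved path equals P(z) - Q(w') plus a
  constant, with local primitives P and Q of the integrand, so the two variables separate. The
  coefficients of the exponential are polynomials in such integrals.\<close>

lemma wkb_locally_holomorphic_in_both:
  assumes S: "open S" and A: "\<And>l. l \<in> {2..N} \<Longrightarrow> A l holomorphic_on S"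
  shows "locally_holomorphic_in_both S (\<lambda>p w. wkb N A s p)"
  unfolding locally_holomorphic_in_both_def
proof (intro ballI)
  fix w p assume w: "w \<in> S" and p: "p \<in> univ_cover S w"
  obtain r where r: "0 < r" "ball (fst p) r \<subseteq> S" by (rule univ_cover_ball[OF S p])
  obtain r' where r': "0 < r'" "ball w r' \<subseteq> S" using S w open_contains_ball by blast
  define e where "e = min r r'"
  have e: "0 < e" "ball (fst p) e \<subseteq> S" "ball w e \<subseteq> S" using r r' by (auto simp: e_def)
  let ?U = "ball (fst p) e \<times> ball w e"
  have "pair.cdiff (\<lambda>x. cover_integral f (sheet_base S w p (snd x) (fst x))) x"
    if f: "f holomorphic_on S" and x: "x \<in> ?U" for f x
  proof -
    obtain P where P: "\<And>z. z \<in> ball (fst p) e \<Longrightarrow> (P has_field_derivative f z) (at z)"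
      "\<And>y z. y \<in> ball (fst p) e \<Longrightarrow> z \<in> ball (fst p) e \<Longrightarrow> contour_integral (linepath y z) f = P z - P y"
      using ball_primitive[OF holomorphic_on_subset[OF f e(2)]] by blast
    obtain Q where Q: "\<And>z. z \<in> ball w e \<Longrightarrow> (Q has_field_derivative f z) (at z)"
      "\<And>y z. y \<in> ball w e \<Longrightarrow> z \<in> ball w e \<Longrightarrow> contour_integral (linepath y z) f = Q z - Q y"
      using ball_primitive[OF holomorphic_on_subset[OF f e(3)]] by blast
    have "pair.cdiff (\<lambda>x. (Q w + cover_integral f p - P (fst p)) + (P (fst x) + - 1 * Q (snd x))) x"
      using x by (intro pair.cdiff_add pair.cdiff_mult pair.cdiff_const pair_cdiff_fst[OF P(1)] pair_cdiff_snd[OF Q(1)]) auto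
    then show ?thesis
    proof (rule pair.cdiff_transform[of _ _ ?U])
      fix y assume y: "y \<in> ?U"
      then have y': "fst y \<in> ball (fst p) e" "snd y \<in> ball w e" by auto
      have c: "fst p \<in> ball (fst p) e" "w \<in> ball w e" using e by auto
      show "Q w + cover_integral f p - P (fst p) + (P (fst y) + - 1 * Q (snd y))
          = cover_integral f (sheet_base S w p (snd y) (fst y))"
        using cover_integral_sheet_base[OF S f p segment_in_ball[OF c(1) y'(1) e(2)] segment_in_ball[OF y'(2) c(2) e(3)]]
          P(2)[OF c(1) y'(1)] Q(2)[OF y'(2) c(2)] by simp
    qed (use x in \<open>auto intro: open_Times\<close>)
  qed
  then have "pair.cdiff (\<lambda>x. wkb N A s (sheet_base S w p (snd x) (fst x))) x" if "x \<in> ?U" for x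
    unfolding wkb_def
    by (intro pair.cdiff_exp_coeff) (use that riccati_holomorphic[where A = A and S = S, OF S A] in blast)
  then have "holomorphic_two (\<lambda>x. wkb N A s (sheet_base S w p (snd x) (fst x))) ?U"
    by (rule pair_cdiff_imp_holomorphic_two)
  then show "\<exists>\<epsilon>>0. ball (fst p) \<epsilon> \<subseteq> S \<and> ball w \<epsilon> \<subseteq> S \<and>
        holomorphic_two (\<lambda>(z, w'). wkb N A s (sheet_base S w p w' z)) (ball (fst p) \<epsilon> \<times> ball w \<epsilon>)"
    using e unfolding case_prod_unfold by blast
qed

section \<open>Pole sets and holomorphy in the periods\<close>

lemma pole_set_properties:
  assumes "\<And>l. l \<in> {2..N} \<Longrightarrow> meromorphic_plane (a l \<Omega>)"
  shows "open (- pole_set N a \<Omega>)" and "l \<in> {2..N} \<Longrightarrow> a l \<Omega> holomorphic_on - pole_set N a \<Omega>"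
proof -
  have an: "a l \<Omega> analytic_on {z}" if "l \<in> {2..N}" "\<not> is_pole (a l \<Omega>) z" for l z
    using assms that by (auto simp: meromorphic_plane_def)
  have "open {z. \<not> is_pole (a l \<Omega>) z}" if l: "l \<in> {2..N}" for l
  proof (subst open_subopen, intro ballI)
    fix z assume "z \<in> {z. \<not> is_pole (a l \<Omega>) z}"
    then obtain T where T: "open T" "z \<in> T" "a l \<Omega> holomorphic_on T"
      using an[OF l] by (auto simp: analytic_at)
    then have "T \<subseteq> {z. \<not> is_pole (a l \<Omega>) z}" using not_is_pole_holomorphic by blast
    with T show "\<exists>T. open T \<and> z \<in> T \<and> T \<subseteq> {z. \<not> is_pole (a l \<Omega>) z}" by blast
  qed
  then have "open (\<Inter>l\<in>{2..N}. {z. \<not> is_pole (a l \<Omega>) z})" by (intro open_INT) auto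
  moreover have "(\<Inter>l\<in>{2..N}. {z. \<not> is_pole (a l \<Omega>) z}) = - pole_set N a \<Omega>"
    by (auto simp: pole_set_def)
  ultimately show "open (- pole_set N a \<Omega>)" by simp
  show "a l \<Omega> holomorphic_on - pole_set N a \<Omega>" if "l \<in> {2..N}"
    by (rule analytic_imp_holomorphic, subst analytic_on_analytic_at)
       (use an[OF that] that in \<open>auto simp: pole_set_def\<close>)
qed

text \<open>The class of \<gamma> is taken in a set that varies with \<Omega>. By compactness of the
  arc, a tube \<open>W\<close> around it avoids the poles for all \<Omega> near
  \<open>\<Omega>0\<close>. A homotopy inside \<open>W\<close> from \<gamma> to a polynomial path p
  is then valid for all these \<Omega>, and the same p computes every integral.\<close>

lemma wkb_holomorphic_periods:
  fixes a :: "nat \<Rightarrow> ('n::finite, 'g::finite) periods \<Rightarrow> complex \<Rightarrow> complex"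
  assumes gen: "holomorphic_for_generic_z N a"
    and mero: "\<And>l \<Omega>. l \<in> {2..N} \<Longrightarrow> \<Omega> \<in> siegel_prod \<Longrightarrow> meromorphic_plane (a l \<Omega>)"
    and \<gamma>: "arc_in UNIV w z \<gamma>"
  shows "holomorphic_periods (\<lambda>\<Omega>. wkb N (\<lambda>l. a l \<Omega>) s (z, path_class (- pole_set N a \<Omega>) \<gamma>))
    {\<Omega>. \<forall>x\<in>path_image \<gamma>. (\<Omega>, x) \<in> generic_locus N a}"
  unfolding holomorphic_periods_def
proof
  fix \<Omega>0 assume "\<Omega>0 \<in> {\<Omega>. \<forall>x\<in>path_image \<gamma>. (\<Omega>, x) \<in> generic_locus N a}"
  then have \<Omega>0: "(\<Omega>0, x) \<in> generic_locus N a" if "x \<in> path_image \<gamma>" for x using that by blast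
  note \<gamma>' = arc_inD[OF \<gamma>]
  define O' where "O' = \<Union>{T. open T \<and> (\<forall>(\<Omega>', z')\<in>T. \<Omega>' \<in> siegel_prod \<longrightarrow> z' \<notin> pole_set N a \<Omega>')}"
  have generic: "(\<Omega>, x) \<in> generic_locus N a \<longleftrightarrow> \<Omega> \<in> siegel_prod \<and> (\<Omega>, x) \<in> O'" for \<Omega> x
    by (auto simp: generic_locus_def O'_def)
  have "open O'" unfolding O'_def by (rule open_Union) blast
  moreover have sub: "{\<Omega>0} \<times> path_image \<gamma> \<subseteq> O'" using \<Omega>0 generic by auto
  moreover have "compact ({\<Omega>0} \<times> path_image \<gamma>)"
    by (intro compact_Times compact_path_image \<gamma>') auto
  ultimately obtain e where e: "0 < e" "(\<Union>x\<in>{\<Omega>0} \<times> path_image \<gamma>. ball x e) \<subseteq> O'"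
    using compact_subset_open_imp_ball_epsilon_subset by metis
  have \<Omega>0S: "\<Omega>0 \<in> siegel_prod"
    using \<Omega>0[of "pathstart \<gamma>"] generic by blast
  define W where "W = (\<Union>x\<in>path_image \<gamma>. ball x (e / 2))"
  have inO: "(\<Omega>, y) \<in> O'" if \<Omega>: "\<Omega> \<in> ball \<Omega>0 (e / 2)" and y: "y \<in> W" for \<Omega> y
  proof -
    obtain x where x: "x \<in> path_image \<gamma>" "dist x y < e / 2" using y by (auto simp: W_def)
    have "dist (\<Omega>0, x) (\<Omega>, y) \<le> dist \<Omega>0 \<Omega> + dist x y"
      unfolding dist_Pair_Pair by (rule sqrt_sum_squares_le_sum) auto
    also have "\<dots> < e" using \<Omega> x(2) by simp
    finally have "(\<Omega>, y) \<in> ball (\<Omega>0, x) e" by (simp only: mem_ball)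
    then show ?thesis using e(2) x(1) by blast
  qed
  have W: "open W" "path_image \<gamma> \<subseteq> W" using e(1) by (auto simp: W_def)
  obtain \<delta> where \<delta>: "0 < \<delta>" "\<And>X. X \<in> ball \<Omega>0 \<delta> \<Longrightarrow> symm X \<in> siegel_prod"
    using symm_in_siegel_prod[OF \<Omega>0S] by blast
  \<comment> \<open>Symmetrization maps \<open>V\<close> both into \<open>siegel_prod\<close> and
    into the ball of periods for which \<open>W\<close> avoids the poles.\<close>
  define V where "V = ball \<Omega>0 \<delta> \<inter> symm -` ball \<Omega>0 (e / 2)"
  have V: "open V" "\<Omega>0 \<in> V" "symm ` V \<subseteq> siegel_prod"
  proof -
    have "continuous_on UNIV (symm :: ('n, 'g) periods \<Rightarrow> _)"
      using bounded_linear_symm by (rule bounded_linear.continuous_on) (rule continuous_on_id)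
    then show "open V" unfolding V_def by (intro open_Int open_ball open_vimage)
    show "\<Omega>0 \<in> V" using \<delta>(1) e(1) by (simp add: V_def symm_siegel_prod[OF \<Omega>0S])
    show "symm ` V \<subseteq> siegel_prod" using \<delta>(2) by (auto simp: V_def)
  qed
  have VW: "(symm X, y) \<in> generic_locus N a" if "X \<in> V" "y \<in> W" for X y
    using that V(3) inO[of "symm X" y] generic by (auto simp: V_def)
  have Wsub: "W \<subseteq> - pole_set N a (symm X)" if "X \<in> V" for X
    using VW[OF that] by (auto simp: generic_locus_def)
  have sep: "periods.sep_hol V W (\<lambda>X. a l (symm X))" if l: "l \<in> {2..N}" for l
    unfolding periods.sep_hol_def
  proof (intro conjI ballI)
    fix y X assume y: "y \<in> W" and X: "X \<in> V"
    have "holomorphic_periods (\<lambda>\<Omega>. a l \<Omega> y) {\<Omega>. (\<Omega>, y) \<in> generic_locus N a}"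
      using gen l unfolding holomorphic_for_generic_z_def by blast
    then show "periods.cdiff (\<lambda>X. a l (symm X) y) X"
      by (rule cdiff_pullback[OF _ _ V(1) X V(3)]) (use VW X y in simp)
  next
    fix X assume X: "X \<in> V"
    then have "symm X \<in> siegel_prod" using V(3) by blast
    then show "a l (symm X) holomorphic_on W"
      using pole_set_properties(2)[of N a "symm X" l, OF mero l] Wsub[OF X] holomorphic_on_subset by blast
  qed
  have arcW: "arc_in W w z \<gamma>" using \<gamma>' W by (simp add: arc_in_def)
  obtain p where p: "polynomial_function p" "homotopic_paths W \<gamma> p"
    by (rule polynomial_path_in_class[OF W(1) arcW])
  have int: "periods.cdiff (\<lambda>X. cover_integral (riccati_v N (\<lambda>l. a l (symm X)) j) (z, path_class (- pole_set N a (symm X)) \<gamma>)) \<Omega>0" for j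
  proof -
    have "periods.sep_hol V W (\<lambda>X. riccati_v N (\<lambda>l. a l (symm X)) j)"
      using periods.riccati_sep_hol[OF V(1) W(1), of N "\<lambda>X l. a l (symm X)" j] sep by blast
    then have "periods.cdiff (\<lambda>X. contour_integral p (riccati_v N (\<lambda>l. a l (symm X)) j)) \<Omega>0"
      by (rule periods.sep_hol_contour_integral[OF V(1) W(1) _ V(2) p(1)])
        (use homotopic_paths_imp_subset[OF p(2)] in blast)
    then show ?thesis
    proof (rule periods.cdiff_transform[OF _ V(1,2)])
      fix X assume X: "X \<in> V"
      then have X': "symm X \<in> siegel_prod" using V(3) by blast
      note S = pole_set_properties[of N a "symm X", OF mero[OF _ X']]
      have "riccati_v N (\<lambda>l. a l (symm X)) j holomorphic_on - pole_set N a (symm X)"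
        using riccati_holomorphic[where A = "\<lambda>l. a l (symm X)", OF S] by blast
      from cover_integral_eq[OF S(1) this valid_path_polynomial_function[OF p(1)]
          homotopic_paths_subset[OF p(2) Wsub[OF X]]]
      show "contour_integral p (riccati_v N (\<lambda>l. a l (symm X)) j)
        = cover_integral (riccati_v N (\<lambda>l. a l (symm X)) j) (z, path_class (- pole_set N a (symm X)) \<gamma>)"
        by simp
    qed
  qed
  have "periods.cdiff (\<lambda>X. wkb N (\<lambda>l. a l (symm X)) s (z, path_class (- pole_set N a (symm X)) \<gamma>)) \<Omega>0"
    unfolding wkb_def by (rule periods.cdiff_exp_coeff[OF int])
  from cdiff_pushforward[OF this \<Omega>0S]
  show "\<exists>c :: ('n, 'g) periods. ((\<lambda>\<Omega>. wkb N (\<lambda>l. a l \<Omega>) s (z, path_class (- pole_set N a \<Omega>) \<gamma>)) has_derivative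
      (\<lambda>H. \<Sum>\<nu>\<in>UNIV. \<Sum>i\<in>UNIV. \<Sum>j\<in>UNIV. c $ \<nu> $ i $ j * H $ \<nu> $ i $ j)) (at \<Omega>0 within siegel_prod)" .
qed

section \<open>The transformation law\<close>

lemma riccati_scale:
  assumes S: "open S" and A: "\<And>l. l \<in> {2..N} \<Longrightarrow> A l holomorphic_on S" and j: "j \<noteq> 0"
    and A': "\<And>l z. l \<in> {2..N} \<Longrightarrow> z \<in> S \<Longrightarrow> A' l (z / j) = j ^ l * A l z"
  shows "\<forall>z\<in>S. riccati_v N A' s (z / j) = j ^ s * riccati_v N A s z \<and>
    (\<forall>m. riccati_q N A' s m (z / j) = j ^ s * riccati_q N A s m z)"
proof (induction s rule: less_induct)
  case (less s)
  \<comment> \<open>The factor j^(s-1) comes from the induction hypothesis, valid on a whole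
    neighbourhood of \<open>z / j\<close>, and one further factor j from the chain rule:
    differentiation raises the weight by one.\<close>
  have d: "deriv (riccati_q N A' (s - 1) k) (z / j) = j ^ s * deriv (riccati_q N A (s - 1) k) z"
    if "s \<noteq> 0" and z: "z \<in> S" for k z
  proof (rule DERIV_imp_deriv)
    have "riccati_q N A (s - 1) k holomorphic_on S"
      using riccati_holomorphic[where A = A and S = S, OF S A] by blast
    then have h: "(riccati_q N A (s - 1) k has_field_derivative deriv (riccati_q N A (s - 1) k) z) (at z)"
      using S z by (rule holomorphic_derivI)
    have "((\<lambda>u. j * u) has_field_derivative j) (at (z / j))"
      by (auto intro!: derivative_eq_intros)
    from DERIV_chain2[where g = "\<lambda>u. j * u" and x = "z / j", OF _ this] h
    have "((\<lambda>u. riccati_q N A (s - 1) k (j * u)) has_field_derivative deriv (riccati_q N A (s - 1) k) z * j) (at (z / j))"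
      using j by simp
    from DERIV_cmult[OF this, of "j ^ (s - 1)"]
    have "((\<lambda>u. j ^ (s - 1) * riccati_q N A (s - 1) k (j * u)) has_field_derivative
        j ^ s * deriv (riccati_q N A (s - 1) k) z) (at (z / j))"
      using that(1) by (cases s) (simp_all add: mult_ac)
    then show "(riccati_q N A' (s - 1) k has_field_derivative j ^ s * deriv (riccati_q N A (s - 1) k) z) (at (z / j))"
    proof (rule has_field_derivative_transform_within_open)
      show "open ((\<lambda>u. j * u) -` S)" using S by (intro open_vimage continuous_intros)
      show "z / j \<in> (\<lambda>u. j * u) -` S" using z j by simp
      fix u assume "u \<in> (\<lambda>u. j * u) -` S"
      then show "j ^ (s - 1) * riccati_q N A (s - 1) k (j * u) = riccati_q N A' (s - 1) k u"
        using less.IH[of "s - 1"] that(1) j by (force simp: dest: bspec[of _ _ "j * u"])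
    qed
  qed
  have pw: "j ^ i * x * (j ^ (s - i) * y) = j ^ s * (x * y)" if "i \<le> s" for i x y
  proof -
    have "j ^ s = j ^ i * j ^ (s - i)" using that by (simp add: power_add[symmetric])
    then show ?thesis by simp
  qed
  have v: "riccati_v N A' s (z / j) = j ^ s * riccati_v N A s z" if z: "z \<in> S" for z
  proof (cases "s = 0")
    case False
    have 1: "(\<Sum>i\<in>{1..<s}. riccati_v N A' i (z / j) * riccati_q N A' (s - i) k (z / j))
        = j ^ s * (\<Sum>i\<in>{1..<s}. riccati_v N A i z * riccati_q N A (s - i) k z)" for k
      unfolding sum_distrib_left
      by (intro sum.cong refl) (use less.IH z pw in auto)
    have 2: "(\<Sum>l\<in>{2..min N s}. A' l (z / j) * riccati_q N A' (s - l) (N - l) (z / j))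
        = j ^ s * (\<Sum>l\<in>{2..min N s}. A l z * riccati_q N A (s - l) (N - l) z)"
      unfolding sum_distrib_left
      by (intro sum.cong refl) (use less.IH z pw A' in auto)
    show ?thesis
      by (subst (1 2) riccati_v.simps)
        (simp only: False if_False d[OF False z] 1 2 distrib_left[symmetric]
          sum_distrib_left[symmetric] times_divide_eq_right mult_minus_right)
  qed (simp add: riccati_v_0)
  have "riccati_q N A' s m (z / j) = j ^ s * riccati_q N A s m z" if z: "z \<in> S" for m z
  proof (cases "s = 0")
    case False
    have 1: "(\<Sum>i\<in>{1..s}. riccati_v N A' i (z / j) * riccati_q N A' (s - i) k (z / j))
        = j ^ s * (\<Sum>i\<in>{1..s}. riccati_v N A i z * riccati_q N A (s - i) k z)" for k
      unfolding sum_distrib_left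
    proof (intro sum.cong refl)
      fix i assume i: "i \<in> {1..s}"
      have "riccati_v N A' i (z / j) = j ^ i * riccati_v N A i z"
        using v[OF z] less.IH[of i] i z by (cases "i = s") auto
      moreover have "riccati_q N A' (s - i) k (z / j) = j ^ (s - i) * riccati_q N A (s - i) k z"
        using less.IH[of "s - i"] i z by auto
      ultimately show "riccati_v N A' i (z / j) * riccati_q N A' (s - i) k (z / j)
          = j ^ s * (riccati_v N A i z * riccati_q N A (s - i) k z)"
        using pw i by simp
    qed
    show ?thesis
      by (subst (1 2) riccati_q.simps)
        (simp only: False if_False d[OF False z] 1 distrib_left[symmetric] sum_distrib_left[symmetric])
  qed (simp add: riccati_q_0)
  with v show ?case by blast
qed

text \<open>Since d(z / j) = dz / j, integration consumes one factor j. In the application this is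
  the difference between the weight i + 1 of \<open>riccati_v N A (Suc i)\<close> and the index i of
  its integral in the exponent.\<close>

lemma contour_integral_scale:
  assumes p: "polynomial_function p" and f: "\<And>z. z \<in> path_image p \<Longrightarrow> g (z / j) = j * c * f z" and j: "j \<noteq> 0"
  shows "contour_integral (\<lambda>t. p t / j) g = c * contour_integral p f"
proof -
  obtain p' where p': "\<And>t. (p has_vector_derivative p' t) (at t)"
    using has_vector_derivative_polynomial_function[OF p] by blast
  have d: "((\<lambda>t. p t / j) has_vector_derivative p' t / j) (at t)" for t
    using has_vector_derivative_mult_left[OF p'[of t], of "1 / j"] by simp
  have "contour_integral (\<lambda>t. p t / j) g = integral {0..1} (\<lambda>t. c * (f (p t) * p' t))"
    unfolding contour_integral_integral
    by (intro integral_cong) (use f j in \<open>auto simp: vector_derivative_at[OF d] path_image_def\<close>)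
  also have "\<dots> = c * contour_integral p f"
    by (simp add: contour_integral_integral vector_derivative_at[OF p'])
  finally show ?thesis .
qed

text \<open>A polynomial representative of the class of \<gamma> is carried by division by j to one
  of the scaled class. The i-th integral therefore acquires j^i, and the formal exponential is
  homogeneous for these weights.\<close>

lemma wkb_scale:
  assumes S: "open S" and A: "\<And>l. l \<in> {2..N} \<Longrightarrow> A l holomorphic_on S" and j: "j \<noteq> 0"
    and S': "\<And>z. z / j \<in> S' \<longleftrightarrow> z \<in> S"
    and A': "\<And>l z. l \<in> {2..N} \<Longrightarrow> z \<in> S \<Longrightarrow> A' l (z / j) = j ^ l * A l z"
    and \<gamma>: "arc_in S w z \<gamma>"
  shows "wkb N A' s (z / j, path_class S' (\<lambda>t. \<gamma> t / j)) = j ^ s * wkb N A s (z, path_class S \<gamma>)"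
proof -
  have S'eq: "S' = (\<lambda>u. j * u) -` S" using S'[of "j * _"] j by auto
  have oS': "open S'" unfolding S'eq using S by (intro open_vimage continuous_intros)
  have hA': "A' l holomorphic_on S'" if l: "l \<in> {2..N}" for l
  proof (rule holomorphic_transform)
    show "(\<lambda>u. j ^ l * A l (j * u)) holomorphic_on S'"
      unfolding S'eq
      by (intro holomorphic_intros holomorphic_on_compose_gen[OF _ A[OF l], unfolded comp_def]) auto
    show "j ^ l * A l (j * u) = A' l u" if "u \<in> S'" for u
      using A'[OF l, of "j * u"] that j by (simp add: S'eq)
  qed
  obtain p where p: "polynomial_function p" "homotopic_paths S \<gamma> p"
    by (rule polynomial_path_in_class[OF S \<gamma>])
  have pp: "polynomial_function (\<lambda>t. p t / j)"
    using polynomial_function_compose[OF p(1) polynomial_function_bounded_linear[OF bounded_linear_divide]]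
    by (simp add: comp_def)
  have "homotopic_paths S' ((\<lambda>u. u / j) \<circ> \<gamma>) ((\<lambda>u. u / j) \<circ> p)"
    by (rule homotopic_paths_continuous_image[OF p(2)]) (use S' j in \<open>auto intro!: continuous_intros\<close>)
  then have hom: "homotopic_paths S' (\<lambda>t. \<gamma> t / j) (\<lambda>t. p t / j)" by (simp add: comp_def)
  have "cover_integral (riccati_v N A' (Suc i)) (z / j, path_class S' (\<lambda>t. \<gamma> t / j))
      = j ^ i * cover_integral (riccati_v N A (Suc i)) (z, path_class S \<gamma>)" for i
  proof -
    have h: "riccati_v N A (Suc i) holomorphic_on S" "riccati_v N A' (Suc i) holomorphic_on S'"
      using riccati_holomorphic[where A = A and S = S, OF S A] riccati_holomorphic[where A = A' and S = S', OF oS' hA']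
      by blast+
    have "cover_integral (riccati_v N A' (Suc i)) (z / j, path_class S' (\<lambda>t. \<gamma> t / j))
        = contour_integral (\<lambda>t. p t / j) (riccati_v N A' (Suc i))"
      by (rule cover_integral_eq[OF oS' h(2) valid_path_polynomial_function[OF pp] hom])
    also have "\<dots> = j ^ i * contour_integral p (riccati_v N A (Suc i))"
    proof (rule contour_integral_scale[OF p(1) _ j])
      fix y assume "y \<in> path_image p"
      then have "y \<in> S" using homotopic_paths_imp_subset[OF p(2)] by blast
      then have "riccati_v N A' (Suc i) (y / j) = j ^ Suc i * riccati_v N A (Suc i) y"
        using riccati_scale[where A = A and A' = A' and S = S, OF S A j A'] by blast
      then show "riccati_v N A' (Suc i) (y / j) = j * j ^ i * riccati_v N A (Suc i) y" by simp
    qed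
    also have "contour_integral p (riccati_v N A (Suc i)) = cover_integral (riccati_v N A (Suc i)) (z, path_class S \<gamma>)"
      by (rule cover_integral_eq[OF S h(1) valid_path_polynomial_function[OF p(1)] p(2), symmetric])
    finally show ?thesis .
  qed
  then show ?thesis unfolding wkb_def by (simp add: exp_coeff_scale)
qed

text \<open>The relation between f and g is given only off the poles of f. As the singularity is
  isolated, it holds on a punctured neighbourhood, and being a pole depends on nothing more.\<close>

lemma is_pole_scale_iff:
  assumes f: "isolated_singularity_at f z" and j: "j \<noteq> 0" and c: "c \<noteq> 0"
    and g: "\<And>y. \<not> is_pole f y \<Longrightarrow> g (y / j) = c * f y"
  shows "is_pole g (z / j) \<longleftrightarrow> is_pole f z"
proof -
  have "\<forall>\<^sub>F y in at z. (g \<circ> (\<lambda>y. y / j)) y = c * f y"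
    using eventually_not_pole[OF f] by eventually_elim (simp add: g)
  then have "is_pole (g \<circ> (\<lambda>y. y / j)) z \<longleftrightarrow> is_pole (\<lambda>y. c * f y) z"
    by (rule is_pole_cong) simp
  also have "\<dots> \<longleftrightarrow> is_pole f z"
    by (rule is_pole_mult_analytic_nonzero1_iff) (use c in auto)
  finally have "is_pole (g \<circ> (\<lambda>y. y / j)) z \<longleftrightarrow> is_pole f z" .
  moreover have "is_pole (g \<circ> (\<lambda>y. y / j)) z" if "is_pole g (z / j)"
    unfolding comp_def
  proof (rule is_pole_compose[OF that])
    show "(\<lambda>y. y / j) \<midarrow>z\<rightarrow> z / j" using j by (intro tendsto_intros)
    show "\<forall>\<^sub>F y in at z. y / j \<noteq> z / j"
      using j by (simp add: eventually_at_filter)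
  qed
  moreover have "is_pole g (z / j)" if "is_pole (g \<circ> (\<lambda>y. y / j)) z"
  proof -
    have "is_pole (\<lambda>x. (g \<circ> (\<lambda>y. y / j)) (x * j)) (z / j)"
    proof (rule is_pole_compose[OF that])
      have "(\<lambda>y. y * j) \<midarrow>z / j\<rightarrow> z / j * j" by (intro tendsto_intros)
      then show "(\<lambda>y. y * j) \<midarrow>z / j\<rightarrow> z" using j by simp
      show "\<forall>\<^sub>F y in at (z / j). y * j \<noteq> z"
        using j by (auto simp: eventually_at_filter field_simps)
    qed
    then show ?thesis using j by simp
  qed
  ultimately show ?thesis by blast
qed

theorem theorem2p1:
  fixes \<phi> :: "'g::finite \<Rightarrow> 'f::field_char_0 \<Rightarrow> real"
    and \<Gamma> :: "('f, 'n::finite) mat2 set"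
    and N :: nat
    and a :: "nat \<Rightarrow> ('n, 'g) periods \<Rightarrow> complex \<Rightarrow> complex"
  assumes "number_field TYPE('f)"
    and "totally_real TYPE('f)"
    and "CARD('g) = field_degree TYPE('f)"
    and "bij_betw \<phi> UNIV {\<sigma>. field_embedding \<sigma>}"
    and "congruence_subgroup \<Gamma>"
    and "N \<ge> 2"
    and "holomorphic_for_generic_z N a"
    and "\<And>l \<Omega>. l \<in> {2..N} \<Longrightarrow> \<Omega> \<in> siegel_prod \<Longrightarrow> meromorphic_plane (a l \<Omega>)"
    and "\<And>l \<Omega> \<alpha> z. l \<in> {2..N} \<Longrightarrow> \<Omega> \<in> siegel_prod \<Longrightarrow> \<alpha> \<in> \<Gamma> \<Longrightarrow> \<not> is_pole (a l \<Omega>) z \<Longrightarrow>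
           a l (Sp_act \<phi> \<alpha> \<Omega>) (z / aut_factor \<phi> \<alpha> \<Omega>) = aut_factor \<phi> \<alpha> \<Omega> ^ l * a l \<Omega> z"
  shows
    "\<exists>\<xi> :: nat \<Rightarrow> ('n, 'g) periods \<Rightarrow> cover_point \<Rightarrow> complex \<Rightarrow> complex.
       (\<forall>\<Omega>\<in>siegel_prod. \<forall>w. w \<notin> pole_set N a \<Omega> \<longrightarrow>
          normalized_formal_solution N (\<lambda>l. a l \<Omega>) (- pole_set N a \<Omega>) w (\<lambda>s p. \<xi> s \<Omega> p w) \<and>
          (\<forall>\<eta>. normalized_formal_solution N (\<lambda>l. a l \<Omega>) (- pole_set N a \<Omega>) w \<eta> \<longrightarrow>
             (\<forall>s. \<forall>p\<in>univ_cover (- pole_set N a \<Omega>) w. \<eta> s p = \<xi> s \<Omega> p w))) \<and>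
       (\<forall>s w z \<gamma>. arc_in UNIV w z \<gamma> \<longrightarrow>
          holomorphic_periods (\<lambda>\<Omega>. \<xi> s \<Omega> (z, path_class (- pole_set N a \<Omega>) \<gamma>) w)
            {\<Omega>. \<forall>x\<in>path_image \<gamma>. (\<Omega>, x) \<in> generic_locus N a}) \<and>
       (\<forall>s. \<forall>\<Omega>\<in>siegel_prod. locally_holomorphic_in_both (- pole_set N a \<Omega>) (\<lambda>p w. \<xi> s \<Omega> p w)) \<and>
       (\<forall>\<alpha>\<in>\<Gamma>. \<forall>\<Omega>\<in>siegel_prod. \<forall>w z \<gamma>. arc_in (- pole_set N a \<Omega>) w z \<gamma> \<longrightarrow>
          (let j = aut_factor \<phi> \<alpha> \<Omega>;
               \<Omega>' = Sp_act \<phi> \<alpha> \<Omega>;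
               p = (z, path_class (- pole_set N a \<Omega>) \<gamma>);
               p' = (z / j, path_class (- pole_set N a \<Omega>') (\<lambda>t. \<gamma> t / j))
           in formal_subst j (Psi (w / j) (\<lambda>s q. \<xi> s \<Omega>' q (w / j)) p')
                = Psi w (\<lambda>s q. \<xi> s \<Omega> q w) p \<and>
              (\<forall>s. \<xi> s \<Omega>' p' (w / j) = j ^ s * \<xi> s \<Omega> p w)))"
proof -
  note emb = assms(4) and cong = assms(5) and N2 = assms(6) and gen = assms(7) and mero = assms(8) and trans = assms(9)
  have N: "N \<ge> 1" using N2 by simp
  \<comment> \<open>The base point enters through the homotopy class in \<open>p\<close>, all of
    whose paths start there.\<close>
  define \<xi> :: "nat \<Rightarrow> ('n, 'g) periods \<Rightarrow> cover_point \<Rightarrow> complex \<Rightarrow> complex"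
    where "\<xi> = (\<lambda>s \<Omega> p w. wkb N (\<lambda>l. a l \<Omega>) s p)"
  have S: "open (- pole_set N a \<Omega>)" if "\<Omega> \<in> siegel_prod" for \<Omega>
    using pole_set_properties(1)[of N a \<Omega>] mero that by blast
  have A: "a l \<Omega> holomorphic_on - pole_set N a \<Omega>" if "\<Omega> \<in> siegel_prod" "l \<in> {2..N}" for l \<Omega>
    using pole_set_properties(2)[of N a \<Omega> l] mero that by blast
  have sol: "normalized_formal_solution N (\<lambda>l. a l \<Omega>) (- pole_set N a \<Omega>) w (\<lambda>s p. \<xi> s \<Omega> p w)"
    if "\<Omega> \<in> siegel_prod" "w \<notin> pole_set N a \<Omega>" for \<Omega> w
    using wkb_normalized_formal_solution[where A = "\<lambda>l. a l \<Omega>" and w = w, OF S[OF that(1)] N A[OF that(1)]] that(2)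
    by (simp add: \<xi>_def)
  have law: "formal_subst j (Psi (w / j) (\<lambda>s q. \<xi> s \<Omega>' q (w / j)) p') = Psi w (\<lambda>s q. \<xi> s \<Omega> q w) p \<and>
      (\<forall>s. \<xi> s \<Omega>' p' (w / j) = j ^ s * \<xi> s \<Omega> p w)"
    if \<alpha>: "\<alpha> \<in> \<Gamma>" and \<Omega>: "\<Omega> \<in> siegel_prod" and \<gamma>: "arc_in (- pole_set N a \<Omega>) w z \<gamma>"
      and defs: "j = aut_factor \<phi> \<alpha> \<Omega>" "\<Omega>' = Sp_act \<phi> \<alpha> \<Omega>" "p = (z, path_class (- pole_set N a \<Omega>) \<gamma>)"
        "p' = (z / j, path_class (- pole_set N a \<Omega>') (\<lambda>t. \<gamma> t / j))"
    for \<alpha> \<Omega> w z \<gamma> j \<Omega>' p p'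
  proof -
    have "\<alpha> \<in> Sp UNIV"
      using cong \<alpha> subgroup.subset unfolding congruence_subgroup_def Sp_group_def by fastforce
    moreover have "field_embedding (\<phi> \<nu>)" for \<nu> using emb by (auto simp: bij_betw_def)
    ultimately have j: "j \<noteq> 0" unfolding defs(1) using \<Omega> by (intro aut_factor_nonzero)
    have tr: "a l \<Omega>' (y / j) = j ^ l * a l \<Omega> y" if "l \<in> {2..N}" "\<not> is_pole (a l \<Omega>) y" for l y
      unfolding defs using trans[OF that(1) \<Omega> \<alpha> that(2)] .
    \<comment> \<open>The automorphy law, given at regular points, must first be turned into a
      correspondence of the pole sets, so that division by j carries one covering to the
      other.\<close>
    have "is_pole (a l \<Omega>') (y / j) \<longleftrightarrow> is_pole (a l \<Omega>) y" if l: "l \<in> {2..N}" for l y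
    proof (rule is_pole_scale_iff[where c = "j ^ l"])
      show "isolated_singularity_at (a l \<Omega>) y"
        using mero[OF l \<Omega>] unfolding meromorphic_plane_def
        by (intro meromorphic_on_isolated_singularity) (auto intro: meromorphic_on_subset)
    qed (use j tr[OF l] in auto)
    then have "y / j \<in> - pole_set N a \<Omega>' \<longleftrightarrow> y \<in> - pole_set N a \<Omega>" for y
      by (simp add: pole_set_def)
    then have eq: "\<xi> s \<Omega>' p' (w / j) = j ^ s * \<xi> s \<Omega> p w" for s
      unfolding \<xi>_def defs(3,4)
      by (intro wkb_scale[OF S[OF \<Omega>] A[OF \<Omega>] j _ _ \<gamma>]) (auto simp: pole_set_def intro: tr)
    have "formal_subst j (Psi (w / j) (\<lambda>s q. \<xi> s \<Omega>' q (w / j)) p') = Psi w (\<lambda>s q. \<xi> s \<Omega> q w) p"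
    proof -
      \<comment> \<open>At \<lambda>^k with k = - s, the factor j^s from the law for \<xi> cancels
        the factor j^k from the substitution; in the exponent j cancels the denominators of z / j -
        w / j.\<close>
      have "j ^ nat (- k) * x * j powi k = x" if "k \<le> 0" for k x
      proof -
        have "k = - int (nat (- k))" using that by simp
        then have "j powi k = inverse (j ^ nat (- k))" by (metis power_int_minus power_int_of_nat)
        then show ?thesis using j by simp
      qed
      then show ?thesis
        using j by (auto simp: formal_subst_def Psi_def eq fun_eq_iff) (auto simp: defs(3,4) right_diff_distrib)
    qed
    with eq show ?thesis by blast
  qed
  show ?thesis
  proof (rule exI[of _ \<xi>], intro conjI ballI allI impI)
    fix \<Omega> w assume *: "\<Omega> \<in> siegel_prod" "w \<notin> pole_set N a \<Omega>"
    show "normalized_formal_solution N (\<lambda>l. a l \<Omega>) (- pole_set N a \<Omega>) w (\<lambda>s p. \<xi> s \<Omega> p w)"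
      by (rule sol[OF *])
    show "\<eta> s p = \<xi> s \<Omega> p w"
      if "normalized_formal_solution N (\<lambda>l. a l \<Omega>) (- pole_set N a \<Omega>) w \<eta>" "p \<in> univ_cover (- pole_set N a \<Omega>) w"
      for \<eta> s p
      by (rule normalized_formal_solution_unique[OF S[OF *(1)] N sol[OF *] that])
  next
    fix s w z \<gamma> assume \<gamma>: "arc_in UNIV w z \<gamma>"
    show "holomorphic_periods (\<lambda>\<Omega>. \<xi> s \<Omega> (z, path_class (- pole_set N a \<Omega>) \<gamma>) w)
        {\<Omega>. \<forall>x\<in>path_image \<gamma>. (\<Omega>, x) \<in> generic_locus N a}"
      unfolding \<xi>_def by (rule wkb_holomorphic_periods[OF gen _ \<gamma>]) (rule mero)
  next
    fix s and \<Omega> :: "('n, 'g) periods" assume "\<Omega> \<in> siegel_prod"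
    then show "locally_holomorphic_in_both (- pole_set N a \<Omega>) (\<lambda>p w. \<xi> s \<Omega> p w)"
      unfolding \<xi>_def by (intro wkb_locally_holomorphic_in_both S A)
  next
    fix \<alpha> \<Omega> w z \<gamma> assume "\<alpha> \<in> \<Gamma>" "\<Omega> \<in> siegel_prod" "arc_in (- pole_set N a \<Omega>) w z \<gamma>"
    then show "let j = aut_factor \<phi> \<alpha> \<Omega>;
               \<Omega>' = Sp_act \<phi> \<alpha> \<Omega>;
               p = (z, path_class (- pole_set N a \<Omega>) \<gamma>);
               p' = (z / j, path_class (- pole_set N a \<Omega>') (\<lambda>t. \<gamma> t / j))
           in formal_subst j (Psi (w / j) (\<lambda>s q. \<xi> s \<Omega>' q (w / j)) p')
                = Psi w (\<lambda>s q. \<xi> s \<Omega> q w) p \<and>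
              (\<forall>s. \<xi> s \<Omega>' p' (w / j) = j ^ s * \<xi> s \<Omega> p w)"
      unfolding Let_def by (rule law[OF _ _ _ refl refl refl refl])
  qed
qed

end
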